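(* Let $\mathbb{A}$ be a symmetric strict monoidal category, let $\mathsf{T}(\mathbb{A})$ be the spatial strict monoidal category presented by the generators and equations given in the context, let $\mathbf{H}\,\mathcal{C}(\mathbb{A})$ be the strict monoidal category of horizontal cells of the free cornering of $\mathbb{A}$, and let $M:\mathsf{T}(\mathbb{A})\to\mathbf{H}\,\mathcal{C}(\mathbb{A})$ be the strict monoidal functor given in the context. Then $M$ is full, faithful, and identity-on-objects.
   Context: Single-object double categories. A single-object double category $\mathbb{D}$ consists of a monoid $(\mathbb{D}_H,\otimes,I)$ of horizontal edges, a monoid $(\mathbb{D}_V,\otimes,I)$ of vertical edges, and cells $\alpha$, each with a top and a bottom boundary in $\mathbb{D}_H$ and a left and a right boundary in $\mathbb{D}_V$. If the right boundary of $\alpha$ equals the left boundary of $\beta$ there is a horizontal composite $\alpha\vert\beta$ (top/bottom boundaries are multiplied in the order $\alpha,\beta$; left boundary that of $\alpha$, right boundary that of $\beta$). If the bottom boundary of $\alpha$ equals the top boundary of $\beta$ there is a vertical composite $\frac{\alpha}{\beta}$ (left/right boundaries multiplied in the order $\alpha,\beta$; top that of $\alpha$, bottom that of $\beta$). Both compositions are associative and unital, with identity cells $1_A$ for $A\in\mathbb{D}_H$ (top $=$ bottom $=A$, left $=$ right $=I$; identities for vertical composition) and $1_X$ for $X\in\mathbb{D}_V$ (left $=$ right $=X$, top $=$ bottom $=I$; identities for horizontal composition), with $1_A\vert 1_B=1_{A\otimes B}$, $\frac{1_X}{1_Y}=1_{X\otimes Y}$, the two identity cells on $I$ coincide, and the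 interchange law $\frac{\alpha}{\beta}\big\vert\frac{\gamma}{\delta}=\frac{\alpha\vert\gamma}{\beta\vert\delta}$ holds. Horizontal cells. $\mathbf{H}\mathbb{D}$ is the strict monoidal category with object set $\mathbb{D}_V$, whose morphisms $X\to Y$ are cells with left boundary $X$, right boundary $Y$ and top and bottom boundary $I$; composition is horizontal composition, and the tensor product is vertical composition, $h\otimes k=\frac{h}{k}$. Free cornering. For a symmetric strict monoidal category $\mathbb{A}$ (with object set $\mathbb{A}_0$ and braiding $\sigma_{A,B}:A\otimes B\to B\otimes A$), $\mathcal{C}(\mathbb{A})$ is the free single-object double category determined by: horizontal edge monoid $(\mathbb{A}_0,\otimes,I)$; vertical edge monoid the free monoid $\mathbb{A}^{\circ\bullet}=(\mathbb{A}_0\times\{\circ,\bullet\})^*$, with generators written $A^\circ$, $A^\bullet$, product written $\otimes$ and unit $I$; generating cells, for each $A\in\mathbb{A}_0$, the corners (boundaries not mentioned are $I$) - $s^\circ_A$: top $A$, right $A^\circ$; $\quad r^\circ_A$: left $A^\circ$, bottom $A$; - $s^\bullet_A$: top $A$, left $A^\bullet$; $\quad r^\bullet_A$: right $A^\bullet$, bottom $A$; and, for each morphism $f:A\to B$ of $\mathbb{A}$, a cell $\ulcorner f\urcorner$ with top $A$, bottom $B$; subject to the yanking equations $s^\circ_A\vert r^\circ_A=1_A$, $\frac{r^\circ_A}{s^\circ_A}=1_{A^\circ}$, $r^\bullet_A\vert s^\bullet_A=1_A$, $\frac{r^\bullet_A}{s^\bullet_A}=1_{A^\bullet}$, and the equations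 $\frac{\ulcorner f\urcorner}{\ulcorner g\urcorner}=\ulcorner f;g\urcorner$ (for composable $f,g$; $f;g$ is "first $f$ then $g$"), $\ulcorner 1_A\urcorner=1_A$, $\ulcorner f\urcorner\vert\ulcorner g\urcorner=\ulcorner f\otimes g\urcorner$. The category $\mathsf{T}(\mathbb{A})$. A strict monoidal category is spatial if $h\otimes 1_X=1_X\otimes h$ for every object $X$ and $h:I\to I$. $\mathsf{T}(\mathbb{A})$ is the free spatial strict monoidal category with generating objects $A^\circ,A^\bullet$ for $A\in\mathbb{A}_0$, and generating morphisms, for all $A,B\in\mathbb{A}_0$ and $f:A\to B$ in $\mathbb{A}$: $f^\circ:A^\circ\to B^\circ$; $f^\bullet:B^\bullet\to A^\bullet$; $\triangleleft_{A,B}:(A\otimes B)^\circ\to A^\circ\otimes B^\circ$; $\triangleright_{A,B}:A^\circ\otimes B^\circ\to(A\otimes B)^\circ$; $\blacktriangleleft_{A,B}:(A\otimes B)^\bullet\to A^\bullet\otimes B^\bullet$; $\blacktriangleright_{A,B}:A^\bullet\otimes B^\bullet\to(A\otimes B)^\bullet$; $\iota^\circ:I\to I^\circ$; $\kappa^\circ:I^\circ\to I$; $\iota^\bullet:I\to I^\bullet$; $\kappa^\bullet:I^\bullet\to I$; $\sigma^\circ_{A,B}:A^\circ\otimes B^\circ\to B^\circ\otimes A^\circ$; $\sigma^\bullet_{A,B}:A^\bullet\otimes B^\bullet\to B^\bullet\otimes A^\bullet$; $\eta_A:I\to A^\bullet\otimes A^\circ$; $\varepsilon_A:A^\circ\otimes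 A^\bullet\to I$. The equations are as follows (composition written $;$ in diagrammatic order, $1$ denoting identities of the evident type, for all objects and morphisms of $\mathbb{A}$). In (1)–(6) the equations are stated for $\circ$; the same equations are also imposed with $\triangleleft,\triangleright,\iota^\circ,\kappa^\circ,\sigma^\circ$ replaced by $\blacktriangleleft,\blacktriangleright,\iota^\bullet,\kappa^\bullet,\sigma^\bullet$, $A^\circ$ by $A^\bullet$, and $f^\circ:A^\circ\to B^\circ$ by $f^\bullet:B^\bullet\to A^\bullet$. (1) $\triangleleft_{A,B};\triangleright_{A,B}=1$; $\triangleright_{A,B};\triangleleft_{A,B}=1$; $(\triangleright_{A,B}\otimes 1);\triangleright_{A\otimes B,C}=(1\otimes\triangleright_{B,C});\triangleright_{A,B\otimes C}$; $\triangleleft_{A\otimes B,C};(\triangleleft_{A,B}\otimes 1)=\triangleleft_{A,B\otimes C};(1\otimes\triangleleft_{B,C})$. (2) $\iota^\circ;\kappa^\circ=1$; $\kappa^\circ;\iota^\circ=1$. (3) $(\iota^\circ\otimes 1);\triangleright_{I,A}=1$; $(1\otimes\iota^\circ);\triangleright_{A,I}=1$; $\triangleleft_{I,A};(\kappa^\circ\otimes 1)=1$; $\triangleleft_{A,I};(1\otimes\kappa^\circ)=1$; $\iota^\circ;\triangleleft_{I,I}=\iota^\circ\otimes\iota^\circ$; $\triangleright_{I,I};\kappa^\circ=\kappa^\circ\otimes\kappa^\circ$. (4) $(f^\circ\otimes 1);\sigma^\circ=\sigma^\circ;(1\otimes f^\circ)$; $(1\otimes f^\circ);\sigma^\circ=\sigma^\circ;(f^\circ\otimes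 1)$. (5) $(\triangleright_{A,B}\otimes 1);\sigma^\circ_{A\otimes B,C}=(1\otimes\sigma^\circ_{B,C});(\sigma^\circ_{A,C}\otimes 1);(1\otimes\triangleright_{A,B})$; $(1\otimes\triangleright_{B,C});\sigma^\circ_{A,B\otimes C}=(\sigma^\circ_{A,B}\otimes 1);(1\otimes\sigma^\circ_{A,C});(\triangleright_{B,C}\otimes 1)$; $\sigma^\circ_{A\otimes B,C};(1\otimes\triangleleft_{A,B})=(\triangleleft_{A,B}\otimes 1);(1\otimes\sigma^\circ_{B,C});(\sigma^\circ_{A,C}\otimes 1)$; $\sigma^\circ_{A,B\otimes C};(\triangleleft_{B,C}\otimes 1)=(1\otimes\triangleleft_{B,C});(\sigma^\circ_{A,B}\otimes 1);(1\otimes\sigma^\circ_{A,C})$. (6) $(\iota^\circ\otimes 1);\sigma^\circ_{I,A}=1\otimes\iota^\circ$; $(1\otimes\iota^\circ);\sigma^\circ_{A,I}=\iota^\circ\otimes 1$; $\sigma^\circ_{I,A};(1\otimes\kappa^\circ)=\kappa^\circ\otimes 1$; $\sigma^\circ_{A,I};(\kappa^\circ\otimes 1)=1\otimes\kappa^\circ$. (7) $(1_{A^\circ}\otimes\eta_A);(\varepsilon_A\otimes 1_{A^\circ})=1_{A^\circ}$; $(\eta_A\otimes 1_{A^\bullet});(1_{A^\bullet}\otimes\varepsilon_A)=1_{A^\bullet}$; for $f:A\to B$: $\eta_A;(1\otimes f^\circ)=\eta_B;(f^\bullet\otimes 1)$ and $(f^\circ\otimes 1);\varepsilon_B=(1\otimes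 f^\bullet);\varepsilon_A$. (8) With $N_{A,B}=\eta_B;(1\otimes\eta_A\otimes 1):I\to B^\bullet\otimes A^\bullet\otimes A^\circ\otimes B^\circ$ and $E_{A,B}=(1\otimes\varepsilon_B\otimes 1);\varepsilon_A:A^\circ\otimes B^\circ\otimes B^\bullet\otimes A^\bullet\to I$: $N_{A,B};(1\otimes\sigma^\circ_{A,B})=N_{B,A};(\sigma^\bullet_{A,B}\otimes 1)$ and $(\sigma^\circ_{A,B}\otimes 1);E_{B,A}=(1\otimes\sigma^\bullet_{A,B});E_{A,B}$. (9) $\eta_{A\otimes B};(\blacktriangleleft_{A,B}\otimes 1)=N_{B,A};(1\otimes\sigma^\circ_{B,A});(1\otimes\triangleright_{A,B})$; $\eta_{A\otimes B};(1\otimes\triangleleft_{A,B})=N_{A,B};(\sigma^\bullet_{B,A}\otimes 1);(\blacktriangleright_{A,B}\otimes 1)$; $(\triangleright_{A,B}\otimes 1);\varepsilon_{A\otimes B}=(1\otimes\blacktriangleleft_{A,B});(1\otimes\sigma^\bullet_{A,B});E_{A,B}$; $(1\otimes\blacktriangleright_{A,B});\varepsilon_{A\otimes B}=(\triangleleft_{A,B}\otimes 1);(\sigma^\circ_{A,B}\otimes 1);E_{B,A}$. (10) $f^\circ;g^\circ=(f;g)^\circ$; $\triangleleft;(f^\circ\otimes g^\circ);\triangleright=(f\otimes g)^\circ$; $(1_A)^\circ=1_{A^\circ}$; $\triangleright_{A,B};(\sigma_{A,B})^\circ;\triangleleft_{B,A}=\sigma^\circ_{A,B}$; $g^\bullet;f^\bullet=(f;g)^\bullet$;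 $\blacktriangleleft;(f^\bullet\otimes g^\bullet);\blacktriangleright=(f\otimes g)^\bullet$; $(1_A)^\bullet=1_{A^\bullet}$; $\blacktriangleright_{A,B};(\sigma_{B,A})^\bullet;\blacktriangleleft_{B,A}=\sigma^\bullet_{A,B}$. The functor $M$. $M$ is the strict monoidal functor with $M(X)=X$ on objects (both categories have object set $\mathbb{A}^{\circ\bullet}$), given on generators by the following vertical composites of cells, listed from top to bottom: $M(f^\circ)$: $r^\circ_A,\ulcorner f\urcorner,s^\circ_B$; $M(f^\bullet)$: $r^\bullet_A,\ulcorner f\urcorner,s^\bullet_B$; $M(\triangleleft_{A,B})$: $r^\circ_{A\otimes B},\ulcorner\sigma_{A,B}\urcorner,1_B\vert s^\circ_A,s^\circ_B$; $M(\triangleright_{A,B})$: $r^\circ_A,\;r^\circ_B\vert 1_A,\;\ulcorner\sigma_{B,A}\urcorner,\;s^\circ_{A\otimes B}$; $M(\blacktriangleleft_{A,B})$: $r^\bullet_A,\;1_A\vert r^\bullet_B,\;s^\bullet_{A\otimes B}$; $M(\blacktriangleright_{A,B})$: $r^\bullet_{A\otimes B},\;s^\bullet_A\vert 1_B,\;s^\bullet_B$; $M(\iota^\circ)=s^\circ_I$, $M(\kappa^\circ)=r^\circ_I$, $M(\iota^\bullet)=r^\bullet_I$, $M(\kappa^\bullet)=s^\bullet_I$; $M(\sigma^\circ_{A,B})$: $r^\circ_A,\;r^\circ_B\vert 1_A,\;\ulcorner\sigma_{B,A}\urcorner,\;1_A\vert s^\circ_B,\;s^\circ_A$; $M(\sigma^\bullet_{A,B})$: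 $r^\bullet_B,\;1_B\vert r^\bullet_A,\;\ulcorner\sigma_{B,A}\urcorner,\;s^\bullet_A\vert 1_B,\;s^\bullet_B$; $M(\eta_A)$: $r^\bullet_A,s^\circ_A$; $\quad M(\varepsilon_A)$: $r^\circ_A,s^\bullet_A$. *)

theory Defs
  imports Main
begin

section \<open>Strict monoidal categories\<close>

text \<open>
  The objects form the whole type \<open>'o\<close>; the arrows form a carrier set. Composition \<open>f \<cdot> g\<close> is
  written in diagrammatic order (first \<open>f\<close>, then \<open>g\<close>).
\<close>

record ('o, 'm) smc =
  arrows :: "'m set"
  source :: "'m \<Rightarrow> 'o"
  target :: "'m \<Rightarrow> 'o"
  ident :: "'o \<Rightarrow> 'm"
  comp_arr :: "'m \<Rightarrow> 'm \<Rightarrow> 'm"  (infixr "\<cdot>\<index>" 60)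
  tensor_ob :: "'o \<Rightarrow> 'o \<Rightarrow> 'o"  (infixr "\<odot>\<index>" 72)
  unit_ob :: "'o"
  tensor_arr :: "'m \<Rightarrow> 'm \<Rightarrow> 'm"  (infixr "\<boxtimes>\<index>" 70)

definition hom :: "('o, 'm, 'r) smc_scheme \<Rightarrow> 'o \<Rightarrow> 'o \<Rightarrow> 'm set"
  where "hom C A B = {f \<in> arrows C. source C f = A \<and> target C f = B}"

locale strict_monoidal_category =
  fixes C :: "('o, 'm, 'r) smc_scheme" (structure)
  assumes ident_hom: "ident C A \<in> hom C A A"
    and comp_hom: "\<lbrakk>f \<in> hom C A B; g \<in> hom C B D\<rbrakk> \<Longrightarrow> f \<cdot> g \<in> hom C A D"
    and comp_ident_left: "f \<in> hom C A B \<Longrightarrow> ident C A \<cdot> f = f"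
    and comp_ident_right: "f \<in> hom C A B \<Longrightarrow> f \<cdot> ident C B = f"
    and comp_assoc:
      "\<lbrakk>f \<in> hom C A B; g \<in> hom C B D; h \<in> hom C D E\<rbrakk> \<Longrightarrow> (f \<cdot> g) \<cdot> h = f \<cdot> (g \<cdot> h)"
    and tensor_ob_assoc: "(A \<odot> B) \<odot> D = A \<odot> (B \<odot> D)"
    and tensor_ob_unit_left: "unit_ob C \<odot> A = A"
    and tensor_ob_unit_right: "A \<odot> unit_ob C = A"
    and tensor_hom:
      "\<lbrakk>f \<in> hom C A B; g \<in> hom C A' B'\<rbrakk> \<Longrightarrow> f \<boxtimes> g \<in> hom C (A \<odot> A') (B \<odot> B')"
    and tensor_assoc:
      "\<lbrakk>f \<in> arrows C; g \<in> arrows C; h \<in> arrows C\<rbrakk> \<Longrightarrow> (f \<boxtimes> g) \<boxtimes> h = f \<boxtimes> (g \<boxtimes> h)"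
    and tensor_unit_left: "f \<in> arrows C \<Longrightarrow> ident C (unit_ob C) \<boxtimes> f = f"
    and tensor_unit_right: "f \<in> arrows C \<Longrightarrow> f \<boxtimes> ident C (unit_ob C) = f"
    and tensor_ident: "ident C A \<boxtimes> ident C B = ident C (A \<odot> B)"
    and tensor_comp:
      "\<lbrakk>f \<in> hom C A B; g \<in> hom C B D; f' \<in> hom C A' B'; g' \<in> hom C B' D'\<rbrakk>
        \<Longrightarrow> (f \<cdot> g) \<boxtimes> (f' \<cdot> g') = (f \<boxtimes> f') \<cdot> (g \<boxtimes> g')"

locale spatial_strict_monoidal_category = strict_monoidal_category +
  assumes spatial: "h \<in> hom C (unit_ob C) (unit_ob C) \<Longrightarrow> h \<boxtimes> ident C X = ident C X \<boxtimes> h"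

record ('o, 'm) ssmc = "('o, 'm) smc" +
  braid :: "'o \<Rightarrow> 'o \<Rightarrow> 'm"  ("\<sigma>\<index>")

text \<open>
  The second hexagon and \<open>\<sigma> I A = \<sigma> A I = 1\<close> follow from the axioms below.
\<close>

locale symmetric_strict_monoidal_category = strict_monoidal_category C
  for C :: "('o, 'm, 'r) ssmc_scheme" (structure) +
  assumes braid_hom: "\<sigma> A B \<in> hom C (A \<odot> B) (B \<odot> A)"
    and braid_natural:
      "\<lbrakk>f \<in> hom C A B; g \<in> hom C A' B'\<rbrakk> \<Longrightarrow> (f \<boxtimes> g) \<cdot> \<sigma> B B' = \<sigma> A A' \<cdot> (g \<boxtimes> f)"
    and braid_symmetric: "\<sigma> A B \<cdot> \<sigma> B A = ident C (A \<odot> B)"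
    and braid_hexagon:
      "\<sigma> (A \<odot> B) D = (ident C A \<boxtimes> \<sigma> B D) \<cdot> (\<sigma> A D \<boxtimes> ident C B)"

record ('o, 'm, 'p, 'n) smfunctor =
  ob_map :: "'o \<Rightarrow> 'p"
  arr_map :: "'m \<Rightarrow> 'n"

locale strict_monoidal_functor =
  C: strict_monoidal_category C + D: strict_monoidal_category D
  for C :: "('o, 'm, 'r) smc_scheme"
    and D :: "('p, 'n, 's) smc_scheme"
    and F :: "('o, 'm, 'p, 'n) smfunctor" +
  assumes map_hom: "f \<in> hom C A B \<Longrightarrow> arr_map F f \<in> hom D (ob_map F A) (ob_map F B)"
    and map_ident: "arr_map F (ident C A) = ident D (ob_map F A)"
    and map_comp: "\<lbrakk>f \<in> hom C A B; g \<in> hom C B E\<rbrakk>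
      \<Longrightarrow> arr_map F (f \<cdot>\<^bsub>C\<^esub> g) = arr_map F f \<cdot>\<^bsub>D\<^esub> arr_map F g"
    and map_tensor_ob: "ob_map F (A \<odot>\<^bsub>C\<^esub> B) = ob_map F A \<odot>\<^bsub>D\<^esub> ob_map F B"
    and map_unit_ob: "ob_map F (unit_ob C) = unit_ob D"
    and map_tensor: "\<lbrakk>f \<in> arrows C; g \<in> arrows C\<rbrakk>
      \<Longrightarrow> arr_map F (f \<boxtimes>\<^bsub>C\<^esub> g) = arr_map F f \<boxtimes>\<^bsub>D\<^esub> arr_map F g"

definition full ::
    "('o, 'm, 'r) smc_scheme \<Rightarrow> ('p, 'n, 's) smc_scheme \<Rightarrow> ('o, 'm, 'p, 'n) smfunctor \<Rightarrow> bool"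
  where "full C D F \<longleftrightarrow>
    (\<forall>A B. \<forall>g \<in> hom D (ob_map F A) (ob_map F B). \<exists>f \<in> hom C A B. arr_map F f = g)"

definition faithful :: "('o, 'm, 'r) smc_scheme \<Rightarrow> ('o, 'm, 'p, 'n) smfunctor \<Rightarrow> bool"
  where "faithful C F \<longleftrightarrow>
    (\<forall>A B. \<forall>f \<in> hom C A B. \<forall>g \<in> hom C A B. arr_map F f = arr_map F g \<longrightarrow> f = g)"

definition identity_on_objects :: "('o, 'm, 'o, 'n) smfunctor \<Rightarrow> bool"
  where "identity_on_objects F \<longleftrightarrow> (\<forall>A. ob_map F A = A)"


section \<open>Single-object double categories\<close>

text \<open>
  \<open>'h\<close> and \<open>'v\<close> are the horizontal and vertical edges. \<open>hor a b\<close> is \<open>a\<close> to the left of \<open>b\<close>, and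
  \<open>ver a b\<close> is \<open>a\<close> above \<open>b\<close>. The cell \<open>id_h A\<close> on a horizontal edge is an identity for \<open>ver\<close>,
  the cell \<open>id_v X\<close> on a vertical edge is an identity for \<open>hor\<close>.
\<close>

record ('h, 'v, 'c) sodc =
  h_tensor :: "'h \<Rightarrow> 'h \<Rightarrow> 'h"
  h_unit :: "'h"
  v_tensor :: "'v \<Rightarrow> 'v \<Rightarrow> 'v"
  v_unit :: "'v"
  cells :: "'c set"
  top_edge :: "'c \<Rightarrow> 'h"
  bot_edge :: "'c \<Rightarrow> 'h"
  left_edge :: "'c \<Rightarrow> 'v"
  right_edge :: "'c \<Rightarrow> 'v"
  id_h :: "'h \<Rightarrow> 'c"
  id_v :: "'v \<Rightarrow> 'c"
  hor :: "'c \<Rightarrow> 'c \<Rightarrow> 'c"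
  ver :: "'c \<Rightarrow> 'c \<Rightarrow> 'c"

text \<open>Cells with left boundary \<open>X\<close>, right boundary \<open>Y\<close>, top boundary \<open>A\<close>, bottom boundary \<open>B\<close>.\<close>

definition cell :: "('h, 'v, 'c, 'r) sodc_scheme \<Rightarrow> 'v \<Rightarrow> 'v \<Rightarrow> 'h \<Rightarrow> 'h \<Rightarrow> 'c set"
  where "cell D X Y A B = {a \<in> cells D. left_edge D a = X \<and> right_edge D a = Y \<and>
    top_edge D a = A \<and> bot_edge D a = B}"

locale single_object_double_category =
  fixes D :: "('h, 'v, 'c, 'r) sodc_scheme"
  assumes h_assoc: "h_tensor D (h_tensor D A B) C = h_tensor D A (h_tensor D B C)"
    and h_unit_left: "h_tensor D (h_unit D) A = A"
    and h_unit_right: "h_tensor D A (h_unit D) = A"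
    and v_assoc: "v_tensor D (v_tensor D X Y) Z = v_tensor D X (v_tensor D Y Z)"
    and v_unit_left: "v_tensor D (v_unit D) X = X"
    and v_unit_right: "v_tensor D X (v_unit D) = X"
    and id_h_cell: "id_h D A \<in> cell D (v_unit D) (v_unit D) A A"
    and id_v_cell: "id_v D X \<in> cell D X X (h_unit D) (h_unit D)"
    and hor_cell: "\<lbrakk>a \<in> cell D X Y A B; b \<in> cell D Y Z A' B'\<rbrakk>
      \<Longrightarrow> hor D a b \<in> cell D X Z (h_tensor D A A') (h_tensor D B B')"
    and ver_cell: "\<lbrakk>a \<in> cell D X Y A B; b \<in> cell D X' Y' B C\<rbrakk>
      \<Longrightarrow> ver D a b \<in> cell D (v_tensor D X X') (v_tensor D Y Y') A C"
    and hor_assoc: "\<lbrakk>a \<in> cell D X Y A B; b \<in> cell D Y Z A' B'; c \<in> cell D Z W A'' B''\<rbrakk>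
      \<Longrightarrow> hor D (hor D a b) c = hor D a (hor D b c)"
    and ver_assoc: "\<lbrakk>a \<in> cell D X Y A B; b \<in> cell D X' Y' B B'; c \<in> cell D X'' Y'' B' B''\<rbrakk>
      \<Longrightarrow> ver D (ver D a b) c = ver D a (ver D b c)"
    and hor_unit_left: "a \<in> cell D X Y A B \<Longrightarrow> hor D (id_v D X) a = a"
    and hor_unit_right: "a \<in> cell D X Y A B \<Longrightarrow> hor D a (id_v D Y) = a"
    and ver_unit_left: "a \<in> cell D X Y A B \<Longrightarrow> ver D (id_h D A) a = a"
    and ver_unit_right: "a \<in> cell D X Y A B \<Longrightarrow> ver D a (id_h D B) = a"
    and hor_id_h: "hor D (id_h D A) (id_h D B) = id_h D (h_tensor D A B)"
    and ver_id_v: "ver D (id_v D X) (id_v D Y) = id_v D (v_tensor D X Y)"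
    and id_units: "id_h D (h_unit D) = id_v D (v_unit D)"
    and interchange:
      "\<lbrakk>a \<in> cell D X Y A B; b \<in> cell D X' Y' B C; c \<in> cell D Y Z A' B'; d \<in> cell D Y' Z' B' C'\<rbrakk>
        \<Longrightarrow> hor D (ver D a b) (ver D c d) = ver D (hor D a c) (hor D b d)"

definition horizontal_cells :: "('h, 'v, 'c, 'r) sodc_scheme \<Rightarrow> ('v, 'c) smc"
  where "horizontal_cells D = \<lparr>
    arrows = {a \<in> cells D. top_edge D a = h_unit D \<and> bot_edge D a = h_unit D},
    source = left_edge D,
    target = right_edge D,
    ident = id_v D,
    comp_arr = hor D,
    tensor_ob = v_tensor D,
    unit_ob = v_unit D,
    tensor_arr = ver D\<rparr>"

lemma hom_horizontal_cells: "hom (horizontal_cells D) X Y = cell D X Y (h_unit D) (h_unit D)"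
  by (auto simp: hom_def horizontal_cells_def cell_def)

lemma arrows_horizontal_cells_obtain:
  assumes "a \<in> arrows (horizontal_cells D)"
  obtains X Y where "a \<in> cell D X Y (h_unit D) (h_unit D)"
  using assms by (auto simp: horizontal_cells_def cell_def)

lemma (in single_object_double_category) strict_monoidal_category_horizontal_cells:
  "strict_monoidal_category (horizontal_cells D)"
proof (unfold_locales, goal_cases)
  case 1 show ?case using id_v_cell unfolding hom_horizontal_cells by (simp add: horizontal_cells_def)
next
  case 2 then show ?case using hor_cell unfolding hom_horizontal_cells
    by (fastforce simp: horizontal_cells_def h_unit_left)
next
  case 3 then show ?case using hor_unit_left unfolding hom_horizontal_cells
    by (simp add: horizontal_cells_def)
next
  case 4 then show ?case using hor_unit_right unfolding hom_horizontal_cells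
    by (simp add: horizontal_cells_def)
next
  case 5 then show ?case using hor_assoc unfolding hom_horizontal_cells
    by (simp add: horizontal_cells_def)
next
  case 6 show ?case by (simp add: horizontal_cells_def v_assoc)
next
  case 7 show ?case by (simp add: horizontal_cells_def v_unit_left)
next
  case 8 show ?case by (simp add: horizontal_cells_def v_unit_right)
next
  case 9 then show ?case using ver_cell unfolding hom_horizontal_cells
    by (simp add: horizontal_cells_def)
next
  case 10 then show ?case
    by (elim arrows_horizontal_cells_obtain) (simp add: horizontal_cells_def ver_assoc)
next
  case 11 then show ?case
    by (elim arrows_horizontal_cells_obtain)
      (simp add: horizontal_cells_def flip: id_units, rule ver_unit_left)
next
  case 12 then show ?case
    by (elim arrows_horizontal_cells_obtain)
      (simp add: horizontal_cells_def flip: id_units, rule ver_unit_right)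
next
  case 13 show ?case by (simp add: horizontal_cells_def ver_id_v)
next
  case 14 then show ?case using interchange unfolding hom_horizontal_cells
    by (fastforce simp: horizontal_cells_def)
qed


section \<open>Polarised objects\<close>

text \<open>\<open>White\<close> is the exponent \<open>\<circ>\<close> and \<open>Black\<close> is the exponent \<open>\<bullet>\<close>.\<close>

datatype polarity = White | Black

text \<open>The free monoid on polarised objects, with product \<open>@\<close> and unit \<open>[]\<close>.\<close>

type_synonym 'o vedge = "('o \<times> polarity) list"

abbreviation polarised :: "polarity \<Rightarrow> 'o \<Rightarrow> 'o vedge"
  where "polarised p A \<equiv> [(A, p)]"

abbreviation white :: "'o \<Rightarrow> 'o vedge"  ("_\<degree>" [1000] 1000)
  where "A\<degree> \<equiv> polarised White A"

abbreviation black :: "'o \<Rightarrow> 'o vedge"  ("_\<bullet>" [1000] 1000)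
  where "A\<bullet> \<equiv> polarised Black A"


section \<open>The free cornering\<close>

text \<open>
  Raw terms for the cells. \<open>Send White A\<close>, \<open>Recv White A\<close>, \<open>Send Black A\<close>, \<open>Recv Black A\<close> are
  the corners \<open>s\<degree>\<close>, \<open>r\<degree>\<close>, \<open>s\<bullet>\<close>, \<open>r\<bullet>\<close> on \<open>A\<close>. \<open>a \<parallel> b\<close> is horizontal composition, and
  \<open>a \<Down> b\<close> is vertical composition with \<open>a\<close> above \<open>b\<close>.
\<close>

datatype ('o, 'm) cterm =
    IdH 'o
  | IdV "'o vedge"
  | Send polarity 'o
  | Recv polarity 'o
  | Lift 'm
  | HorC "('o, 'm) cterm" "('o, 'm) cterm"  (infixr "\<parallel>" 70)
  | VerC "('o, 'm) cterm" "('o, 'm) cterm"  (infixr "\<Down>" 60)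

primrec topC :: "('o, 'm) ssmc \<Rightarrow> ('o, 'm) cterm \<Rightarrow> 'o" where
  "topC \<A> (IdH A) = A"
| "topC \<A> (IdV X) = unit_ob \<A>"
| "topC \<A> (Send p A) = A"
| "topC \<A> (Recv p A) = unit_ob \<A>"
| "topC \<A> (Lift f) = source \<A> f"
| "topC \<A> (a \<parallel> b) = topC \<A> a \<odot>\<^bsub>\<A>\<^esub> topC \<A> b"
| "topC \<A> (a \<Down> b) = topC \<A> a"

primrec botC :: "('o, 'm) ssmc \<Rightarrow> ('o, 'm) cterm \<Rightarrow> 'o" where
  "botC \<A> (IdH A) = A"
| "botC \<A> (IdV X) = unit_ob \<A>"
| "botC \<A> (Send p A) = unit_ob \<A>"
| "botC \<A> (Recv p A) = A"
| "botC \<A> (Lift f) = target \<A> f"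
| "botC \<A> (a \<parallel> b) = botC \<A> a \<odot>\<^bsub>\<A>\<^esub> botC \<A> b"
| "botC \<A> (a \<Down> b) = botC \<A> b"

primrec leftC :: "('o, 'm) cterm \<Rightarrow> 'o vedge" where
  "leftC (IdH A) = []"
| "leftC (IdV X) = X"
| "leftC (Send p A) = (case p of White \<Rightarrow> [] | Black \<Rightarrow> A\<bullet>)"
| "leftC (Recv p A) = (case p of White \<Rightarrow> A\<degree> | Black \<Rightarrow> [])"
| "leftC (Lift f) = []"
| "leftC (a \<parallel> b) = leftC a"
| "leftC (a \<Down> b) = leftC a @ leftC b"

primrec rightC :: "('o, 'm) cterm \<Rightarrow> 'o vedge" where
  "rightC (IdH A) = []"
| "rightC (IdV X) = X"
| "rightC (Send p A) = (case p of White \<Rightarrow> A\<degree> | Black \<Rightarrow> [])"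
| "rightC (Recv p A) = (case p of White \<Rightarrow> [] | Black \<Rightarrow> A\<bullet>)"
| "rightC (Lift f) = []"
| "rightC (a \<parallel> b) = rightC b"
| "rightC (a \<Down> b) = rightC a @ rightC b"

primrec wfC :: "('o, 'm) ssmc \<Rightarrow> ('o, 'm) cterm \<Rightarrow> bool" where
  "wfC \<A> (IdH A) \<longleftrightarrow> True"
| "wfC \<A> (IdV X) \<longleftrightarrow> True"
| "wfC \<A> (Send p A) \<longleftrightarrow> True"
| "wfC \<A> (Recv p A) \<longleftrightarrow> True"
| "wfC \<A> (Lift f) \<longleftrightarrow> f \<in> arrows \<A>"
| "wfC \<A> (a \<parallel> b) \<longleftrightarrow> wfC \<A> a \<and> wfC \<A> b \<and> rightC a = leftC b"
| "wfC \<A> (a \<Down> b) \<longleftrightarrow> wfC \<A> a \<and> wfC \<A> b \<and> botC \<A> a = topC \<A> b"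

inductive cornering_axiom :: "('o, 'm) ssmc \<Rightarrow> ('o, 'm) cterm \<Rightarrow> ('o, 'm) cterm \<Rightarrow> bool"
  for \<A> :: "('o, 'm) ssmc" where
  yank_white_h: "cornering_axiom \<A> (Send White A \<parallel> Recv White A) (IdH A)"
| yank_white_v: "cornering_axiom \<A> (Recv White A \<Down> Send White A) (IdV (A\<degree>))"
| yank_black_h: "cornering_axiom \<A> (Recv Black A \<parallel> Send Black A) (IdH A)"
| yank_black_v: "cornering_axiom \<A> (Recv Black A \<Down> Send Black A) (IdV (A\<bullet>))"
| lift_comp: "\<lbrakk>f \<in> hom \<A> A B; g \<in> hom \<A> B C\<rbrakk>
    \<Longrightarrow> cornering_axiom \<A> (Lift f \<Down> Lift g) (Lift (f \<cdot>\<^bsub>\<A>\<^esub> g))"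
| lift_ident: "cornering_axiom \<A> (Lift (ident \<A> A)) (IdH A)"
| lift_tensor: "\<lbrakk>f \<in> arrows \<A>; g \<in> arrows \<A>\<rbrakk>
    \<Longrightarrow> cornering_axiom \<A> (Lift f \<parallel> Lift g) (Lift (f \<boxtimes>\<^bsub>\<A>\<^esub> g))"

text \<open>
  The congruence on well-formed terms generated by the axioms above and the laws of
  single-object double categories.
\<close>

inductive eqC :: "('o, 'm) ssmc \<Rightarrow> ('o, 'm) cterm \<Rightarrow> ('o, 'm) cterm \<Rightarrow> bool"
  for \<A> :: "('o, 'm) ssmc" where
  ax: "cornering_axiom \<A> a b \<Longrightarrow> eqC \<A> a b"
| refl: "wfC \<A> a \<Longrightarrow> eqC \<A> a a"
| sym: "eqC \<A> a b \<Longrightarrow> eqC \<A> b a"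
| trans: "\<lbrakk>eqC \<A> a b; eqC \<A> b c\<rbrakk> \<Longrightarrow> eqC \<A> a c"
| hor_cong: "\<lbrakk>eqC \<A> a a'; eqC \<A> b b'; rightC a = leftC b\<rbrakk> \<Longrightarrow> eqC \<A> (a \<parallel> b) (a' \<parallel> b')"
| ver_cong: "\<lbrakk>eqC \<A> a a'; eqC \<A> b b'; botC \<A> a = topC \<A> b\<rbrakk> \<Longrightarrow> eqC \<A> (a \<Down> b) (a' \<Down> b')"
| hor_assoc: "wfC \<A> ((a \<parallel> b) \<parallel> c) \<Longrightarrow> eqC \<A> ((a \<parallel> b) \<parallel> c) (a \<parallel> (b \<parallel> c))"
| ver_assoc: "wfC \<A> ((a \<Down> b) \<Down> c) \<Longrightarrow> eqC \<A> ((a \<Down> b) \<Down> c) (a \<Down> (b \<Down> c))"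
| hor_unit_left: "wfC \<A> a \<Longrightarrow> eqC \<A> (IdV (leftC a) \<parallel> a) a"
| hor_unit_right: "wfC \<A> a \<Longrightarrow> eqC \<A> (a \<parallel> IdV (rightC a)) a"
| ver_unit_left: "wfC \<A> a \<Longrightarrow> eqC \<A> (IdH (topC \<A> a) \<Down> a) a"
| ver_unit_right: "wfC \<A> a \<Longrightarrow> eqC \<A> (a \<Down> IdH (botC \<A> a)) a"
| hor_IdH: "eqC \<A> (IdH A \<parallel> IdH B) (IdH (A \<odot>\<^bsub>\<A>\<^esub> B))"
| ver_IdV: "eqC \<A> (IdV X \<Down> IdV Y) (IdV (X @ Y))"
| Id_units: "eqC \<A> (IdH (unit_ob \<A>)) (IdV [])"
| interchange: "\<lbrakk>wfC \<A> (a \<Down> b); wfC \<A> (c \<Down> d); rightC a = leftC c; rightC b = leftC d\<rbrakk>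
    \<Longrightarrow> eqC \<A> ((a \<Down> b) \<parallel> (c \<Down> d)) ((a \<parallel> c) \<Down> (b \<parallel> d))"

definition classC :: "('o, 'm) ssmc \<Rightarrow> ('o, 'm) cterm \<Rightarrow> ('o, 'm) cterm set"
  where "classC \<A> a = {b. eqC \<A> a b}"

definition free_cornering ::
    "('o, 'm) ssmc \<Rightarrow> ('o, 'o vedge, ('o, 'm) cterm set) sodc"
  where "free_cornering \<A> = \<lparr>
    h_tensor = tensor_ob \<A>,
    h_unit = unit_ob \<A>,
    v_tensor = (@),
    v_unit = [],
    cells = classC \<A> ` {a. wfC \<A> a},
    top_edge = (\<lambda>c. the_elem (topC \<A> ` c)),
    bot_edge = (\<lambda>c. the_elem (botC \<A> ` c)),
    left_edge = (\<lambda>c. the_elem (leftC ` c)),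
    right_edge = (\<lambda>c. the_elem (rightC ` c)),
    id_h = (\<lambda>A. classC \<A> (IdH A)),
    id_v = (\<lambda>X. classC \<A> (IdV X)),
    hor = (\<lambda>c d. \<Union>a \<in> c. \<Union>b \<in> d. classC \<A> (a \<parallel> b)),
    ver = (\<lambda>c d. \<Union>a \<in> c. \<Union>b \<in> d. classC \<A> (a \<Down> b))\<rparr>"


section \<open>The category T\<close>

text \<open>
  Raw terms for the morphisms. For \<open>p = White\<close> and \<open>p = Black\<close> respectively, \<open>Map p f\<close> is
  \<open>f\<degree>\<close> and \<open>f\<bullet>\<close>, \<open>Split p A B\<close> is \<open>\<triangleleft>\<close> and its black version, \<open>Merge p A B\<close> is
  \<open>\<triangleright>\<close> and its black version, and \<open>Iota p\<close>, \<open>Kappa p\<close>, \<open>Swap p A B\<close> are \<open>\<iota>\<close>, \<open>\<kappa>\<close>, \<open>\<sigma>\<close>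
  with the exponent \<open>p\<close>. Composition \<open>s ;; t\<close> is in diagrammatic order.
\<close>

datatype ('o, 'm) tterm =
    Idn "'o vedge"
  | Map polarity 'm
  | Split polarity 'o 'o
  | Merge polarity 'o 'o
  | Iota polarity
  | Kappa polarity
  | Swap polarity 'o 'o
  | Eta 'o
  | Eps 'o
  | SeqT "('o, 'm) tterm" "('o, 'm) tterm"  (infixr ";;" 60)
  | TenT "('o, 'm) tterm" "('o, 'm) tterm"  (infixr "\<otimes>" 70)

primrec srcT :: "('o, 'm) ssmc \<Rightarrow> ('o, 'm) tterm \<Rightarrow> 'o vedge" where
  "srcT \<A> (Idn X) = X"
| "srcT \<A> (Map p f) = (case p of White \<Rightarrow> (source \<A> f)\<degree> | Black \<Rightarrow> (target \<A> f)\<bullet>)"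
| "srcT \<A> (Split p A B) = polarised p (A \<odot>\<^bsub>\<A>\<^esub> B)"
| "srcT \<A> (Merge p A B) = polarised p A @ polarised p B"
| "srcT \<A> (Iota p) = []"
| "srcT \<A> (Kappa p) = polarised p (unit_ob \<A>)"
| "srcT \<A> (Swap p A B) = polarised p A @ polarised p B"
| "srcT \<A> (Eta A) = []"
| "srcT \<A> (Eps A) = A\<degree> @ A\<bullet>"
| "srcT \<A> (s ;; t) = srcT \<A> s"
| "srcT \<A> (s \<otimes> t) = srcT \<A> s @ srcT \<A> t"

primrec tgtT :: "('o, 'm) ssmc \<Rightarrow> ('o, 'm) tterm \<Rightarrow> 'o vedge" where
  "tgtT \<A> (Idn X) = X"
| "tgtT \<A> (Map p f) = (case p of White \<Rightarrow> (target \<A> f)\<degree> | Black \<Rightarrow> (source \<A> f)\<bullet>)"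
| "tgtT \<A> (Split p A B) = polarised p A @ polarised p B"
| "tgtT \<A> (Merge p A B) = polarised p (A \<odot>\<^bsub>\<A>\<^esub> B)"
| "tgtT \<A> (Iota p) = polarised p (unit_ob \<A>)"
| "tgtT \<A> (Kappa p) = []"
| "tgtT \<A> (Swap p A B) = polarised p B @ polarised p A"
| "tgtT \<A> (Eta A) = A\<bullet> @ A\<degree>"
| "tgtT \<A> (Eps A) = []"
| "tgtT \<A> (s ;; t) = tgtT \<A> t"
| "tgtT \<A> (s \<otimes> t) = tgtT \<A> s @ tgtT \<A> t"

primrec wfT :: "('o, 'm) ssmc \<Rightarrow> ('o, 'm) tterm \<Rightarrow> bool" where
  "wfT \<A> (Idn X) \<longleftrightarrow> True"
| "wfT \<A> (Map p f) \<longleftrightarrow> f \<in> arrows \<A>"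
| "wfT \<A> (Split p A B) \<longleftrightarrow> True"
| "wfT \<A> (Merge p A B) \<longleftrightarrow> True"
| "wfT \<A> (Iota p) \<longleftrightarrow> True"
| "wfT \<A> (Kappa p) \<longleftrightarrow> True"
| "wfT \<A> (Swap p A B) \<longleftrightarrow> True"
| "wfT \<A> (Eta A) \<longleftrightarrow> True"
| "wfT \<A> (Eps A) \<longleftrightarrow> True"
| "wfT \<A> (s ;; t) \<longleftrightarrow> wfT \<A> s \<and> wfT \<A> t \<and> tgtT \<A> s = srcT \<A> t"
| "wfT \<A> (s \<otimes> t) \<longleftrightarrow> wfT \<A> s \<and> wfT \<A> t"

text \<open>The nested units and counits \<open>N\<close> and \<open>E\<close>.\<close>

definition EtaN :: "'o \<Rightarrow> 'o \<Rightarrow> ('o, 'm) tterm"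
  where "EtaN A B = Eta B ;; (Idn (B\<bullet>) \<otimes> Eta A \<otimes> Idn (B\<degree>))"

definition EpsN :: "'o \<Rightarrow> 'o \<Rightarrow> ('o, 'm) tterm"
  where "EpsN A B = (Idn (A\<degree>) \<otimes> Eps B \<otimes> Idn (A\<bullet>)) ;; Eps A"

text \<open>
  Rules with a polarity \<open>p\<close> stand for both the white equation and the corresponding black one.
  Since \<open>f\<bullet>\<close> is contravariant in \<open>f\<close>, the equations involving \<open>Map\<close> are given separately.
\<close>

inductive T_axiom :: "('o, 'm) ssmc \<Rightarrow> ('o, 'm) tterm \<Rightarrow> ('o, 'm) tterm \<Rightarrow> bool"
  for \<A> :: "('o, 'm) ssmc" where
  split_merge: "T_axiom \<A> (Split p A B ;; Merge p A B) (Idn (polarised p (A \<odot>\<^bsub>\<A>\<^esub> B)))"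
| merge_split: "T_axiom \<A> (Merge p A B ;; Split p A B) (Idn (polarised p A @ polarised p B))"
| merge_assoc: "T_axiom \<A>
    ((Merge p A B \<otimes> Idn (polarised p C)) ;; Merge p (A \<odot>\<^bsub>\<A>\<^esub> B) C)
    ((Idn (polarised p A) \<otimes> Merge p B C) ;; Merge p A (B \<odot>\<^bsub>\<A>\<^esub> C))"
| split_assoc: "T_axiom \<A>
    (Split p (A \<odot>\<^bsub>\<A>\<^esub> B) C ;; (Split p A B \<otimes> Idn (polarised p C)))
    (Split p A (B \<odot>\<^bsub>\<A>\<^esub> C) ;; (Idn (polarised p A) \<otimes> Split p B C))"

| iota_kappa: "T_axiom \<A> (Iota p ;; Kappa p) (Idn [])"
| kappa_iota: "T_axiom \<A> (Kappa p ;; Iota p) (Idn (polarised p (unit_ob \<A>)))"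

| iota_merge_left: "T_axiom \<A>
    ((Iota p \<otimes> Idn (polarised p A)) ;; Merge p (unit_ob \<A>) A) (Idn (polarised p A))"
| iota_merge_right: "T_axiom \<A>
    ((Idn (polarised p A) \<otimes> Iota p) ;; Merge p A (unit_ob \<A>)) (Idn (polarised p A))"
| split_kappa_left: "T_axiom \<A>
    (Split p (unit_ob \<A>) A ;; (Kappa p \<otimes> Idn (polarised p A))) (Idn (polarised p A))"
| split_kappa_right: "T_axiom \<A>
    (Split p A (unit_ob \<A>) ;; (Idn (polarised p A) \<otimes> Kappa p)) (Idn (polarised p A))"
| iota_split: "T_axiom \<A> (Iota p ;; Split p (unit_ob \<A>) (unit_ob \<A>)) (Iota p \<otimes> Iota p)"
| merge_kappa: "T_axiom \<A> (Merge p (unit_ob \<A>) (unit_ob \<A>) ;; Kappa p) (Kappa p \<otimes> Kappa p)"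

| swap_white_left: "f \<in> hom \<A> A B \<Longrightarrow> T_axiom \<A>
    ((Map White f \<otimes> Idn (C\<degree>)) ;; Swap White B C) (Swap White A C ;; (Idn (C\<degree>) \<otimes> Map White f))"
| swap_white_right: "f \<in> hom \<A> A B \<Longrightarrow> T_axiom \<A>
    ((Idn (C\<degree>) \<otimes> Map White f) ;; Swap White C B) (Swap White C A ;; (Map White f \<otimes> Idn (C\<degree>)))"
| swap_black_left: "f \<in> hom \<A> A B \<Longrightarrow> T_axiom \<A>
    ((Map Black f \<otimes> Idn (C\<bullet>)) ;; Swap Black A C) (Swap Black B C ;; (Idn (C\<bullet>) \<otimes> Map Black f))"
| swap_black_right: "f \<in> hom \<A> A B \<Longrightarrow> T_axiom \<A>
    ((Idn (C\<bullet>) \<otimes> Map Black f) ;; Swap Black C A) (Swap Black C B ;; (Map Black f \<otimes> Idn (C\<bullet>)))"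

| merge_swap_left: "T_axiom \<A>
    ((Merge p A B \<otimes> Idn (polarised p C)) ;; Swap p (A \<odot>\<^bsub>\<A>\<^esub> B) C)
    ((Idn (polarised p A) \<otimes> Swap p B C) ;; (Swap p A C \<otimes> Idn (polarised p B)) ;;
      (Idn (polarised p C) \<otimes> Merge p A B))"
| merge_swap_right: "T_axiom \<A>
    ((Idn (polarised p A) \<otimes> Merge p B C) ;; Swap p A (B \<odot>\<^bsub>\<A>\<^esub> C))
    ((Swap p A B \<otimes> Idn (polarised p C)) ;; (Idn (polarised p B) \<otimes> Swap p A C) ;;
      (Merge p B C \<otimes> Idn (polarised p A)))"
| swap_split_left: "T_axiom \<A>
    (Swap p (A \<odot>\<^bsub>\<A>\<^esub> B) C ;; (Idn (polarised p C) \<otimes> Split p A B))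
    ((Split p A B \<otimes> Idn (polarised p C)) ;; (Idn (polarised p A) \<otimes> Swap p B C) ;;
      (Swap p A C \<otimes> Idn (polarised p B)))"
| swap_split_right: "T_axiom \<A>
    (Swap p A (B \<odot>\<^bsub>\<A>\<^esub> C) ;; (Split p B C \<otimes> Idn (polarised p A)))
    ((Idn (polarised p A) \<otimes> Split p B C) ;; (Swap p A B \<otimes> Idn (polarised p C)) ;;
      (Idn (polarised p B) \<otimes> Swap p A C))"

| iota_swap_left: "T_axiom \<A>
    ((Iota p \<otimes> Idn (polarised p A)) ;; Swap p (unit_ob \<A>) A) (Idn (polarised p A) \<otimes> Iota p)"
| iota_swap_right: "T_axiom \<A>
    ((Idn (polarised p A) \<otimes> Iota p) ;; Swap p A (unit_ob \<A>)) (Iota p \<otimes> Idn (polarised p A))"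
| swap_kappa_left: "T_axiom \<A>
    (Swap p (unit_ob \<A>) A ;; (Idn (polarised p A) \<otimes> Kappa p)) (Kappa p \<otimes> Idn (polarised p A))"
| swap_kappa_right: "T_axiom \<A>
    (Swap p A (unit_ob \<A>) ;; (Kappa p \<otimes> Idn (polarised p A))) (Idn (polarised p A) \<otimes> Kappa p)"

| snake_white: "T_axiom \<A> ((Idn (A\<degree>) \<otimes> Eta A) ;; (Eps A \<otimes> Idn (A\<degree>))) (Idn (A\<degree>))"
| snake_black: "T_axiom \<A> ((Eta A \<otimes> Idn (A\<bullet>)) ;; (Idn (A\<bullet>) \<otimes> Eps A)) (Idn (A\<bullet>))"
| eta_map: "f \<in> hom \<A> A B \<Longrightarrow> T_axiom \<A>
    (Eta A ;; (Idn (A\<bullet>) \<otimes> Map White f)) (Eta B ;; (Map Black f \<otimes> Idn (B\<degree>)))"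
| map_eps: "f \<in> hom \<A> A B \<Longrightarrow> T_axiom \<A>
    ((Map White f \<otimes> Idn (B\<bullet>)) ;; Eps B) ((Idn (A\<degree>) \<otimes> Map Black f) ;; Eps A)"

| etaN_swap: "T_axiom \<A>
    (EtaN A B ;; (Idn (B\<bullet> @ A\<bullet>) \<otimes> Swap White A B))
    (EtaN B A ;; (Swap Black A B \<otimes> Idn (B\<degree> @ A\<degree>)))"
| swap_epsN: "T_axiom \<A>
    ((Swap White A B \<otimes> Idn (A\<bullet> @ B\<bullet>)) ;; EpsN B A)
    ((Idn (A\<degree> @ B\<degree>) \<otimes> Swap Black A B) ;; EpsN A B)"

| eta_split_black: "T_axiom \<A>
    (Eta (A \<odot>\<^bsub>\<A>\<^esub> B) ;; (Split Black A B \<otimes> Idn ((A \<odot>\<^bsub>\<A>\<^esub> B)\<degree>)))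
    (EtaN B A ;; (Idn (A\<bullet> @ B\<bullet>) \<otimes> Swap White B A) ;; (Idn (A\<bullet> @ B\<bullet>) \<otimes> Merge White A B))"
| eta_split_white: "T_axiom \<A>
    (Eta (A \<odot>\<^bsub>\<A>\<^esub> B) ;; (Idn ((A \<odot>\<^bsub>\<A>\<^esub> B)\<bullet>) \<otimes> Split White A B))
    (EtaN A B ;; (Swap Black B A \<otimes> Idn (A\<degree> @ B\<degree>)) ;; (Merge Black A B \<otimes> Idn (A\<degree> @ B\<degree>)))"
| merge_white_eps: "T_axiom \<A>
    ((Merge White A B \<otimes> Idn ((A \<odot>\<^bsub>\<A>\<^esub> B)\<bullet>)) ;; Eps (A \<odot>\<^bsub>\<A>\<^esub> B))
    ((Idn (A\<degree> @ B\<degree>) \<otimes> Split Black A B) ;; (Idn (A\<degree> @ B\<degree>) \<otimes> Swap Black A B) ;; EpsN A B)"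
| merge_black_eps: "T_axiom \<A>
    ((Idn ((A \<odot>\<^bsub>\<A>\<^esub> B)\<degree>) \<otimes> Merge Black A B) ;; Eps (A \<odot>\<^bsub>\<A>\<^esub> B))
    ((Split White A B \<otimes> Idn (A\<bullet> @ B\<bullet>)) ;; (Swap White A B \<otimes> Idn (A\<bullet> @ B\<bullet>)) ;; EpsN B A)"

| map_white_comp: "\<lbrakk>f \<in> hom \<A> A B; g \<in> hom \<A> B C\<rbrakk> \<Longrightarrow> T_axiom \<A>
    (Map White f ;; Map White g) (Map White (f \<cdot>\<^bsub>\<A>\<^esub> g))"
| map_white_tensor: "\<lbrakk>f \<in> hom \<A> A B; g \<in> hom \<A> A' B'\<rbrakk> \<Longrightarrow> T_axiom \<A>
    (Split White A A' ;; (Map White f \<otimes> Map White g) ;; Merge White B B')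
    (Map White (f \<boxtimes>\<^bsub>\<A>\<^esub> g))"
| map_white_ident: "T_axiom \<A> (Map White (ident \<A> A)) (Idn (A\<degree>))"
| map_white_braid: "T_axiom \<A>
    (Merge White A B ;; Map White (\<sigma>\<^bsub>\<A>\<^esub> A B) ;; Split White B A) (Swap White A B)"
| map_black_comp: "\<lbrakk>f \<in> hom \<A> A B; g \<in> hom \<A> B C\<rbrakk> \<Longrightarrow> T_axiom \<A>
    (Map Black g ;; Map Black f) (Map Black (f \<cdot>\<^bsub>\<A>\<^esub> g))"
| map_black_tensor: "\<lbrakk>f \<in> hom \<A> A B; g \<in> hom \<A> A' B'\<rbrakk> \<Longrightarrow> T_axiom \<A>
    (Split Black B B' ;; (Map Black f \<otimes> Map Black g) ;; Merge Black A A')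
    (Map Black (f \<boxtimes>\<^bsub>\<A>\<^esub> g))"
| map_black_ident: "T_axiom \<A> (Map Black (ident \<A> A)) (Idn (A\<bullet>))"
| map_black_braid: "T_axiom \<A>
    (Merge Black A B ;; Map Black (\<sigma>\<^bsub>\<A>\<^esub> B A) ;; Split Black B A) (Swap Black A B)"

text \<open>
  The congruence on well-formed terms generated by the axioms above and the laws of spatial
  strict monoidal categories.
\<close>

inductive eqT :: "('o, 'm) ssmc \<Rightarrow> ('o, 'm) tterm \<Rightarrow> ('o, 'm) tterm \<Rightarrow> bool"
  for \<A> :: "('o, 'm) ssmc" where
  ax: "T_axiom \<A> s t \<Longrightarrow> eqT \<A> s t"
| refl: "wfT \<A> t \<Longrightarrow> eqT \<A> t t"
| sym: "eqT \<A> s t \<Longrightarrow> eqT \<A> t s"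
| trans: "\<lbrakk>eqT \<A> s t; eqT \<A> t u\<rbrakk> \<Longrightarrow> eqT \<A> s u"
| seq_cong: "\<lbrakk>eqT \<A> s s'; eqT \<A> t t'; tgtT \<A> s = srcT \<A> t\<rbrakk> \<Longrightarrow> eqT \<A> (s ;; t) (s' ;; t')"
| ten_cong: "\<lbrakk>eqT \<A> s s'; eqT \<A> t t'\<rbrakk> \<Longrightarrow> eqT \<A> (s \<otimes> t) (s' \<otimes> t')"
| seq_assoc: "wfT \<A> ((s ;; t) ;; u) \<Longrightarrow> eqT \<A> ((s ;; t) ;; u) (s ;; (t ;; u))"
| seq_ident_left: "wfT \<A> t \<Longrightarrow> eqT \<A> (Idn (srcT \<A> t) ;; t) t"
| seq_ident_right: "wfT \<A> t \<Longrightarrow> eqT \<A> (t ;; Idn (tgtT \<A> t)) t"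
| ten_assoc: "wfT \<A> ((s \<otimes> t) \<otimes> u) \<Longrightarrow> eqT \<A> ((s \<otimes> t) \<otimes> u) (s \<otimes> (t \<otimes> u))"
| ten_unit_left: "wfT \<A> t \<Longrightarrow> eqT \<A> (Idn [] \<otimes> t) t"
| ten_unit_right: "wfT \<A> t \<Longrightarrow> eqT \<A> (t \<otimes> Idn []) t"
| ten_ident: "eqT \<A> (Idn X \<otimes> Idn Y) (Idn (X @ Y))"
| ten_seq: "\<lbrakk>wfT \<A> (s ;; t); wfT \<A> (u ;; v)\<rbrakk>
    \<Longrightarrow> eqT \<A> ((s ;; t) \<otimes> (u ;; v)) ((s \<otimes> u) ;; (t \<otimes> v))"
| spatial: "\<lbrakk>wfT \<A> h; srcT \<A> h = []; tgtT \<A> h = []\<rbrakk> \<Longrightarrow> eqT \<A> (h \<otimes> Idn X) (Idn X \<otimes> h)"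

definition classT :: "('o, 'm) ssmc \<Rightarrow> ('o, 'm) tterm \<Rightarrow> ('o, 'm) tterm set"
  where "classT \<A> t = {u. eqT \<A> t u}"

definition T_category :: "('o, 'm) ssmc \<Rightarrow> ('o vedge, ('o, 'm) tterm set) smc"
  where "T_category \<A> = \<lparr>
    arrows = classT \<A> ` {t. wfT \<A> t},
    source = (\<lambda>c. the_elem (srcT \<A> ` c)),
    target = (\<lambda>c. the_elem (tgtT \<A> ` c)),
    ident = (\<lambda>X. classT \<A> (Idn X)),
    comp_arr = (\<lambda>c d. \<Union>s \<in> c. \<Union>t \<in> d. classT \<A> (s ;; t)),
    tensor_ob = (@),
    unit_ob = [],
    tensor_arr = (\<lambda>c d. \<Union>s \<in> c. \<Union>t \<in> d. classT \<A> (s \<otimes> t))\<rparr>"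


section \<open>The functor M\<close>

primrec M_term :: "('o, 'm) ssmc \<Rightarrow> ('o, 'm) tterm \<Rightarrow> ('o, 'm) cterm" where
  "M_term \<A> (Idn X) = IdV X"
| "M_term \<A> (Map p f) = (case p of
      White \<Rightarrow> Recv White (source \<A> f) \<Down> Lift f \<Down> Send White (target \<A> f)
    | Black \<Rightarrow> Recv Black (source \<A> f) \<Down> Lift f \<Down> Send Black (target \<A> f))"
| "M_term \<A> (Split p A B) = (case p of
      White \<Rightarrow> Recv White (A \<odot>\<^bsub>\<A>\<^esub> B) \<Down> Lift (\<sigma>\<^bsub>\<A>\<^esub> A B) \<Down> (IdH B \<parallel> Send White A) \<Down> Send White B
    | Black \<Rightarrow> Recv Black A \<Down> (IdH A \<parallel> Recv Black B) \<Down> Send Black (A \<odot>\<^bsub>\<A>\<^esub> B))"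
| "M_term \<A> (Merge p A B) = (case p of
      White \<Rightarrow> Recv White A \<Down> (Recv White B \<parallel> IdH A) \<Down> Lift (\<sigma>\<^bsub>\<A>\<^esub> B A) \<Down> Send White (A \<odot>\<^bsub>\<A>\<^esub> B)
    | Black \<Rightarrow> Recv Black (A \<odot>\<^bsub>\<A>\<^esub> B) \<Down> (Send Black A \<parallel> IdH B) \<Down> Send Black B)"
| "M_term \<A> (Iota p) = (case p of
      White \<Rightarrow> Send White (unit_ob \<A>) | Black \<Rightarrow> Recv Black (unit_ob \<A>))"
| "M_term \<A> (Kappa p) = (case p of
      White \<Rightarrow> Recv White (unit_ob \<A>) | Black \<Rightarrow> Send Black (unit_ob \<A>))"
| "M_term \<A> (Swap p A B) = (case p of
      White \<Rightarrow> Recv White A \<Down> (Recv White B \<parallel> IdH A) \<Down> Lift (\<sigma>\<^bsub>\<A>\<^esub> B A) \<Down>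
        (IdH A \<parallel> Send White B) \<Down> Send White A
    | Black \<Rightarrow> Recv Black B \<Down> (IdH B \<parallel> Recv Black A) \<Down> Lift (\<sigma>\<^bsub>\<A>\<^esub> B A) \<Down>
        (Send Black A \<parallel> IdH B) \<Down> Send Black B)"
| "M_term \<A> (Eta A) = Recv Black A \<Down> Send White A"
| "M_term \<A> (Eps A) = Recv White A \<Down> Send Black A"
| "M_term \<A> (s ;; t) = M_term \<A> s \<parallel> M_term \<A> t"
| "M_term \<A> (s \<otimes> t) = M_term \<A> s \<Down> M_term \<A> t"

text \<open>
  The image of a class is the union of the classes of the images of all its members, so it is
  a cell of the free cornering only if these images are all equal there.
\<close>

definition M_functor ::
    "('o, 'm) ssmc \<Rightarrow> ('o vedge, ('o, 'm) tterm set, 'o vedge, ('o, 'm) cterm set) smfunctor"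
  where "M_functor \<A> = \<lparr>
    ob_map = (\<lambda>X. X),
    arr_map = (\<lambda>c. \<Union>t \<in> c. classC \<A> (M_term \<A> t))\<rparr>"


section \<open>The constructions are well defined\<close>

lemma UN2_const:
  assumes "a \<in> S" "b \<in> T" and "\<And>x y. x \<in> S \<Longrightarrow> y \<in> T \<Longrightarrow> F x y = K"
  shows "(\<Union>x \<in> S. \<Union>y \<in> T. F x y) = K"
proof -
  have "(\<Union>x \<in> S. \<Union>y \<in> T. F x y) = (\<Union>x \<in> S. \<Union>y \<in> T. K)" using assms(3) by simp
  then show ?thesis using assms(1,2) by auto
qed

context symmetric_strict_monoidal_category
begin

lemmas objects_simps = tensor_ob_assoc tensor_ob_unit_left tensor_ob_unit_right

lemma homD:
  assumes "f \<in> hom C A B"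
  shows "f \<in> arrows C" "source C f = A" "target C f = B"
  using assms by (auto simp: hom_def)

lemma arrows_hom: "f \<in> arrows C \<Longrightarrow> f \<in> hom C (source C f) (target C f)"
  by (simp add: hom_def)

lemmas ident_arrow = homD[OF ident_hom]
lemmas tensor_arrow = homD[OF tensor_hom[OF arrows_hom arrows_hom]]
lemmas braid_arrow = homD[OF braid_hom]

end

locale symmetric_strict_monoidal_base = symmetric_strict_monoidal_category \<A>
  for \<A> :: "('o, 'm) ssmc"
begin

lemma eqC_boundary:
  assumes "eqC \<A> a b"
  shows "wfC \<A> a \<and> wfC \<A> b \<and> topC \<A> a = topC \<A> b \<and> botC \<A> a = botC \<A> b \<and>
    leftC a = leftC b \<and> rightC a = rightC b"
  using assms
proof (induction rule: eqC.induct)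
  case (ax a b)
  then show ?case
  proof cases
    case (lift_comp f A B g C)
    then show ?thesis using homD[OF comp_hom[of f A B g C]] homD[of f] homD[of g] by auto
  qed (auto simp: objects_simps ident_arrow tensor_arrow)
qed (auto simp: objects_simps)

lemma classC_self: "wfC \<A> a \<Longrightarrow> a \<in> classC \<A> a"
  by (simp add: classC_def eqC.refl)

lemma classC_eq_iff: "wfC \<A> a \<Longrightarrow> classC \<A> a = classC \<A> b \<longleftrightarrow> eqC \<A> a b"
  unfolding classC_def by (auto intro: eqC.refl eqC.sym eqC.trans)

lemma classC_eqI: "eqC \<A> a b \<Longrightarrow> classC \<A> a = classC \<A> b"
  by (subst classC_eq_iff) (auto dest: eqC_boundary)

lemma free_cornering_edges:
  assumes "wfC \<A> a"
  shows "top_edge (free_cornering \<A>) (classC \<A> a) = topC \<A> a"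
    and "bot_edge (free_cornering \<A>) (classC \<A> a) = botC \<A> a"
    and "left_edge (free_cornering \<A>) (classC \<A> a) = leftC a"
    and "right_edge (free_cornering \<A>) (classC \<A> a) = rightC a"
proof -
  have "a \<in> classC \<A> a" using assms by (simp add: classC_def eqC.refl)
  then have img: "f ` classC \<A> a = {f a}" if "\<And>b. eqC \<A> a b \<Longrightarrow> f b = f a" for f :: "_ \<Rightarrow> 'b"
    using that unfolding classC_def by blast
  have "topC \<A> ` classC \<A> a = {topC \<A> a}" "botC \<A> ` classC \<A> a = {botC \<A> a}"
    by (rule img, drule eqC_boundary, simp)+
  moreover have "leftC ` classC \<A> a = {leftC a}" "rightC ` classC \<A> a = {rightC a}"
    by (rule img, drule eqC_boundary, simp)+
  ultimately show "top_edge (free_cornering \<A>) (classC \<A> a) = topC \<A> a"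
    and "bot_edge (free_cornering \<A>) (classC \<A> a) = botC \<A> a"
    and "left_edge (free_cornering \<A>) (classC \<A> a) = leftC a"
    and "right_edge (free_cornering \<A>) (classC \<A> a) = rightC a"
    by (simp_all add: free_cornering_def)
qed

lemma hor_classC:
  assumes "wfC \<A> (a \<parallel> b)"
  shows "hor (free_cornering \<A>) (classC \<A> a) (classC \<A> b) = classC \<A> (a \<parallel> b)"
proof -
  have wf: "wfC \<A> a" "wfC \<A> b" using assms by simp_all
  have eq: "classC \<A> (a' \<parallel> b') = classC \<A> (a \<parallel> b)"
    if "a' \<in> classC \<A> a" "b' \<in> classC \<A> b" for a' b'
  proof -
    have "eqC \<A> (a \<parallel> b) (a' \<parallel> b')"
      by (rule eqC.hor_cong) (use that assms in \<open>simp_all add: classC_def\<close>)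
    from classC_eqI[OF this] show ?thesis by (rule HOL.sym)
  qed
  have "hor (free_cornering \<A>) (classC \<A> a) (classC \<A> b) =
      (\<Union>a' \<in> classC \<A> a. \<Union>b' \<in> classC \<A> b. classC \<A> (a' \<parallel> b'))"
    by (simp add: free_cornering_def)
  also have "\<dots> = classC \<A> (a \<parallel> b)"
    by (rule UN2_const[OF classC_self[OF wf(1)] classC_self[OF wf(2)] eq])
  finally show ?thesis .
qed

lemma ver_classC:
  assumes "wfC \<A> (a \<Down> b)"
  shows "ver (free_cornering \<A>) (classC \<A> a) (classC \<A> b) = classC \<A> (a \<Down> b)"
proof -
  have wf: "wfC \<A> a" "wfC \<A> b" using assms by simp_all
  have eq: "classC \<A> (a' \<Down> b') = classC \<A> (a \<Down> b)"
    if "a' \<in> classC \<A> a" "b' \<in> classC \<A> b" for a' b'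
  proof -
    have "eqC \<A> (a \<Down> b) (a' \<Down> b')"
      by (rule eqC.ver_cong) (use that assms in \<open>simp_all add: classC_def\<close>)
    from classC_eqI[OF this] show ?thesis by (rule HOL.sym)
  qed
  have "ver (free_cornering \<A>) (classC \<A> a) (classC \<A> b) =
      (\<Union>a' \<in> classC \<A> a. \<Union>b' \<in> classC \<A> b. classC \<A> (a' \<Down> b'))"
    by (simp add: free_cornering_def)
  also have "\<dots> = classC \<A> (a \<Down> b)"
    by (rule UN2_const[OF classC_self[OF wf(1)] classC_self[OF wf(2)] eq])
  finally show ?thesis .
qed

lemma cell_free_cornering: "c \<in> cell (free_cornering \<A>) X Y A B \<longleftrightarrow>
    (\<exists>a. c = classC \<A> a \<and> wfC \<A> a \<and> leftC a = X \<and> rightC a = Y \<and> topC \<A> a = A \<and> botC \<A> a = B)"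
proof
  assume c: "c \<in> cell (free_cornering \<A>) X Y A B"
  then have "c \<in> cells (free_cornering \<A>)" by (simp add: cell_def)
  then obtain a where a: "c = classC \<A> a" "wfC \<A> a" by (auto simp: free_cornering_def)
  then show "\<exists>a. c = classC \<A> a \<and> wfC \<A> a \<and> leftC a = X \<and> rightC a = Y \<and> topC \<A> a = A \<and> botC \<A> a = B"
    using c by (intro exI[of _ a]) (simp add: cell_def free_cornering_edges)
next
  assume "\<exists>a. c = classC \<A> a \<and> wfC \<A> a \<and> leftC a = X \<and> rightC a = Y \<and> topC \<A> a = A \<and> botC \<A> a = B"
  then obtain a where a: "c = classC \<A> a" "wfC \<A> a" "leftC a = X" "rightC a = Y"
    "topC \<A> a = A" "botC \<A> a = B" by blast
  moreover have "c \<in> cells (free_cornering \<A>)" using a by (simp add: free_cornering_def)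
  ultimately show "c \<in> cell (free_cornering \<A>) X Y A B"
    by (simp add: cell_def free_cornering_edges)
qed

lemma free_cornering_simps:
  "h_tensor (free_cornering \<A>) = tensor_ob \<A>" "h_unit (free_cornering \<A>) = unit_ob \<A>"
  "v_tensor (free_cornering \<A>) = (@)" "v_unit (free_cornering \<A>) = []"
  "id_h (free_cornering \<A>) A = classC \<A> (IdH A)" "id_v (free_cornering \<A>) X = classC \<A> (IdV X)"
  by (simp_all add: free_cornering_def)

theorem free_cornering_double_category: "single_object_double_category (free_cornering \<A>)"
proof (unfold_locales, unfold cell_free_cornering free_cornering_simps, goal_cases)
  case 1 show ?case by (simp add: objects_simps)
next
  case 2 show ?case by (simp add: objects_simps)
next
  case 3 show ?case by (simp add: objects_simps)
next
  case 4 show ?case by (simp add: objects_simps)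
next
  case 5 show ?case by (simp add: objects_simps)
next
  case 6 show ?case by (simp add: objects_simps)
next
  case (7 A) show ?case by (intro exI[of _ "IdH A"]) simp
next
  case (8 X) show ?case by (intro exI[of _ "IdV X"]) simp
next
  case 9
  then show ?case
    by (elim exE conjE, hypsubst) (intro exI conjI, rule hor_classC, simp_all)
next
  case 10
  then show ?case
    by (elim exE conjE, hypsubst) (intro exI conjI, rule ver_classC, simp_all)
next
  case 11
  then show ?case
    by (elim exE conjE, hypsubst) (simp add: hor_classC ver_classC, rule classC_eqI, rule eqC.hor_assoc, simp)
next
  case 12
  then show ?case
    by (elim exE conjE, hypsubst) (simp add: hor_classC ver_classC, rule classC_eqI, rule eqC.ver_assoc, simp)
next
  case 13
  then show ?case
    by (elim exE conjE, hypsubst) (simp add: hor_classC ver_classC, rule classC_eqI, rule eqC.hor_unit_left, simp)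
next
  case 14
  then show ?case
    by (elim exE conjE, hypsubst) (simp add: hor_classC ver_classC, rule classC_eqI, rule eqC.hor_unit_right, simp)
next
  case 15
  then show ?case
    by (elim exE conjE, hypsubst) (simp add: hor_classC ver_classC, rule classC_eqI, rule eqC.ver_unit_left, simp)
next
  case 16
  then show ?case
    by (elim exE conjE, hypsubst) (simp add: hor_classC ver_classC, rule classC_eqI, rule eqC.ver_unit_right, simp)
next
  case 17 show ?case by (simp add: hor_classC classC_eqI eqC.hor_IdH)
next
  case 18 show ?case by (simp add: ver_classC classC_eqI eqC.ver_IdV)
next
  case 19 show ?case by (rule classC_eqI) (rule eqC.Id_units)
next
  case 20
  then show ?case
    by (elim exE conjE, hypsubst) (simp add: hor_classC ver_classC, rule classC_eqI, rule eqC.interchange, simp_all)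
qed

lemma eqT_boundary:
  assumes "eqT \<A> s t"
  shows "wfT \<A> s \<and> wfT \<A> t \<and> srcT \<A> s = srcT \<A> t \<and> tgtT \<A> s = tgtT \<A> t"
  using assms
proof (induction rule: eqT.induct)
  case (ax s t)
  then show ?case
  proof cases
    case (map_white_comp f A B g C)
    then show ?thesis using homD[OF comp_hom[of f A B g C]] homD[of f] homD[of g] by auto
  next
    case (map_black_comp f A B g C)
    then show ?thesis using homD[OF comp_hom[of f A B g C]] homD[of f] homD[of g] by auto
  qed (auto simp: objects_simps ident_arrow tensor_arrow braid_arrow EtaN_def EpsN_def hom_def
      split: polarity.splits)
qed auto

lemma classT_self: "wfT \<A> t \<Longrightarrow> t \<in> classT \<A> t"
  by (simp add: classT_def eqT.refl)

lemma classT_eq_iff: "wfT \<A> s \<Longrightarrow> classT \<A> s = classT \<A> t \<longleftrightarrow> eqT \<A> s t"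
  unfolding classT_def by (auto intro: eqT.refl eqT.sym eqT.trans)

lemma classT_eqI: "eqT \<A> s t \<Longrightarrow> classT \<A> s = classT \<A> t"
  by (subst classT_eq_iff) (auto dest: eqT_boundary)

lemma T_category_source_target:
  assumes "wfT \<A> t"
  shows "source (T_category \<A>) (classT \<A> t) = srcT \<A> t"
    and "target (T_category \<A>) (classT \<A> t) = tgtT \<A> t"
proof -
  have "t \<in> classT \<A> t" using assms by (simp add: classT_def eqT.refl)
  then have img: "f ` classT \<A> t = {f t}" if "\<And>u. eqT \<A> t u \<Longrightarrow> f u = f t" for f
    using that unfolding classT_def by blast
  have "srcT \<A> ` classT \<A> t = {srcT \<A> t}" "tgtT \<A> ` classT \<A> t = {tgtT \<A> t}"
    by (rule img, drule eqT_boundary, simp)+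
  then show "source (T_category \<A>) (classT \<A> t) = srcT \<A> t"
    and "target (T_category \<A>) (classT \<A> t) = tgtT \<A> t"
    by (simp_all add: T_category_def)
qed

lemma seq_classT:
  assumes "wfT \<A> (s ;; t)"
  shows "comp_arr (T_category \<A>) (classT \<A> s) (classT \<A> t) = classT \<A> (s ;; t)"
proof -
  have wf: "wfT \<A> s" "wfT \<A> t" using assms by simp_all
  have eq: "classT \<A> (s' ;; t') = classT \<A> (s ;; t)"
    if "s' \<in> classT \<A> s" "t' \<in> classT \<A> t" for s' t'
  proof -
    have "eqT \<A> (s ;; t) (s' ;; t')"
      by (rule eqT.seq_cong) (use that assms in \<open>simp_all add: classT_def\<close>)
    from classT_eqI[OF this] show ?thesis by (rule HOL.sym)
  qed
  have "comp_arr (T_category \<A>) (classT \<A> s) (classT \<A> t) =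
      (\<Union>s' \<in> classT \<A> s. \<Union>t' \<in> classT \<A> t. classT \<A> (s' ;; t'))"
    by (simp add: T_category_def)
  also have "\<dots> = classT \<A> (s ;; t)"
    by (rule UN2_const[OF classT_self[OF wf(1)] classT_self[OF wf(2)] eq])
  finally show ?thesis .
qed

lemma ten_classT:
  assumes "wfT \<A> s" "wfT \<A> t"
  shows "tensor_arr (T_category \<A>) (classT \<A> s) (classT \<A> t) = classT \<A> (s \<otimes> t)"
proof -
  have wf: "wfT \<A> s" "wfT \<A> t" using assms by simp_all
  have eq: "classT \<A> (s' \<otimes> t') = classT \<A> (s \<otimes> t)"
    if "s' \<in> classT \<A> s" "t' \<in> classT \<A> t" for s' t'
  proof -
    have "eqT \<A> (s \<otimes> t) (s' \<otimes> t')"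
      by (rule eqT.ten_cong) (use that assms in \<open>simp_all add: classT_def\<close>)
    from classT_eqI[OF this] show ?thesis by (rule HOL.sym)
  qed
  have "tensor_arr (T_category \<A>) (classT \<A> s) (classT \<A> t) =
      (\<Union>s' \<in> classT \<A> s. \<Union>t' \<in> classT \<A> t. classT \<A> (s' \<otimes> t'))"
    by (simp add: T_category_def)
  also have "\<dots> = classT \<A> (s \<otimes> t)"
    by (rule UN2_const[OF classT_self[OF wf(1)] classT_self[OF wf(2)] eq])
  finally show ?thesis .
qed

lemma arrows_T_category: "c \<in> arrows (T_category \<A>) \<longleftrightarrow> (\<exists>t. c = classT \<A> t \<and> wfT \<A> t)"
  by (auto simp: T_category_def)

lemma hom_T_category: "c \<in> hom (T_category \<A>) X Y \<longleftrightarrow>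
    (\<exists>t. c = classT \<A> t \<and> wfT \<A> t \<and> srcT \<A> t = X \<and> tgtT \<A> t = Y)"
  by (auto simp: hom_def arrows_T_category T_category_source_target)

lemma T_category_simps:
  "tensor_ob (T_category \<A>) = (@)" "unit_ob (T_category \<A>) = []"
  "ident (T_category \<A>) X = classT \<A> (Idn X)"
  by (simp_all add: T_category_def)

theorem T_category_spatial: "spatial_strict_monoidal_category (T_category \<A>)"
proof (unfold_locales, unfold hom_T_category arrows_T_category T_category_simps, goal_cases)
  case (1 X) show ?case by (intro exI[of _ "Idn X"]) simp
next
  case 2
  then show ?case
    by (elim exE conjE, hypsubst) (intro exI conjI, rule seq_classT, simp_all)
next
  case 3
  then show ?case
    by (elim exE conjE, hypsubst) (simp add: seq_classT ten_classT, rule classT_eqI, rule eqT.seq_ident_left, simp_all)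
next
  case 4
  then show ?case
    by (elim exE conjE, hypsubst) (simp add: seq_classT ten_classT, rule classT_eqI, rule eqT.seq_ident_right, simp_all)
next
  case 5
  then show ?case
    by (elim exE conjE, hypsubst) (simp add: seq_classT ten_classT, rule classT_eqI, rule eqT.seq_assoc, simp_all)
next
  case 6 show ?case by simp
next
  case 7 show ?case by simp
next
  case 8 show ?case by simp
next
  case 9
  then show ?case
    by (elim exE conjE, hypsubst) (intro exI conjI, rule ten_classT, simp_all)
next
  case 10
  then show ?case
    by (elim exE conjE, hypsubst) (simp add: seq_classT ten_classT, rule classT_eqI, rule eqT.ten_assoc, simp_all)
next
  case 11
  then show ?case
    by (elim exE conjE, hypsubst) (simp add: seq_classT ten_classT, rule classT_eqI, rule eqT.ten_unit_left, simp_all)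
next
  case 12
  then show ?case
    by (elim exE conjE, hypsubst) (simp add: seq_classT ten_classT, rule classT_eqI, rule eqT.ten_unit_right, simp_all)
next
  case 13 show ?case by (simp add: ten_classT classT_eqI eqT.ten_ident)
next
  case 14
  then show ?case
    by (elim exE conjE, hypsubst) (simp add: seq_classT ten_classT, rule classT_eqI, rule eqT.ten_seq, simp_all)
next
  case 15
  then show ?case
    by (elim exE conjE, hypsubst) (simp add: seq_classT ten_classT, rule classT_eqI, rule eqT.spatial, simp_all)
qed

lemma M_term_boundary:
  assumes "wfT \<A> t"
  shows "wfC \<A> (M_term \<A> t) \<and> leftC (M_term \<A> t) = srcT \<A> t \<and> rightC (M_term \<A> t) = tgtT \<A> t \<and>
    topC \<A> (M_term \<A> t) = unit_ob \<A> \<and> botC \<A> (M_term \<A> t) = unit_ob \<A>"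
  using assms by (induction t) (auto simp: objects_simps braid_arrow split: polarity.splits)

end

end

(*
  A corner turns a horizontal edge into a vertical one. Attaching the black corner that creates the
  top edge A above a cell, and the black corner that absorbs the bottom edge B below it, turns a
  cell with boundary (left X, right Y, top A, bottom B) into a morphism from X B* to A* Y of T, and
  this assignment ("bend") can be defined by recursion on cells because T has all the structure it
  requires: the black splitting and merging morphisms glue the edges of horizontal composites.
  It respects the laws of double categories and the corner equations, and it sends M t to
  t up to the unit object I*; hence M is faithful. Conversely M (bend a) is the cell a with its two
  corners attached, so for top = bottom = I one recovers a by yanking; hence M is full.

  For M to be well defined, the equations of T must hold between cells. A term of a single colour
  is a morphism of the base category between two columns of corners, so the equations of a single colour are
  coherence equations there; the mixed ones follow by yanking. Spatiality holds since a vertical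
  strand can be pulled across every cell.
*)

theory Submission
  imports Defs
begin

section \<open>Strict monoidal categories\<close>

text \<open>Defining the inverse on raw cell terms avoids any normal form for cells: only the
  generating equations have to be checked. Bending both edges with one colour makes the construction
  asymmetric. Black generators come back unchanged, while white ones come back as mates under
  \<open>Eta\<close> and \<open>Eps\<close>, and the equations joining the two colours are what
  straightens them.

  The obstacle throughout is the unit object: \<open>I\<bullet>\<close> is isomorphic to the empty
  word but not equal to it. A cell with unit edges therefore bends to a morphism with extra
  \<open>I\<bullet>\<close> strands, and the comparison with \<open>t\<close> is stated up to
  cutting these by \<open>\<kappa>b\<close> and \<open>\<iota>b\<close>. For white corners on
  \<open>I\<close> this requires knowing that \<open>Eta I\<close> and \<open>Eps I\<close> are
  built from the unit isomorphisms.

  For the equations of T among cells, black corners are treated as white corners in the left-right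
  reflection. Reflection reverses the horizontal tensor, which is why braidings occur in white
  splits and merges and not in black ones. Spatiality is obtained by extending the braiding of
  \<open>\<A>\<close> to a crossing natural in every cell.\<close>

context strict_monoidal_category
begin

lemma arr_ident: "ident C A \<in> arrows C" "source C (ident C A) = A" "target C (ident C A) = A"
  using ident_hom[of A] by (auto simp: hom_def)

lemma arr_comp:
  assumes "f \<in> arrows C" "g \<in> arrows C" "target C f = source C g"
  shows "f \<cdot> g \<in> arrows C" "source C (f \<cdot> g) = source C f" "target C (f \<cdot> g) = target C g"
  using comp_hom[of f "source C f" "source C g" g "target C g"] assms by (auto simp: hom_def)

lemma arr_tensor:
  assumes "f \<in> arrows C" "g \<in> arrows C"
  shows "f \<boxtimes> g \<in> arrows C" "source C (f \<boxtimes> g) = source C f \<odot> source C g"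
    "target C (f \<boxtimes> g) = target C f \<odot> target C g"
  using tensor_hom[of f "source C f" "target C f" g "source C g" "target C g"] assms
  by (auto simp: hom_def)

lemma comp_assoc_arr:
  assumes "f \<in> arrows C" "g \<in> arrows C" "h \<in> arrows C"
    "target C f = source C g" "target C g = source C h"
  shows "(f \<cdot> g) \<cdot> h = f \<cdot> (g \<cdot> h)"
  using assms by (intro comp_assoc[of _ "source C f"]) (auto simp: hom_def)

lemma comp_ident_arr:
  assumes "f \<in> arrows C"
  shows "source C f = X \<Longrightarrow> ident C X \<cdot> f = f" "target C f = Y \<Longrightarrow> f \<cdot> ident C Y = f"
  using comp_ident_left[of f "source C f" "target C f"] comp_ident_right[of f "source C f" "target C f"]
    assms by (auto simp: hom_def)

lemma tensor_comp_arr: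
  assumes "f \<in> arrows C" "g \<in> arrows C" "f' \<in> arrows C" "g' \<in> arrows C"
    "target C f = source C g" "target C f' = source C g'"
  shows "(f \<cdot> g) \<boxtimes> (f' \<cdot> g') = (f \<boxtimes> f') \<cdot> (g \<boxtimes> g')"
  using assms by (intro tensor_comp) (auto simp: hom_def)

lemmas objs = tensor_ob_assoc tensor_ob_unit_left tensor_ob_unit_right

text \<open>Equations are computed between composites of whiskered generators: every tensor is
  sequentialised, and the only freedom left is the exchange of neighbouring whiskers on disjoint
  strands, see \<open>slide\<close>.\<close>

definition whisker :: "'o \<Rightarrow> 'm \<Rightarrow> 'o \<Rightarrow> 'm"
  where "whisker X f Y = ident C X \<boxtimes> (f \<boxtimes> ident C Y)"

lemma arr_whisker:
  assumes "f \<in> arrows C"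
  shows "whisker X f Y \<in> arrows C" "source C (whisker X f Y) = X \<odot> (source C f \<odot> Y)"
    "target C (whisker X f Y) = X \<odot> (target C f \<odot> Y)"
  using assms by (simp_all add: whisker_def arr_tensor arr_ident)

lemmas typing = arr_ident arr_comp arr_tensor arr_whisker

lemma whisker_whisker:
  "f \<in> arrows C \<Longrightarrow> whisker X (whisker X' f Y') Y = whisker (X \<odot> X') f (Y' \<odot> Y)"
  unfolding whisker_def by (simp add: tensor_assoc arr_tensor arr_ident flip: tensor_ident)

lemma whisker_ident: "whisker X (ident C Z) Y = ident C (X \<odot> (Z \<odot> Y))"
  by (simp add: whisker_def tensor_ident)

lemma whisker_unit: "f \<in> arrows C \<Longrightarrow> whisker (unit_ob C) f (unit_ob C) = f"
  by (simp add: whisker_def tensor_unit_left tensor_unit_right)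

lemma whisker_comp:
  assumes "f \<in> arrows C" "g \<in> arrows C" "target C f = source C g"
  shows "whisker X (f \<cdot> g) Y = whisker X f Y \<cdot> whisker X g Y"
proof -
  have "(f \<cdot> g) \<boxtimes> ident C Y = (f \<boxtimes> ident C Y) \<cdot> (g \<boxtimes> ident C Y)"
    using tensor_comp_arr[OF assms(1,2) arr_ident(1) arr_ident(1), of Y Y] assms
    by (simp add: comp_ident_arr arr_ident)
  then show ?thesis
    unfolding whisker_def
    using tensor_comp_arr[OF arr_ident(1) arr_ident(1), of "f \<boxtimes> ident C Y" "g \<boxtimes> ident C Y" X X] assms
    by (simp add: comp_ident_arr arr_ident arr_tensor)
qed

lemma tensor_whisker:
  assumes "f \<in> arrows C" "g \<in> arrows C"
  shows "f \<boxtimes> g = whisker (unit_ob C) f (source C g) \<cdot> whisker (target C f) g (unit_ob C)"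
  using tensor_comp_arr[OF assms(1) arr_ident(1) arr_ident(1) assms(2), of "target C f" "source C g"] assms
  by (simp add: whisker_def comp_ident_arr arr_ident arr_tensor tensor_unit_left tensor_unit_right)

lemma tensor_whisker':
  assumes "f \<in> arrows C" "g \<in> arrows C"
  shows "f \<boxtimes> g = whisker (source C f) g (unit_ob C) \<cdot> whisker (unit_ob C) f (target C g)"
  using tensor_comp_arr[OF arr_ident(1) assms(1) assms(2) arr_ident(1), of "source C f" "target C g"] assms
  by (simp add: whisker_def comp_ident_arr arr_ident arr_tensor tensor_unit_left tensor_unit_right)

lemma tensor_ident_whisker:
  assumes "f \<in> arrows C"
  shows "ident C X \<boxtimes> f = whisker X f (unit_ob C)" "f \<boxtimes> ident C X = whisker (unit_ob C) f X"
  using assms by (simp_all add: whisker_def tensor_unit_left tensor_unit_right arr_tensor arr_ident)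

text \<open>Both sides sequentialise \<open>f \<boxtimes> whisker Y g Z\<close>, one with
  \<open>f\<close> first and the other with \<open>g\<close> first. The equation has no preferred
  direction, so each use names its arrows and words.\<close>

lemma slide:
  assumes "f \<in> arrows C" "g \<in> arrows C"
  shows "whisker X f (Y \<odot> (source C g \<odot> Z)) \<cdot> whisker (X \<odot> (target C f \<odot> Y)) g Z =
    whisker (X \<odot> (source C f \<odot> Y)) g Z \<cdot> whisker X f (Y \<odot> (target C g \<odot> Z))"
proof -
  let ?g = "whisker Y g Z"
  have "whisker X (f \<boxtimes> ?g) (unit_ob C) = whisker X f (Y \<odot> (source C g \<odot> Z)) \<cdot> whisker (X \<odot> (target C f \<odot> Y)) g Z"
    using assms by (subst tensor_whisker) (simp_all add: typing whisker_comp whisker_whisker objs)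
  moreover have "whisker X (f \<boxtimes> ?g) (unit_ob C) = whisker (X \<odot> (source C f \<odot> Y)) g Z \<cdot> whisker X f (Y \<odot> (target C g \<odot> Z))"
    using assms by (subst tensor_whisker') (simp_all add: typing whisker_comp whisker_whisker objs)
  ultimately show ?thesis by simp
qed

text \<open>Applies an equation \<open>f \<cdot> g = k\<close> at the front of a longer right-nested
  composite, where \<open>f \<cdot> g\<close> is not a subterm.\<close>

lemma comp_reassoc:
  assumes "f \<cdot> g = k" "f \<in> arrows C" "g \<in> arrows C" "h \<in> arrows C"
    "target C f = source C g" "target C g = source C h"
  shows "f \<cdot> (g \<cdot> h) = k \<cdot> h"
  using assms comp_assoc_arr by metis

lemma comp_reassoc2:
  assumes "f \<cdot> (g \<cdot> g') = k" "f \<in> arrows C" "g \<in> arrows C" "g' \<in> arrows C" "h \<in> arrows C"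
    "target C f = source C g" "target C g = source C g'" "target C g' = source C h"
  shows "f \<cdot> (g \<cdot> (g' \<cdot> h)) = k \<cdot> h"
  using assms by (metis comp_assoc_arr arr_comp)

end

context symmetric_strict_monoidal_category
begin

text \<open>The hexagon at two unit objects makes this braiding idempotent, and an invertible
  idempotent is an identity.\<close>

lemma braid_unit_left: "\<sigma> (unit_ob C) A = ident C A"
proof -
  let ?s = "\<sigma> (unit_ob C) A" and ?t = "\<sigma> A (unit_ob C)"
  note b = braid_arrow
  have "?s = ?s \<cdot> ?s"
    using braid_hexagon[of "unit_ob C" "unit_ob C" A]
    by (simp add: objects_simps tensor_unit_left tensor_unit_right b)
  then have "?s \<cdot> ?t = ?s \<cdot> (?s \<cdot> ?t)"
    by (metis b comp_assoc_arr objects_simps(2,3))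
  then show ?thesis
    using b[of "unit_ob C" A] by (simp add: braid_symmetric objects_simps comp_ident_arr)
qed

lemma braid_unit_right: "\<sigma> A (unit_ob C) = ident C A"
  using braid_symmetric[of "unit_ob C" A] braid_arrow[of A "unit_ob C"]
  by (simp add: braid_unit_left comp_ident_arr objects_simps)

end

section \<open>From cells to morphisms of T\<close>

context symmetric_strict_monoidal_base
begin

sublocale T: spatial_strict_monoidal_category "T_category \<A>"
  by (rule T_category_spatial)

text \<open>Keeps words as right-nested products of singletons, so that whiskers have a normal form.\<close>

declare append.simps(2) [simp del]

abbreviation cl :: "('o, 'm) tterm \<Rightarrow> ('o, 'm) tterm set" ("\<langle>_\<rangle>")
  where "\<langle>t\<rangle> \<equiv> classT \<A> t"

abbreviation seq (infixr "\<star>" 60) where "f \<star> g \<equiv> comp_arr (T_category \<A>) f g"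

abbreviation otimes (infixr "\<oplus>" 72) where "A \<oplus> B \<equiv> tensor_ob \<A> A B"

abbreviation idT where "idT \<equiv> ident (T_category \<A>)"

abbreviation wh where "wh \<equiv> T.whisker"

lemma ident_T: "\<langle>Idn X\<rangle> = idT X"
  by (simp add: T_category_def)

lemma arr_cl:
  assumes "wfT \<A> t"
  shows "\<langle>t\<rangle> \<in> arrows (T_category \<A>)" "source (T_category \<A>) \<langle>t\<rangle> = srcT \<A> t"
    "target (T_category \<A>) \<langle>t\<rangle> = tgtT \<A> t"
  using assms by (auto simp: arrows_T_category T_category_source_target)

lemmas T_ob = T_category_simps(1,2)
lemmas whiskerT = T.tensor_whisker[unfolded T_ob] T.whisker_comp T.whisker_whisker[unfolded T_ob]
  T.whisker_ident[unfolded T_ob] T.whisker_unit[unfolded T_ob] T.comp_assoc_arr T.comp_ident_arr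

lemmas typingT = T.typing[unfolded T_ob] arr_cl

lemmas class_simps = ident_T seq_classT[symmetric] ten_classT[symmetric]

text \<open>Brings arrows of T to right-nested composites of whiskered generators; equations are
  then used inside them through \<open>T.comp_reassoc\<close>.\<close>

lemmas T_simps = class_simps whiskerT typingT objs EtaN_def EpsN_def

lemmas slideT = T.slide[unfolded T_ob]

lemma axT: "T_axiom \<A> s t \<Longrightarrow> \<langle>s\<rangle> = \<langle>t\<rangle>"
  by (intro classT_eqI eqT.ax)

lemma wh_cong: "f = g \<Longrightarrow> wh X f Y = wh X g Y" by simp

lemmas axT_wh = axT[THEN wh_cong]

text \<open>The clauses are dictated by \<open>M_bend\<close>. The bottom edge belongs to the
  source, so the lower cell of a vertical composite acts first and \<open>Lift\<close> becomes the
  contravariant \<open>Map Black\<close>. \<open>Kappa\<close> and \<open>Iota\<close> appear where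
  an edge of the cell is the unit object, since \<open>I\<bullet>\<close> is a strand of its
  own.\<close>

primrec bend :: "('o, 'm) cterm \<Rightarrow> ('o, 'm) tterm" where
  "bend (IdH A) = Idn (A\<bullet>)"
| "bend (IdV X) = (Idn X \<otimes> Kappa Black) ;; (Iota Black \<otimes> Idn X)"
| "bend (Send p A) = (case p of White \<Rightarrow> Kappa Black ;; Eta A | Black \<Rightarrow> Idn (A\<bullet>) \<otimes> Kappa Black)"
| "bend (Recv p A) = (case p of White \<Rightarrow> Eps A ;; Iota Black | Black \<Rightarrow> Iota Black \<otimes> Idn (A\<bullet>))"
| "bend (Lift f) = Map Black f"
| "bend (a \<parallel> b) = (Idn (leftC a) \<otimes> Split Black (botC \<A> a) (botC \<A> b)) ;;
    (bend a \<otimes> Idn ((botC \<A> b)\<bullet>)) ;; (Idn ((topC \<A> a)\<bullet>) \<otimes> bend b) ;;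
    (Merge Black (topC \<A> a) (topC \<A> b) \<otimes> Idn (rightC b))"
| "bend (a \<Down> b) = (Idn (leftC a) \<otimes> bend b) ;; (bend a \<otimes> Idn (rightC b))"

lemma bend_wf:
  assumes "wfC \<A> a"
  shows "wfT \<A> (bend a)" "srcT \<A> (bend a) = leftC a @ (botC \<A> a)\<bullet>"
    "tgtT \<A> (bend a) = (topC \<A> a)\<bullet> @ rightC a"
proof -
  have "wfT \<A> (bend a) \<and> srcT \<A> (bend a) = leftC a @ (botC \<A> a)\<bullet> \<and>
    tgtT \<A> (bend a) = (topC \<A> a)\<bullet> @ rightC a"
    using assms by (induction a) (auto split: polarity.splits)
  then show "wfT \<A> (bend a)" "srcT \<A> (bend a) = leftC a @ (botC \<A> a)\<bullet>"
    "tgtT \<A> (bend a) = (topC \<A> a)\<bullet> @ rightC a" by auto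
qed

lemma bend_hor:
  assumes "wfC \<A> (a \<parallel> b)"
  shows "\<langle>bend (a \<parallel> b)\<rangle> = wh (leftC a) \<langle>Split Black (botC \<A> a) (botC \<A> b)\<rangle> [] \<star>
    wh [] \<langle>bend a\<rangle> ((botC \<A> b)\<bullet>) \<star> wh ((topC \<A> a)\<bullet>) \<langle>bend b\<rangle> [] \<star>
    wh [] \<langle>Merge Black (topC \<A> a) (topC \<A> b)\<rangle> (rightC b)"
  using assms by (simp add: T_simps bend_wf)

lemma bend_ver:
  assumes "wfC \<A> (a \<Down> b)"
  shows "\<langle>bend (a \<Down> b)\<rangle> = wh (leftC a) \<langle>bend b\<rangle> [] \<star> wh [] \<langle>bend a\<rangle> (rightC b)"
  using assms by (simp add: T_simps bend_wf)

text \<open>The associativity of black splits and merges is the whole content; to apply it, the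
  inner merge slides past \<open>c\<close> and the inner split past \<open>a\<close>.\<close>

lemma bend_hor_assoc:
  assumes "wfC \<A> ((a \<parallel> b) \<parallel> c)"
  shows "\<langle>bend ((a \<parallel> b) \<parallel> c)\<rangle> = \<langle>bend (a \<parallel> (b \<parallel> c))\<rangle>"
proof -
  let ?X = "leftC a" let ?Y = "rightC a" let ?Z = "rightC b" let ?W = "rightC c"
  let ?A = "topC \<A> a" let ?A' = "topC \<A> b" let ?A'' = "topC \<A> c"
  let ?B = "botC \<A> a" let ?B' = "botC \<A> b" let ?B'' = "botC \<A> c"
  let ?sp = "\<lambda>A B. \<langle>Split Black A B\<rangle>" let ?mg = "\<lambda>A B. \<langle>Merge Black A B\<rangle>"
  let ?a = "\<langle>bend a\<rangle>" let ?b = "\<langle>bend b\<rangle>" let ?c = "\<langle>bend c\<rangle>"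
  have wf: "wfC \<A> a" "wfC \<A> b" "wfC \<A> c" and [simp]: "leftC b = ?Y" "leftC c = ?Z"
    using assms by auto
  note [simp] = T_simps wf bend_wf
  have 1: "wh [] (?mg ?A ?A') (?Z @ ?B''\<bullet>) \<star> wh ((?A \<oplus> ?A')\<bullet>) ?c [] =
      wh (?A\<bullet> @ ?A'\<bullet>) ?c [] \<star> wh [] (?mg ?A ?A') (?A''\<bullet> @ ?W)"
    using slideT[of "?mg ?A ?A'" ?c "[]" "[]" "[]"] by simp
  have 2: "wh [] ?a ((?B' \<oplus> ?B'')\<bullet>) \<star> wh (?A\<bullet> @ ?Y) (?sp ?B' ?B'') [] =
      wh (?X @ ?B\<bullet>) (?sp ?B' ?B'') [] \<star> wh [] ?a (?B'\<bullet> @ ?B''\<bullet>)"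
    using slideT[of ?a "?sp ?B' ?B''" "[]" "[]" "[]"] by simp
  have 3: "wh [] (?mg ?A ?A') (?A''\<bullet> @ ?W) \<star> wh [] (?mg (?A \<oplus> ?A') ?A'') ?W =
     wh (?A\<bullet>) (?mg ?A' ?A'') ?W \<star> wh [] (?mg ?A (?A' \<oplus> ?A'')) ?W"
    using axT_wh[OF merge_assoc[of \<A> Black ?A ?A' ?A''], of "[]" ?W] by simp
  have 4: "wh ?X (?sp (?B \<oplus> ?B') ?B'') [] \<star> wh ?X (?sp ?B ?B') (?B''\<bullet>) =
     wh ?X (?sp ?B (?B' \<oplus> ?B'')) [] \<star> wh (?X @ ?B\<bullet>) (?sp ?B' ?B'') []"
    using axT_wh[OF split_assoc[of \<A> Black ?B ?B' ?B''], of ?X "[]"] by simp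
  have "\<langle>bend ((a \<parallel> b) \<parallel> c)\<rangle> = wh ?X (?sp (?B \<oplus> ?B') ?B'') [] \<star> wh ?X (?sp ?B ?B') (?B''\<bullet>) \<star>
     wh [] ?a (?B'\<bullet> @ ?B''\<bullet>) \<star> wh (?A\<bullet>) ?b (?B''\<bullet>) \<star> wh [] (?mg ?A ?A') (?Z @ ?B''\<bullet>) \<star>
     wh ((?A \<oplus> ?A')\<bullet>) ?c [] \<star> wh [] (?mg (?A \<oplus> ?A') ?A'') ?W"
    using assms by (subst bend_hor, simp)+ simp
  also have "\<dots> = wh ?X (?sp ?B (?B' \<oplus> ?B'')) [] \<star> wh (?X @ ?B\<bullet>) (?sp ?B' ?B'') [] \<star>
     wh [] ?a (?B'\<bullet> @ ?B''\<bullet>) \<star> wh (?A\<bullet>) ?b (?B''\<bullet>) \<star> wh (?A\<bullet> @ ?A'\<bullet>) ?c [] \<star> 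
     wh (?A\<bullet>) (?mg ?A' ?A'') ?W \<star> wh [] (?mg ?A (?A' \<oplus> ?A'')) ?W"
    by (simp add: T.comp_reassoc[OF 1] T.comp_reassoc[OF 4] 3)
  also have "\<dots> = \<langle>bend (a \<parallel> (b \<parallel> c))\<rangle>"
    using assms by (simp add: bend_hor T.comp_reassoc[OF 2] del: bend.simps)
  finally show ?thesis .
qed

subsection \<open>Bending respects the congruence on cells\<close>

text \<open>The unit edge split off below is consumed by \<open>Kappa\<close>; the one created by
  \<open>Iota\<close> slides past \<open>a\<close> and is absorbed by the merge on top.\<close>

lemma bend_hor_unit_left:
  assumes "wfC \<A> a"
  shows "\<langle>bend (IdV (leftC a) \<parallel> a)\<rangle> = \<langle>bend a\<rangle>"
proof -
  let ?X = "leftC a" let ?Y = "rightC a" let ?A = "topC \<A> a" let ?B = "botC \<A> a" let ?I = "unit_ob \<A>"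
  note [simp] = T_simps assms bend_wf
  have 1: "wh ?X \<langle>Split Black ?I ?B\<rangle> [] \<star> wh ?X \<langle>Kappa Black\<rangle> (?B\<bullet>) = idT (?X @ ?B\<bullet>)"
    using axT_wh[OF split_kappa_left[of \<A> Black ?B], of ?X "[]"] by simp
  have 2: "wh [] \<langle>Iota Black\<rangle> (?X @ ?B\<bullet>) \<star> wh (?I\<bullet>) \<langle>bend a\<rangle> [] =
      \<langle>bend a\<rangle> \<star> wh [] \<langle>Iota Black\<rangle> (?A\<bullet> @ ?Y)"
    using slideT[of "\<langle>Iota Black\<rangle>" "\<langle>bend a\<rangle>" "[]" "[]" "[]"] by simp
  have 3: "wh [] \<langle>Iota Black\<rangle> (?A\<bullet> @ ?Y) \<star> wh [] \<langle>Merge Black ?I ?A\<rangle> ?Y = idT (?A\<bullet> @ ?Y)"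
    using axT_wh[OF iota_merge_left[of \<A> Black ?A], of "[]" ?Y] by simp
  show ?thesis
    by (subst bend_hor, simp) (simp add: T.comp_reassoc[OF 1] T.comp_reassoc[OF 2] 2 3)
qed

lemma bend_hor_unit_right:
  assumes "wfC \<A> a"
  shows "\<langle>bend (a \<parallel> IdV (rightC a))\<rangle> = \<langle>bend a\<rangle>"
proof -
  let ?X = "leftC a" let ?Y = "rightC a" let ?A = "topC \<A> a" let ?B = "botC \<A> a" let ?I = "unit_ob \<A>"
  note [simp] = T_simps assms bend_wf
  have 1: "wh ?X \<langle>Split Black ?B ?I\<rangle> [] \<star> wh (?X @ ?B\<bullet>) \<langle>Kappa Black\<rangle> [] = idT (?X @ ?B\<bullet>)"
    using axT_wh[OF split_kappa_right[of \<A> Black ?B], of ?X "[]"] by simp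
  have 2: "wh [] \<langle>bend a\<rangle> (?I\<bullet>) \<star> wh (?A\<bullet> @ ?Y) \<langle>Kappa Black\<rangle> [] =
      wh (?X @ ?B\<bullet>) \<langle>Kappa Black\<rangle> [] \<star> \<langle>bend a\<rangle>"
    using slideT[of "\<langle>bend a\<rangle>" "\<langle>Kappa Black\<rangle>" "[]" "[]" "[]"] by simp
  have 3: "wh (?A\<bullet>) \<langle>Iota Black\<rangle> ?Y \<star> wh [] \<langle>Merge Black ?A ?I\<rangle> ?Y = idT (?A\<bullet> @ ?Y)"
    using axT_wh[OF iota_merge_right[of \<A> ?A Black], of "[]" ?Y] by simp
  show ?thesis
    by (subst bend_hor, simp) (simp add: T.comp_reassoc[OF 1] T.comp_reassoc[OF 2] 2 3)
qed

text \<open>On the right-hand side a merge of the two middle edges is followed at once by their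
  split, which cancels; then \<open>a\<close> and \<open>d\<close> act on disjoint strands and
  slide.\<close>

lemma bend_interchange:
  assumes "wfC \<A> (a \<Down> b)" "wfC \<A> (c \<Down> d)" "rightC a = leftC c" "rightC b = leftC d"
  shows "\<langle>bend ((a \<Down> b) \<parallel> (c \<Down> d))\<rangle> = \<langle>bend ((a \<parallel> c) \<Down> (b \<parallel> d))\<rangle>"
proof -
  let ?X = "leftC a" let ?Y = "leftC c" let ?Z = "rightC c"
  let ?X' = "leftC b" let ?Y' = "leftC d" let ?Z' = "rightC d"
  let ?A = "topC \<A> a" let ?B = "topC \<A> b" let ?A' = "topC \<A> c" let ?B' = "topC \<A> d"
  let ?C = "botC \<A> b" let ?C' = "botC \<A> d"
  let ?sp = "\<lambda>A B. \<langle>Split Black A B\<rangle>" let ?mg = "\<lambda>A B. \<langle>Merge Black A B\<rangle>"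
  let ?a = "\<langle>bend a\<rangle>" let ?b = "\<langle>bend b\<rangle>" let ?c = "\<langle>bend c\<rangle>" let ?d = "\<langle>bend d\<rangle>"
  have wf: "wfC \<A> a" "wfC \<A> b" "wfC \<A> c" "wfC \<A> d" "botC \<A> a = ?B" "botC \<A> c = ?B'"
    using assms by auto
  note [simp] = T_simps wf bend_wf assms(3,4)
  have 1: "wh ?X (?mg ?B ?B') ?Z' \<star> wh ?X (?sp ?B ?B') ?Z' = idT (?X @ ?B\<bullet> @ ?B'\<bullet> @ ?Z')"
    using axT_wh[OF merge_split[of \<A> Black ?B ?B'], of ?X ?Z'] by simp
  have 2: "wh (?X @ ?B\<bullet>) ?d [] \<star> wh [] ?a (?B'\<bullet> @ ?Z') = wh [] ?a (?Y' @ ?C'\<bullet>) \<star> wh (?A\<bullet> @ ?Y) ?d []"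
    using slideT[of ?a ?d "[]" "[]" "[]"] by simp
  show ?thesis
    using assms by (simp add: bend_hor bend_ver T.comp_reassoc[OF 1] T.comp_reassoc[OF 2] del: bend.simps)
qed

text \<open>White yanking becomes the snake equations, and the laws of \<open>Lift\<close> become
  functoriality and monoidality of \<open>Map Black\<close>. Black corners bend to plain strands
  beside a unit edge, so their yanking only concerns unit edges.\<close>

lemma cornering_axiom_bend:
  assumes "cornering_axiom \<A> a b"
  shows "\<langle>bend a\<rangle> = \<langle>bend b\<rangle>"
  using assms
proof cases
  case (yank_white_h A)
  let ?I = "unit_ob \<A>"
  note [simp] = T_simps
  have 1: "\<langle>Split Black ?I A\<rangle> \<star> wh [] \<langle>Kappa Black\<rangle> (A\<bullet>) = idT (A\<bullet>)"
    using axT[OF split_kappa_left[of \<A> Black A]] by simp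
  have 2: "wh (A\<bullet>) \<langle>Iota Black\<rangle> [] \<star> \<langle>Merge Black A ?I\<rangle> = idT (A\<bullet>)"
    using axT[OF iota_merge_right[of \<A> A Black]] by simp
  have 3: "wh [] \<langle>Eta A\<rangle> (A\<bullet>) \<star> wh (A\<bullet>) \<langle>Eps A\<rangle> [] = idT (A\<bullet>)"
    using axT[OF snake_black[of \<A> A]] by simp
  show ?thesis
    unfolding yank_white_h by (simp add: T.comp_reassoc[OF 1] T.comp_reassoc[OF 3] 1 2 3)
next
  case (yank_white_v A)
  note [simp] = T_simps
  have 3: "wh (A\<degree>) \<langle>Eta A\<rangle> [] \<star> wh [] \<langle>Eps A\<rangle> (A\<degree>) = idT (A\<degree>)"
    using axT[OF snake_white[of \<A> A]] by simp
  show ?thesis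
    unfolding yank_white_v by (simp add: T.comp_reassoc[OF 3])
next
  case (yank_black_h A)
  let ?I = "unit_ob \<A>"
  note [simp] = T_simps
  have 1: "\<langle>Split Black A ?I\<rangle> \<star> wh (A\<bullet>) \<langle>Kappa Black\<rangle> [] = idT (A\<bullet>)"
    using axT[OF split_kappa_right[of \<A> Black A]] by simp
  have 2: "wh [] \<langle>Iota Black\<rangle> (A\<bullet>) \<star> \<langle>Merge Black ?I A\<rangle> = idT (A\<bullet>)"
    using axT[OF iota_merge_left[of \<A> Black A]] by simp
  have 3: "wh [] \<langle>Iota Black\<rangle> (A\<bullet> @ ?I\<bullet>) \<star> wh (?I\<bullet> @ A\<bullet>) \<langle>Kappa Black\<rangle> [] =
      wh (A\<bullet>) \<langle>Kappa Black\<rangle> [] \<star> wh [] \<langle>Iota Black\<rangle> (A\<bullet>)"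
    using slideT[of "\<langle>Iota Black\<rangle>" "\<langle>Kappa Black\<rangle>" "[]" "A\<bullet>" "[]"] by simp
  show ?thesis
    unfolding yank_black_h by (simp add: T.comp_reassoc[OF 3] T.comp_reassoc[OF 1] 1 2)
next
  case (yank_black_v A)
  then show ?thesis by (simp add: T_simps)
next
  case (lift_comp f A B g C)
  then show ?thesis
    using axT[OF map_black_comp[OF lift_comp(3,4)]] homD[OF lift_comp(3)] homD[OF lift_comp(4)]
    by (simp add: T_simps)
next
  case (lift_ident A)
  then show ?thesis using axT[OF map_black_ident] by simp
next
  case (lift_tensor f g)
  then show ?thesis
    using axT[OF map_black_tensor[OF arrows_hom arrows_hom, of f g]]
    by (simp add: T_simps)
qed

theorem eqC_bend:
  assumes "eqC \<A> a b"
  shows "\<langle>bend a\<rangle> = \<langle>bend b\<rangle>"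
  using assms
proof (induction rule: eqC.induct)
  case (ax a b)
  then show ?case by (rule cornering_axiom_bend)
next
  case (hor_cong a a' b b')
  then show ?case using eqC_boundary[OF hor_cong(1)] eqC_boundary[OF hor_cong(2)]
    by (simp add: bend_hor del: bend.simps)
next
  case (ver_cong a a' b b')
  then show ?case using eqC_boundary[OF ver_cong(1)] eqC_boundary[OF ver_cong(2)]
    by (simp add: bend_ver del: bend.simps)
next
  case (hor_assoc a b c)
  then show ?case by (rule bend_hor_assoc)
next
  case (ver_assoc a b c)
  then show ?case by (simp add: bend_ver bend_wf T_simps)
next
  case (hor_unit_left a)
  then show ?case by (rule bend_hor_unit_left)
next
  case (hor_unit_right a)
  then show ?case by (rule bend_hor_unit_right)
next
  case (ver_unit_left a)
  then show ?case by (simp add: bend_ver bend_wf T_simps)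
next
  case (ver_unit_right a)
  then show ?case by (simp add: bend_ver bend_wf T_simps)
next
  case (hor_IdH A B)
  then show ?case using axT[OF split_merge[of \<A> Black A B]] by (simp add: T_simps)
next
  case (ver_IdV X Y)
  note [simp] = T_simps
  have 1: "wh X \<langle>Iota Black\<rangle> Y \<star> wh X \<langle>Kappa Black\<rangle> Y = idT (X @ Y)"
    using axT_wh[OF iota_kappa[of \<A> Black], of X Y] by simp
  show ?case by (simp add: T.comp_reassoc[OF 1])
next
  case Id_units
  then show ?case using axT[OF kappa_iota[of \<A> Black]] by (simp add: T_simps)
next
  case (interchange a b c d)
  then show ?case by (rule bend_interchange)
qed simp_all

subsection \<open>Bending inverts M\<close>

abbreviation "\<iota>w \<equiv> \<langle>Iota White\<rangle>"
abbreviation "\<iota>b \<equiv> \<langle>Iota Black\<rangle>"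
abbreviation "\<kappa>w \<equiv> \<langle>Kappa White\<rangle>"
abbreviation "\<kappa>b \<equiv> \<langle>Kappa Black\<rangle>"
abbreviation "\<eta> A \<equiv> \<langle>Eta A\<rangle>"
abbreviation "\<epsilon> A \<equiv> \<langle>Eps A\<rangle>"
abbreviation "I \<equiv> unit_ob \<A>"

text \<open>Serves \<open>eta_unit\<close>, where the axiom for \<open>Eta\<close> and
  \<open>Split Black\<close> at the unit object contains this swap.\<close>

lemma swap_white_unit: "\<langle>Swap White I I\<rangle> = idT (I\<degree> @ I\<degree>)"
proof -
  have 1: "\<langle>Map White (ident \<A> I)\<rangle> = idT (I\<degree>)" using axT[OF map_white_ident] by (simp add: T_simps)
  show ?thesis
    using axT[OF map_white_braid[of \<A> I I]] axT[OF merge_split[of \<A> White I I]]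
    by (simp add: T_simps braid_unit_left ident_arrow 1)
qed

text \<open>
  No axiom relates \<open>\<eta>\<close> at the unit object to \<open>\<iota>\<close>. The scalar \<open>?e\<close> by which they differ is
  idempotent by the axiom for \<open>\<eta>\<close> and \<open>Split Black\<close>, and invertible by the snake equation.
\<close>

lemma
  shows eta_unit: "\<eta> I = \<iota>w \<star> wh [] \<iota>b (I\<degree>)"
    and eps_unit: "\<epsilon> I = wh (I\<degree>) \<kappa>b [] \<star> \<kappa>w"
proof -
  note [simp] = T_simps swap_white_unit
  let ?e = "\<eta> I \<star> wh [] \<kappa>b (I\<degree>) \<star> \<kappa>w"
  \<comment> \<open>The corresponding scalar of the counit, which the snake equation pairs with
    \<open>?e\<close>.\<close>
  let ?e' = "\<iota>w \<star> wh (I\<degree>) \<iota>b [] \<star> \<epsilon> I"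
  have e: "?e \<in> arrows (T_category \<A>)" "source (T_category \<A>) ?e = []" "target (T_category \<A>) ?e = []"
    "?e' \<in> arrows (T_category \<A>)" "source (T_category \<A>) ?e' = []" "target (T_category \<A>) ?e' = []"
    by simp_all
  have ki: "wh X \<kappa>b Y \<star> wh X \<iota>b Y = idT (X @ I\<bullet> @ Y)"
    "wh X \<kappa>w Y \<star> wh X \<iota>w Y = idT (X @ I\<degree> @ Y)"
    "wh X \<iota>w Y \<star> wh X \<kappa>w Y = idT (X @ Y)" for X Y
    using axT_wh[OF kappa_iota[of \<A> Black], of X Y] axT_wh[OF kappa_iota[of \<A> White], of X Y]
      axT_wh[OF iota_kappa[of \<A> White], of X Y] by simp_all
  have ki': "\<kappa>w \<star> \<iota>w = idT (I\<degree>)" "\<iota>w \<star> \<kappa>w = idT []"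
    using ki(2,3)[of "[]" "[]"] by simp_all
  have eta: "\<eta> I = ?e \<star> \<iota>w \<star> wh [] \<iota>b (I\<degree>)"
    by (simp add: T.comp_reassoc[OF ki'(1)] ki)
  have eps: "\<epsilon> I = wh (I\<degree>) \<kappa>b [] \<star> \<kappa>w \<star> ?e'"
    by (simp add: T.comp_reassoc[OF ki'(1)] T.comp_reassoc[OF ki(1)])
  have idem: "?e \<star> ?e = ?e"
  proof -
    let ?sp = "wh [] \<langle>Split Black I I\<rangle> (I\<degree>)"
    have 1: "\<eta> I \<star> ?sp = \<eta> I \<star> wh (I\<bullet>) (\<eta> I) (I\<degree>) \<star> wh (I\<bullet> @ I\<bullet>) \<langle>Merge White I I\<rangle> []"
      using axT[OF eta_split_black[of \<A> I I]] by simp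
    have 2: "?sp \<star> wh [] \<kappa>b (I\<bullet> @ I\<degree>) = idT (I\<bullet> @ I\<degree>)"
      using axT_wh[OF split_kappa_left[of \<A> Black I], of "[]" "I\<degree>"] by simp
    have 3: "wh (I\<bullet> @ I\<bullet>) \<langle>Merge White I I\<rangle> [] \<star> wh [] \<kappa>b (I\<bullet> @ I\<degree>) =
        wh [] \<kappa>b (I\<bullet> @ I\<degree> @ I\<degree>) \<star> wh (I\<bullet>) \<langle>Merge White I I\<rangle> []"
      using slideT[of \<kappa>b "\<langle>Merge White I I\<rangle>" "[]" "I\<bullet>" "[]"] by simp
    have 4: "wh (I\<bullet>) \<langle>Merge White I I\<rangle> [] \<star> wh [] \<kappa>b (I\<degree>) =
        wh [] \<kappa>b (I\<degree> @ I\<degree>) \<star> \<langle>Merge White I I\<rangle>"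
      using slideT[of \<kappa>b "\<langle>Merge White I I\<rangle>" "[]" "[]" "[]"] by simp
    have 5: "\<langle>Merge White I I\<rangle> \<star> \<kappa>w = wh [] \<kappa>w (I\<degree>) \<star> \<kappa>w"
      using axT[OF merge_kappa[of \<A> White]] by simp
    have 6: "wh (I\<bullet>) (\<eta> I) (I\<degree>) \<star> wh [] \<kappa>b (I\<bullet> @ I\<degree> @ I\<degree>) = wh [] \<kappa>b (I\<degree>) \<star> wh [] (\<eta> I) (I\<degree>)"
      using slideT[of \<kappa>b "\<eta> I" "[]" "[]" "I\<degree>"] by simp
    have 7: "wh [] ?e (I\<degree>) \<star> \<kappa>w = \<kappa>w \<star> ?e"
      using slideT[of ?e \<kappa>w "[]" "[]" "[]"] by simp
    \<comment> \<open>Both black strands and the white one are closed off. Cancelling the split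
      against a \<open>\<kappa>b\<close> leaves a single closed \<open>\<eta> I\<close>; replacing
      it by equation 1 leaves two nested ones.\<close>
    have "?e = (\<eta> I \<star> ?sp) \<star> wh [] \<kappa>b (I\<bullet> @ I\<degree>) \<star> wh [] \<kappa>b (I\<degree>) \<star> \<kappa>w"
      by (simp add: T.comp_reassoc[OF 2])
    also have "\<dots> = \<eta> I \<star> wh [] \<kappa>b (I\<degree>) \<star> wh [] (\<eta> I) (I\<degree>) \<star> wh [] \<kappa>b (I\<degree> @ I\<degree>) \<star> wh [] \<kappa>w (I\<degree>) \<star> \<kappa>w"
      unfolding 1 by (simp add: T.comp_reassoc[OF 3] T.comp_reassoc[OF 4] 5 T.comp_reassoc[OF 6])
    also have "\<dots> = \<eta> I \<star> wh [] \<kappa>b (I\<degree>) \<star> (wh [] ?e (I\<degree>) \<star> \<kappa>w)"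
      by simp
    finally show ?thesis unfolding 7 by simp
  qed
  have inv: "?e \<star> ?e' = idT []"
  proof -
    have 1: "wh (I\<degree>) (\<eta> I) [] \<star> wh [] (\<epsilon> I) (I\<degree>) = idT (I\<degree>)"
      using axT[OF snake_white[of \<A> I]] by simp
    have 2: "\<iota>w \<star> wh (I\<degree>) ?e [] = ?e \<star> \<iota>w"
      using slideT[of \<iota>w ?e "[]" "[]" "[]"] by simp
    have 3: "\<iota>w \<star> wh (I\<degree>) \<iota>w [] = \<iota>w \<star> wh [] \<iota>w (I\<degree>)"
      using slideT[of \<iota>w \<iota>w "[]" "[]" "[]"] by simp
    have 4: "wh [] ?e' (I\<degree>) \<star> \<kappa>w = \<kappa>w \<star> ?e'"
      using slideT[of ?e' \<kappa>w "[]" "[]" "[]"] by simp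
    \<comment> \<open>The snake on \<open>I\<degree>\<close>, closed by \<open>\<iota>w\<close> and
      \<open>\<kappa>w\<close>, is an identity on one reading and falls apart into \<open>?e\<close>
      and \<open>?e'\<close> on the other.\<close>
    have "idT [] = \<iota>w \<star> (wh (I\<degree>) (\<eta> I) [] \<star> wh [] (\<epsilon> I) (I\<degree>)) \<star> \<kappa>w"
      unfolding 1 by (simp add: ki')
    also have "wh (I\<degree>) (\<eta> I) [] = wh (I\<degree>) ?e [] \<star> wh (I\<degree>) \<iota>w [] \<star> wh (I\<degree>) \<iota>b (I\<degree>)"
      by (subst eta) simp
    also have "\<iota>w \<star> ((wh (I\<degree>) ?e [] \<star> wh (I\<degree>) \<iota>w [] \<star> wh (I\<degree>) \<iota>b (I\<degree>)) \<star> wh [] (\<epsilon> I) (I\<degree>)) \<star> \<kappa>w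
      = (\<iota>w \<star> wh (I\<degree>) ?e []) \<star> wh (I\<degree>) \<iota>w [] \<star> wh (I\<degree>) \<iota>b (I\<degree>) \<star> wh [] (\<epsilon> I) (I\<degree>) \<star> \<kappa>w"
      by simp
    also have "\<dots> = ?e \<star> \<iota>w \<star> (wh [] ?e' (I\<degree>) \<star> \<kappa>w)"
      unfolding 2 by (simp add: T.comp_reassoc[OF 3])
    also have "\<dots> = ?e \<star> ?e'"
      unfolding 4 by (simp add: T.comp_reassoc[OF ki'(2)])
    finally show ?thesis by simp
  qed
  \<comment> \<open>An idempotent with a right inverse is an identity.\<close>
  have e1: "?e = idT []"
    using T.comp_assoc_arr[of ?e ?e ?e'] e idem inv T.comp_ident_arr by (metis (no_types, lifting))
  have e2: "?e' = idT []" using inv e e1 T.comp_ident_arr by (metis (no_types, lifting))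
  show "\<eta> I = \<iota>w \<star> wh [] \<iota>b (I\<degree>)" by (subst eta, subst e1) simp
  show "\<epsilon> I = wh (I\<degree>) \<kappa>b [] \<star> \<kappa>w" by (subst eps, subst e2) simp
qed

lemma iota_kappa_wh:
  "wh X \<iota>b Y \<star> wh X \<kappa>b Y = idT (X @ Y)" "wh X \<kappa>b Y \<star> wh X \<iota>b Y = idT (X @ I\<bullet> @ Y)"
  using axT_wh[OF iota_kappa[of \<A> Black], of X Y] axT_wh[OF kappa_iota[of \<A> Black], of X Y]
  by (simp_all add: T_simps)

text \<open>The bent form of \<open>M t\<close>: the edges on the unit object are cut by \<open>\<kappa>\<close> and \<open>\<iota>\<close>.\<close>

definition pad :: "('o, 'm) tterm \<Rightarrow> ('o, 'm) tterm set"
  where "pad t = wh (srcT \<A> t) \<kappa>b [] \<star> \<langle>t\<rangle> \<star> wh [] \<iota>b (tgtT \<A> t)"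

text \<open>Unit strands cancel at both ends: the split meets the \<open>\<kappa>b\<close> of
  \<open>s\<close>, and the \<open>\<iota>b\<close> of \<open>s\<close> slides to the end, where the
  merge unites it with that of \<open>t\<close>. The remaining \<open>\<kappa>b\<close> of
  \<open>t\<close> slides to the front past \<open>s\<close>.\<close>

lemma pad_seq:
  assumes "wfT \<A> (s ;; t)" "wfC \<A> a" "wfC \<A> b" "leftC a = srcT \<A> s" "rightC a = tgtT \<A> s"
    "leftC b = srcT \<A> t" "rightC b = tgtT \<A> t"
    "topC \<A> a = I" "topC \<A> b = I" "botC \<A> a = I" "botC \<A> b = I"
    "\<langle>bend a\<rangle> = pad s" "\<langle>bend b\<rangle> = pad t"
  shows "\<langle>bend (a \<parallel> b)\<rangle> = pad (s ;; t)"
proof -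
  let ?X = "srcT \<A> s" let ?Y = "srcT \<A> t" let ?Z = "tgtT \<A> t"
  note [simp] = T_simps iota_kappa_wh
  have w: "wfT \<A> s" "wfT \<A> t" "tgtT \<A> s = ?Y" using assms by auto
  note [simp] = w
  have 1: "wh ?X \<langle>Split Black I I\<rangle> [] \<star> wh ?X \<kappa>b (I\<bullet>) = idT (?X @ I\<bullet>)"
    using axT_wh[OF split_kappa_left[of \<A> Black I], of ?X "[]"] by simp
  have 2: "wh [] \<iota>b (?Y @ I\<bullet>) \<star> wh (I\<bullet> @ ?Y) \<kappa>b [] = wh ?Y \<kappa>b [] \<star> wh [] \<iota>b ?Y"
    using slideT[of \<iota>b \<kappa>b "[]" ?Y "[]"] by simp
  have 3: "wh [] \<langle>s\<rangle> (I\<bullet>) \<star> wh ?Y \<kappa>b [] = wh ?X \<kappa>b [] \<star> \<langle>s\<rangle>"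
    using slideT[of "\<langle>s\<rangle>" \<kappa>b "[]" "[]" "[]"] by simp
  have 4: "wh [] \<iota>b ?Y \<star> wh (I\<bullet>) \<langle>t\<rangle> [] = \<langle>t\<rangle> \<star> wh [] \<iota>b ?Z"
    using slideT[of \<iota>b "\<langle>t\<rangle>" "[]" "[]" "[]"] by simp
  have 5: "wh [] \<iota>b ?Z \<star> wh (I\<bullet>) \<iota>b ?Z \<star> wh [] \<langle>Merge Black I I\<rangle> ?Z = wh [] \<iota>b ?Z"
    using axT_wh[OF iota_merge_right[of \<A> I Black], of "[]" ?Z] by simp
  have "\<langle>bend (a \<parallel> b)\<rangle> = wh ?X \<langle>Split Black I I\<rangle> [] \<star>
      wh [] (pad s) (I\<bullet>) \<star> wh (I\<bullet>) (pad t) [] \<star> wh [] \<langle>Merge Black I I\<rangle> ?Z"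
    using assms by (subst bend_hor) auto
  also have "\<dots> = pad (s ;; t)"
    by (simp add: pad_def T.comp_reassoc[OF 1] T.comp_reassoc[OF 2] T.comp_reassoc[OF 3]
      T.comp_reassoc[OF 4] 5)
  finally show ?thesis .
qed

text \<open>The \<open>\<iota>b\<close> of \<open>t\<close> meets the \<open>\<kappa>b\<close> of
  \<open>s\<close> and cancels. Since \<open>bend\<close> runs the lower cell first, one slide
  restores the order of the factors.\<close>

lemma pad_ten:
  assumes "wfT \<A> s" "wfT \<A> t" "wfC \<A> a" "wfC \<A> b" "leftC a = srcT \<A> s" "rightC a = tgtT \<A> s"
    "leftC b = srcT \<A> t" "rightC b = tgtT \<A> t"
    "topC \<A> a = I" "topC \<A> b = I" "botC \<A> a = I" "botC \<A> b = I"
    "\<langle>bend a\<rangle> = pad s" "\<langle>bend b\<rangle> = pad t"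
  shows "\<langle>bend (a \<Down> b)\<rangle> = pad (s \<otimes> t)"
proof -
  let ?X = "srcT \<A> s" let ?Y = "tgtT \<A> s" let ?X' = "srcT \<A> t" let ?Y' = "tgtT \<A> t"
  note [simp] = T_simps iota_kappa_wh assms(1,2)
  have 1: "wh ?X \<langle>t\<rangle> [] \<star> wh [] \<langle>s\<rangle> ?Y' = wh [] \<langle>s\<rangle> ?X' \<star> wh ?Y \<langle>t\<rangle> []"
    using slideT[of "\<langle>s\<rangle>" "\<langle>t\<rangle>" "[]" "[]" "[]"] by simp
  have "\<langle>bend (a \<Down> b)\<rangle> = wh ?X (pad t) [] \<star> wh [] (pad s) ?Y'"
    using assms by (subst bend_ver) auto
  also have "\<dots> = pad (s \<otimes> t)"
    by (simp add: pad_def T.comp_reassoc[OF iota_kappa_wh(1)] T.comp_reassoc[OF 1])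
  finally show ?thesis .
qed

section \<open>Bending the images of the generators\<close>

lemma snake_whT:
  "wh (X @ A\<degree>) (\<eta> A) Y \<star> wh X (\<epsilon> A) (A\<degree> @ Y) = idT (X @ A\<degree> @ Y)"
  "wh X (\<eta> A) (A\<bullet> @ Y) \<star> wh (X @ A\<bullet>) (\<epsilon> A) Y = idT (X @ A\<bullet> @ Y)"
  using axT_wh[OF snake_white[of \<A> A], of X Y] axT_wh[OF snake_black[of \<A> A], of X Y]
  by (simp_all add: T_simps)

lemma snakeT: "wh (A\<degree>) (\<eta> A) [] \<star> wh [] (\<epsilon> A) (A\<degree>) = idT (A\<degree>)"
  using snake_whT(1)[of "[]" A "[]"] by (simp add: T_simps)

lemma black_mapped_swap:
  "\<langle>Merge Black A B\<rangle> \<star> \<langle>Map Black (\<sigma>\<^bsub>\<A>\<^esub> B A)\<rangle> \<star> \<langle>Split Black B A\<rangle> = \<langle>Swap Black A B\<rangle>"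
  using axT[OF map_black_braid[of \<A> A B]] by (simp add: T_simps braid_arrow)

text \<open>Translates between the swaps in the axioms for \<open>Eta\<close> and \<open>Eps\<close>
  and the mapped braidings that arise from bending \<open>Lift\<close>.\<close>

lemma split_swap_black:
  "\<langle>Split Black A B\<rangle> \<star> \<langle>Swap Black A B\<rangle> = \<langle>Map Black (\<sigma>\<^bsub>\<A>\<^esub> B A)\<rangle> \<star> \<langle>Split Black B A\<rangle>"
proof -
  have 1: "\<langle>Split Black A B\<rangle> \<star> \<langle>Merge Black A B\<rangle> = idT ((A \<oplus> B)\<bullet>)"
    using axT[OF split_merge[of \<A> Black A B]] by (simp add: T_simps)
  show ?thesis
    unfolding black_mapped_swap[symmetric] by (simp add: T_simps braid_arrow T.comp_reassoc[OF 1])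
qed

lemma swap_merge_black:
  "\<langle>Swap Black B A\<rangle> \<star> \<langle>Merge Black A B\<rangle> = \<langle>Merge Black B A\<rangle> \<star> \<langle>Map Black (\<sigma>\<^bsub>\<A>\<^esub> A B)\<rangle>"
proof -
  have 1: "\<langle>Split Black A B\<rangle> \<star> \<langle>Merge Black A B\<rangle> = idT ((A \<oplus> B)\<bullet>)"
    using axT[OF split_merge[of \<A> Black A B]] by (simp add: T_simps)
  show ?thesis
    unfolding black_mapped_swap[symmetric] by (simp add: T_simps braid_arrow 1)
qed

text \<open>Bending yields the mate of \<open>Map Black f\<close> under \<open>Eta\<close> and
  \<open>Eps\<close>; \<open>map_eps\<close> moves the arrow onto the white strand, and the snake
  straightens what is left.\<close>

lemma bend_M_map_white:
  assumes "f \<in> arrows \<A>"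
  shows "\<langle>bend (M_term \<A> (Map White f))\<rangle> = pad (Map White f)"
proof -
  let ?A = "source \<A> f" let ?B = "target \<A> f" let ?w = "\<langle>Map White f\<rangle>"
  note [simp] = T_simps assms
  have 1: "wh (?A\<degree>) \<langle>Map Black f\<rangle> (?B\<degree>) \<star> wh [] (\<epsilon> ?A) (?B\<degree>) =
      wh [] ?w (?B\<bullet> @ ?B\<degree>) \<star> wh [] (\<epsilon> ?B) (?B\<degree>)"
    using axT_wh[OF map_eps[OF arrows_hom[OF assms]], of "[]" "?B\<degree>"] by simp
  have 2: "wh (?A\<degree>) (\<eta> ?B) [] \<star> wh [] ?w (?B\<bullet> @ ?B\<degree>) = ?w \<star> wh (?B\<degree>) (\<eta> ?B) []"
    using slideT[of ?w "\<eta> ?B" "[]" "[]" "[]"] by simp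
  show ?thesis
    by (simp add: pad_def T.comp_reassoc[OF 1] T.comp_reassoc[OF 2] T.comp_reassoc[OF snakeT])
qed

text \<open>The two nested units, the merge and the braiding are what \<open>eta_split_white\<close>
  produces from one unit followed by the white split. Read backwards, it frees the split, which
  slides past the counit and leaves a snake on \<open>A \<oplus> B\<close>.\<close>

lemma bend_M_split_white: "\<langle>bend (M_term \<A> (Split White A B))\<rangle> = pad (Split White A B)"
proof -
  let ?P = "A \<oplus> B" let ?sp = "\<langle>Split White A B\<rangle>" let ?s = "\<langle>Map Black (\<sigma>\<^bsub>\<A>\<^esub> A B)\<rangle>"
  note [simp] = T_simps braid_arrow
  have 0: "wh X \<langle>Split Black B I\<rangle> Y \<star> wh (X @ B\<bullet>) \<kappa>b Y = idT (X @ B\<bullet> @ Y)" for X Y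
    using axT_wh[OF split_kappa_right[of \<A> Black B], of X Y] by simp
  have sm: "wh (?P\<degree>) \<langle>Swap Black B A\<rangle> (A\<degree> @ B\<degree>) \<star> wh (?P\<degree>) \<langle>Merge Black A B\<rangle> (A\<degree> @ B\<degree>) = 
     wh (?P\<degree>) \<langle>Merge Black B A\<rangle> (A\<degree> @ B\<degree>) \<star> wh (?P\<degree>) ?s (A\<degree> @ B\<degree>)"
    using wh_cong[OF swap_merge_black[of B A], of "?P\<degree>" "A\<degree> @ B\<degree>"] by simp
  have 1: "wh (?P\<degree>) (\<eta> ?P) [] \<star> wh (?P\<degree> @ ?P\<bullet>) ?sp [] =
      wh (?P\<degree>) (\<eta> B) [] \<star> wh (?P\<degree> @ B\<bullet>) (\<eta> A) (B\<degree>) \<star> wh (?P\<degree>) \<langle>Merge Black B A\<rangle> (A\<degree> @ B\<degree>) \<star> wh (?P\<degree>) ?s (A\<degree> @ B\<degree>)"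
    using axT_wh[OF eta_split_white[of \<A> A B], of "?P\<degree>" "[]"] by (simp add: sm)
  have 2: "wh (?P\<degree> @ ?P\<bullet>) ?sp [] \<star> wh [] (\<epsilon> ?P) (A\<degree> @ B\<degree>) = wh [] (\<epsilon> ?P) (?P\<degree>) \<star> ?sp"
    using slideT[of "\<epsilon> ?P" ?sp "[]" "[]" "[]"] by simp
  have "\<langle>bend (M_term \<A> (Split White A B))\<rangle> = wh (?P\<degree>) \<kappa>b [] \<star> 
     (wh (?P\<degree>) (\<eta> B) [] \<star> wh (?P\<degree> @ B\<bullet>) (\<eta> A) (B\<degree>) \<star> wh (?P\<degree>) \<langle>Merge Black B A\<rangle> (A\<degree> @ B\<degree>) \<star> wh (?P\<degree>) ?s (A\<degree> @ B\<degree>))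
     \<star> wh [] (\<epsilon> ?P) (A\<degree> @ B\<degree>) \<star> wh [] \<iota>b (A\<degree> @ B\<degree>)"
    by (simp add: T.comp_reassoc[OF 0])
  also have "\<dots> = pad (Split White A B)"
    unfolding 1[symmetric] 
    by (simp add: pad_def T.comp_reassoc[OF 2] T.comp_reassoc[OF snakeT])
  finally show ?thesis .
qed

text \<open>Dual to the split: here \<open>merge_white_eps\<close> is read backwards, and the merge
  slides past the unit of the snake.\<close>

lemma bend_M_merge_white: "\<langle>bend (M_term \<A> (Merge White A B))\<rangle> = pad (Merge White A B)"
proof -
  let ?P = "A \<oplus> B" let ?mg = "\<langle>Merge White A B\<rangle>" let ?s = "\<langle>Map Black (\<sigma>\<^bsub>\<A>\<^esub> B A)\<rangle>"
  let ?X = "A\<degree> @ B\<degree>"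
  note [simp] = T_simps braid_arrow
  have 0: "wh X \<iota>b (A\<bullet> @ Y) \<star> wh X \<langle>Merge Black I A\<rangle> Y = idT (X @ A\<bullet> @ Y)" for X Y
    using axT_wh[OF iota_merge_left[of \<A> Black A], of X Y] by simp
  have ss: "wh X \<langle>Split Black A B\<rangle> Y \<star> wh X \<langle>Swap Black A B\<rangle> Y = wh X ?s Y \<star> wh X \<langle>Split Black B A\<rangle> Y" for X Y
    using wh_cong[OF split_swap_black[of A B], of X Y] by simp
  have 1: "wh [] ?mg (?P\<bullet> @ ?P\<degree>) \<star> wh [] (\<epsilon> ?P) (?P\<degree>) =
      wh ?X ?s (?P\<degree>) \<star> wh ?X \<langle>Split Black B A\<rangle> (?P\<degree>) \<star> wh (A\<degree>) (\<epsilon> B) (A\<bullet> @ ?P\<degree>) \<star> wh [] (\<epsilon> A) (?P\<degree>)"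
    using axT_wh[OF merge_white_eps[of \<A> A B], of "[]" "?P\<degree>"] by (simp add: T.comp_reassoc[OF ss])
  have 2: "wh ?X (\<eta> ?P) [] \<star> wh [] ?mg (?P\<bullet> @ ?P\<degree>) = ?mg \<star> wh (?P\<degree>) (\<eta> ?P) []"
    using slideT[of ?mg "\<eta> ?P" "[]" "[]" "[]"] by simp
  have 3: "wh (?P\<degree>) (\<eta> ?P) [] \<star> wh [] (\<epsilon> ?P) (?P\<degree>) = idT (?P\<degree>)"
    using snake_whT(1)[of "[]" ?P "[]"] by simp
  have "\<langle>bend (M_term \<A> (Merge White A B))\<rangle> = wh ?X \<kappa>b [] \<star> wh ?X (\<eta> ?P) [] \<star>
     (wh ?X ?s (?P\<degree>) \<star> wh ?X \<langle>Split Black B A\<rangle> (?P\<degree>) \<star> wh (A\<degree>) (\<epsilon> B) (A\<bullet> @ ?P\<degree>) \<star> wh [] (\<epsilon> A) (?P\<degree>))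
     \<star> wh [] \<iota>b (?P\<degree>)"
    by (simp add: T.comp_reassoc[OF 0])
  also have "\<dots> = pad (Merge White A B)"
    unfolding 1[symmetric] 
    by (simp add: pad_def T.comp_reassoc[OF 2[unfolded append_assoc]] T.comp_reassoc[OF 3])
  finally show ?thesis .
qed

text \<open>The braiding arrives as a black swap under two nested units. \<open>etaN_swap\<close>
  carries it to the white side, it slides past both counits, and the two snakes on \<open>A\<close>
  and \<open>B\<close> straighten.\<close>

lemma bend_M_swap_white: "\<langle>bend (M_term \<A> (Swap White A B))\<rangle> = pad (Swap White A B)"
proof -
  let ?X = "A\<degree> @ B\<degree>" let ?Y = "B\<degree> @ A\<degree>" let ?w = "\<langle>Swap White A B\<rangle>" let ?s = "\<langle>Map Black (\<sigma>\<^bsub>\<A>\<^esub> B A)\<rangle>"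
  let ?b = "\<langle>Swap Black A B\<rangle>"
  note [simp] = T_simps braid_arrow
  have 0: "wh X \<iota>b (A\<bullet> @ Y) \<star> wh X \<langle>Merge Black I A\<rangle> Y = idT (X @ A\<bullet> @ Y)" 
    "wh X \<langle>Split Black A I\<rangle> Y \<star> wh (X @ A\<bullet>) \<kappa>b Y = idT (X @ A\<bullet> @ Y)" for X Y
    using axT_wh[OF iota_merge_left[of \<A> Black A], of X Y]
      axT_wh[OF split_kappa_right[of \<A> Black A], of X Y] by simp_all
  have ms: "wh X \<langle>Merge Black A B\<rangle> Y \<star> wh X ?s Y \<star> wh X \<langle>Split Black B A\<rangle> Y = wh X ?b Y" for X Y
    using wh_cong[OF black_mapped_swap[of A B], of X Y] by simp
  have 1: "wh ?X (\<eta> A) [] \<star> wh (?X @ A\<bullet>) (\<eta> B) (A\<degree>) \<star> wh ?X ?b ?Y =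
      wh ?X (\<eta> B) [] \<star> wh (?X @ B\<bullet>) (\<eta> A) (B\<degree>) \<star> wh (?X @ B\<bullet> @ A\<bullet>) ?w []"
    using axT_wh[OF etaN_swap[of \<A> A B], of "?X" "[]"] by simp
  have 2: "wh (?X @ B\<bullet> @ A\<bullet>) ?w [] \<star> wh (A\<degree>) (\<epsilon> B) (A\<bullet> @ ?Y) \<star> wh [] (\<epsilon> A) ?Y =
      wh (A\<degree>) (\<epsilon> B) (A\<bullet> @ ?X) \<star> wh [] (\<epsilon> A) ?X \<star> ?w"
  proof -
    have a: "wh (?X @ B\<bullet> @ A\<bullet>) ?w [] \<star> wh (A\<degree>) (\<epsilon> B) (A\<bullet> @ ?Y) = 
       wh (A\<degree>) (\<epsilon> B) (A\<bullet> @ ?X) \<star> wh (A\<degree> @ A\<bullet>) ?w []"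
      using slideT[of "\<epsilon> B" ?w "A\<degree>" "A\<bullet>" "[]"] by simp
    have b: "wh (A\<degree> @ A\<bullet>) ?w [] \<star> wh [] (\<epsilon> A) ?Y = wh [] (\<epsilon> A) ?X \<star> ?w"
      using slideT[of "\<epsilon> A" ?w "[]" "[]" "[]"] by simp
    show ?thesis by (simp add: T.comp_reassoc[OF a[unfolded append_assoc]] b)
  qed
  have 3: "wh (?X @ B\<bullet>) (\<eta> A) (B\<degree>) \<star> wh (A\<degree>) (\<epsilon> B) (A\<bullet> @ ?X) = wh (A\<degree>) (\<epsilon> B) (B\<degree>) \<star> wh (A\<degree>) (\<eta> A) (B\<degree>)"
    using slideT[of "\<epsilon> B" "\<eta> A" "A\<degree>" "[]" "B\<degree>"] by simp
  have 4: "wh (A\<degree>) (\<eta> A) (B\<degree>) \<star> wh [] (\<epsilon> A) ?X = idT ?X"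
    "wh ?X (\<eta> B) [] \<star> wh (A\<degree>) (\<epsilon> B) (B\<degree>) = idT ?X"
    using snake_whT(1)[of "[]" A "B\<degree>"] snake_whT(1)[of "A\<degree>" B "[]"] by simp_all
  have "\<langle>bend (M_term \<A> (Swap White A B))\<rangle> = wh ?X \<kappa>b [] \<star> wh ?X (\<eta> A) [] \<star> wh (?X @ A\<bullet>) (\<eta> B) (A\<degree>) \<star>
     (wh ?X \<langle>Merge Black A B\<rangle> ?Y \<star> wh ?X ?s ?Y \<star> wh ?X \<langle>Split Black B A\<rangle> ?Y) \<star>
     wh (A\<degree>) (\<epsilon> B) (A\<bullet> @ ?Y) \<star> wh [] (\<epsilon> A) ?Y \<star> wh [] \<iota>b ?Y"
    by (simp add: T.comp_reassoc[OF 0(1)] T.comp_reassoc[OF 0(2)])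
  also have "\<dots> = wh ?X \<kappa>b [] \<star> (wh ?X (\<eta> A) [] \<star> wh (?X @ A\<bullet>) (\<eta> B) (A\<degree>) \<star> wh ?X ?b ?Y) \<star>
     wh (A\<degree>) (\<epsilon> B) (A\<bullet> @ ?Y) \<star> wh [] (\<epsilon> A) ?Y \<star> wh [] \<iota>b ?Y"
    unfolding ms by simp
  also have "\<dots> = wh ?X \<kappa>b [] \<star> wh ?X (\<eta> B) [] \<star> wh (?X @ B\<bullet>) (\<eta> A) (B\<degree>) \<star> 
      (wh (?X @ B\<bullet> @ A\<bullet>) ?w [] \<star> wh (A\<degree>) (\<epsilon> B) (A\<bullet> @ ?Y) \<star> wh [] (\<epsilon> A) ?Y) \<star> wh [] \<iota>b ?Y"
    unfolding 1 by simp
  also have "\<dots> = wh ?X \<kappa>b [] \<star> ?w \<star> wh [] \<iota>b ?Y"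
    unfolding 2 by (simp add: T.comp_reassoc[OF 3[unfolded append_assoc]] T.comp_reassoc[OF 4(1)[unfolded append_assoc]] T.comp_reassoc[OF 4(2)[unfolded append_assoc]])
  also have "\<dots> = pad (Swap White A B)" by (simp add: pad_def)
  finally show ?thesis .
qed

text \<open>No duality enters: the black corners bend to strands, and only the unit edges around
  them have to be cancelled.\<close>

lemma bend_M_black:
  shows "\<langle>bend (M_term \<A> (Split Black A B))\<rangle> = pad (Split Black A B)"
    and "\<langle>bend (M_term \<A> (Merge Black A B))\<rangle> = pad (Merge Black A B)"
    and "\<langle>bend (M_term \<A> (Swap Black A B))\<rangle> = pad (Swap Black A B)"
proof -
  note [simp] = T_simps braid_arrow
  have 1: "wh X \<iota>b (A\<bullet> @ Y) \<star> wh X \<langle>Merge Black I A\<rangle> Y = idT (X @ A\<bullet> @ Y)"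
    "wh (X @ A\<bullet>) \<iota>b Y \<star> wh X \<langle>Merge Black A I\<rangle> Y = idT (X @ A\<bullet> @ Y)"
    "wh X \<langle>Split Black A I\<rangle> Y \<star> wh (X @ A\<bullet>) \<kappa>b Y = idT (X @ A\<bullet> @ Y)"
    "wh X \<langle>Split Black I A\<rangle> Y \<star> wh X \<kappa>b (A\<bullet> @ Y) = idT (X @ A\<bullet> @ Y)" for X Y A
    using axT_wh[OF iota_merge_left[of \<A> Black A], of X Y] axT_wh[OF iota_merge_right[of \<A> A Black], of X Y]
      axT_wh[OF split_kappa_right[of \<A> Black A], of X Y] axT_wh[OF split_kappa_left[of \<A> Black A], of X Y]
    by simp_all
  have 2: "wh (A\<bullet>) \<iota>b (B\<bullet>) \<star> wh [] \<langle>Merge Black A I\<rangle> (B\<bullet>) = idT (A\<bullet> @ B\<bullet>)" for A B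
    using 1(2)[of "[]" A "B\<bullet>"] by simp
  have 3: "wh (A\<bullet>) \<langle>Split Black I B\<rangle> [] \<star> wh (A\<bullet>) \<kappa>b (B\<bullet>) = idT (A\<bullet> @ B\<bullet>)"
    using 1(4)[of "A\<bullet>" B "[]"] by simp
  show "\<langle>bend (M_term \<A> (Split Black A B))\<rangle> = pad (Split Black A B)"
    by (simp add: pad_def T.comp_reassoc[OF 2] T.comp_reassoc[OF 1(3)])
  show "\<langle>bend (M_term \<A> (Merge Black A B))\<rangle> = pad (Merge Black A B)"
    by (simp add: pad_def T.comp_reassoc[OF 3])
  show "\<langle>bend (M_term \<A> (Swap Black A B))\<rangle> = pad (Swap Black A B)"
    by (simp add: pad_def T.comp_reassoc[OF 2] T.comp_reassoc[OF 3]
      T.comp_reassoc2[OF black_mapped_swap])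
qed

text \<open>Bending a white corner on \<open>I\<close> produces \<open>Eta I\<close> or
  \<open>Eps I\<close> instead of \<open>Iota White\<close> or \<open>Kappa White\<close>; hence the
  need for \<open>eta_unit\<close> and \<open>eps_unit\<close>.\<close>

lemma bend_M_unit:
  shows "\<langle>bend (M_term \<A> (Iota p))\<rangle> = pad (Iota p)" "\<langle>bend (M_term \<A> (Kappa p))\<rangle> = pad (Kappa p)"
proof -
  note [simp] = T_simps
  note 1 = iota_kappa_wh[of "[]" "[]", simplified]
  show "\<langle>bend (M_term \<A> (Iota p))\<rangle> = pad (Iota p)"
    by (cases p) (simp_all add: pad_def eta_unit T.comp_reassoc[OF 1(2)] )
  show "\<langle>bend (M_term \<A> (Kappa p))\<rangle> = pad (Kappa p)"
    by (cases p) (simp_all add: pad_def eps_unit 1)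
qed

theorem bend_M:
  assumes "wfT \<A> t"
  shows "\<langle>bend (M_term \<A> t)\<rangle> = pad t"
  using assms
proof (induction t)
  case (Idn X)
  then show ?case by (simp add: pad_def T_simps)
next
  case (Map p f)
  show ?case
  proof (cases p)
    case White
    then show ?thesis using bend_M_map_white Map by simp
  next
    case Black
    then show ?thesis using Map by (simp add: pad_def T_simps)
  qed
next
  case (Split p A B)
  show ?case using bend_M_split_white bend_M_black(1) by (cases p) simp_all
next
  case (Merge p A B)
  show ?case using bend_M_merge_white bend_M_black(2) by (cases p) simp_all
next
  case (Swap p A B)
  show ?case using bend_M_swap_white bend_M_black(3) by (cases p) simp_all
next
  case (Iota p)
  show ?case by (rule bend_M_unit)
next
  case (Kappa p)
  show ?case by (rule bend_M_unit)
next
  case (Eta A)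
  show ?case by (simp add: pad_def T_simps)
next
  case (Eps A)
  show ?case by (simp add: pad_def T_simps)
next
  case (SeqT s t)
  then show ?case using M_term_boundary[of s] M_term_boundary[of t] pad_seq[of s t] by simp
next
  case (TenT s t)
  then show ?case using M_term_boundary[of s] M_term_boundary[of t] pad_ten[of s t] by simp
qed

end

section \<open>Double categories with corners\<close>

context single_object_double_category
begin

abbreviation (input) beside (infixr "\<bbar>" 70) where "a \<bbar> b \<equiv> hor D a b"
abbreviation (input) above (infixr "\<sslash>" 65) where "a \<sslash> b \<equiv> ver D a b"

lemma cellsD: "a \<in> cells D \<Longrightarrow> a \<in> cell D (left_edge D a) (right_edge D a) (top_edge D a) (bot_edge D a)"
  by (simp add: cell_def)

lemma hor_typing:
  assumes "a \<in> cells D" "b \<in> cells D" "right_edge D a = left_edge D b"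
  shows "a \<bbar> b \<in> cells D" "left_edge D (a \<bbar> b) = left_edge D a" "right_edge D (a \<bbar> b) = right_edge D b"
    "top_edge D (a \<bbar> b) = h_tensor D (top_edge D a) (top_edge D b)"
    "bot_edge D (a \<bbar> b) = h_tensor D (bot_edge D a) (bot_edge D b)"
  using hor_cell[OF cellsD[OF assms(1), unfolded assms(3)] cellsD[OF assms(2)]] by (simp_all add: cell_def)

lemma ver_typing:
  assumes "a \<in> cells D" "b \<in> cells D" "bot_edge D a = top_edge D b"
  shows "a \<sslash> b \<in> cells D" "top_edge D (a \<sslash> b) = top_edge D a" "bot_edge D (a \<sslash> b) = bot_edge D b"
    "left_edge D (a \<sslash> b) = v_tensor D (left_edge D a) (left_edge D b)"
    "right_edge D (a \<sslash> b) = v_tensor D (right_edge D a) (right_edge D b)"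
  using ver_cell[OF cellsD[OF assms(1), unfolded assms(3)] cellsD[OF assms(2)]] by (simp_all add: cell_def)

lemma id_typing:
  "id_h D A \<in> cells D" "left_edge D (id_h D A) = v_unit D" "right_edge D (id_h D A) = v_unit D"
  "top_edge D (id_h D A) = A" "bot_edge D (id_h D A) = A"
  "id_v D X \<in> cells D" "left_edge D (id_v D X) = X" "right_edge D (id_v D X) = X"
  "top_edge D (id_v D X) = h_unit D" "bot_edge D (id_v D X) = h_unit D"
  using id_h_cell[of A] id_v_cell[of X] by (simp_all add: cell_def)

lemmas cell_typing = hor_typing ver_typing id_typing
lemmas edge_simps = h_assoc h_unit_left h_unit_right v_assoc v_unit_left v_unit_right

lemma hor_units:
  assumes "a \<in> cells D"
  shows "left_edge D a = X \<Longrightarrow> id_v D X \<bbar> a = a" "right_edge D a = X \<Longrightarrow> a \<bbar> id_v D X = a"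
    "left_edge D a = v_unit D \<Longrightarrow> id_h D (h_unit D) \<bbar> a = a"
    "right_edge D a = v_unit D \<Longrightarrow> a \<bbar> id_h D (h_unit D) = a"
  using hor_unit_left[OF cellsD[OF assms]] hor_unit_right[OF cellsD[OF assms]] by (auto simp: id_units)

lemma ver_units:
  assumes "a \<in> cells D"
  shows "top_edge D a = A \<Longrightarrow> id_h D A \<sslash> a = a" "bot_edge D a = A \<Longrightarrow> a \<sslash> id_h D A = a"
    "top_edge D a = h_unit D \<Longrightarrow> id_v D (v_unit D) \<sslash> a = a"
    "bot_edge D a = h_unit D \<Longrightarrow> a \<sslash> id_v D (v_unit D) = a"
  using ver_unit_left[OF cellsD[OF assms]] ver_unit_right[OF cellsD[OF assms]] by (auto simp: id_units[symmetric])

lemma hor_assoc_cells: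
  assumes "a \<in> cells D" "b \<in> cells D" "c \<in> cells D"
    "right_edge D a = left_edge D b" "right_edge D b = left_edge D c"
  shows "(a \<bbar> b) \<bbar> c = a \<bbar> (b \<bbar> c)"
  by (rule hor_assoc[of a "left_edge D a" "left_edge D b" "top_edge D a" "bot_edge D a" b "left_edge D c"])
    (use assms in \<open>auto simp: cell_def\<close>)

lemma ver_assoc_cells:
  assumes "a \<in> cells D" "b \<in> cells D" "c \<in> cells D"
    "bot_edge D a = top_edge D b" "bot_edge D b = top_edge D c"
  shows "(a \<sslash> b) \<sslash> c = a \<sslash> (b \<sslash> c)"
  by (rule ver_assoc[of a "left_edge D a" "right_edge D a" "top_edge D a" "bot_edge D a" b
        "left_edge D b" "right_edge D b" "bot_edge D b"])
    (use assms in \<open>auto simp: cell_def\<close>)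

lemma interchange_cells:
  assumes "a \<in> cells D" "b \<in> cells D" "c \<in> cells D" "d \<in> cells D"
    "bot_edge D a = top_edge D b" "bot_edge D c = top_edge D d"
    "right_edge D a = left_edge D c" "right_edge D b = left_edge D d"
  shows "(a \<sslash> b) \<bbar> (c \<sslash> d) = (a \<bbar> c) \<sslash> (b \<bbar> d)"
  by (rule interchange[of a "left_edge D a" "left_edge D c" "top_edge D a" "top_edge D b" b
        "left_edge D b" "left_edge D d" "bot_edge D b" c "right_edge D c" "top_edge D c" "top_edge D d"])
    (use assms in \<open>auto simp: cell_def\<close>)

lemmas unit_laws = hor_units ver_units hor_id_h ver_id_v
lemmas cell_simps = cell_typing edge_simps unit_laws ver_assoc_cells

text \<open>An Eckmann--Hilton argument.\<close>

lemma hor_eq_ver: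
  assumes "a \<in> cells D" "b \<in> cells D" "right_edge D a = v_unit D" "left_edge D b = v_unit D"
    "top_edge D a = h_unit D" "bot_edge D b = h_unit D"
  shows "a \<bbar> b = b \<sslash> a"
proof -
  have "a \<bbar> b = (id_h D (h_unit D) \<sslash> a) \<bbar> (b \<sslash> id_h D (h_unit D))"
    using assms by (simp add: cell_simps)
  also have "\<dots> = (id_h D (h_unit D) \<bbar> b) \<sslash> (a \<bbar> id_h D (h_unit D))"
    using assms by (intro interchange_cells) (simp_all add: cell_simps)
  finally show ?thesis using assms by (simp add: cell_simps)
qed

end

text \<open>Left-right reflection. It carries black corners to the boundaries of white ones, so that
  columns of corners are studied only once.\<close>

definition hor_opposite :: "('h, 'v, 'c, 'r) sodc_scheme \<Rightarrow> ('h, 'v, 'c, 'r) sodc_scheme"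
  where "hor_opposite D = D\<lparr>h_tensor := \<lambda>A B. h_tensor D B A, left_edge := right_edge D,
    right_edge := left_edge D, hor := \<lambda>a b. hor D b a\<rparr>"

lemma hor_opposite_simps:
  "h_tensor (hor_opposite D) A B = h_tensor D B A" "h_unit (hor_opposite D) = h_unit D" "v_tensor (hor_opposite D) = v_tensor D"
  "v_unit (hor_opposite D) = v_unit D" "cells (hor_opposite D) = cells D" "top_edge (hor_opposite D) = top_edge D"
  "bot_edge (hor_opposite D) = bot_edge D" "left_edge (hor_opposite D) = right_edge D" "right_edge (hor_opposite D) = left_edge D"
  "id_h (hor_opposite D) = id_h D" "id_v (hor_opposite D) = id_v D" "hor (hor_opposite D) a b = hor D b a" "ver (hor_opposite D) = ver D"
  by (simp_all add: hor_opposite_def)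

lemma cell_hor_opposite: "cell (hor_opposite D) X Y A B = cell D Y X A B"
  by (auto simp: cell_def hor_opposite_simps)

lemma (in single_object_double_category) double_category_hor_opposite: "single_object_double_category (hor_opposite D)"
proof (unfold_locales, unfold hor_opposite_simps cell_hor_opposite, goal_cases)
  case 9 then show ?case by (rule hor_cell[rotated])
next
  case 10 then show ?case by (rule ver_cell)
next
  case 11 then show ?case by (metis hor_assoc)
next
  case 12 then show ?case by (rule ver_assoc)
next
  case 20 then show ?case by (intro interchange)
qed (simp_all add: edge_simps id_h_cell id_v_cell hor_unit_left hor_unit_right ver_unit_left ver_unit_right
    hor_id_h ver_id_v id_units)

text \<open>
  White corners form this structure in the free cornering, and black corners form it in the
  horizontal opposite.
\<close>

locale corner = single_object_double_category D for D :: "('o, 'v, 'c, 'r) sodc_scheme" +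
  fixes emb :: "'o \<Rightarrow> 'v" and S R :: "'o \<Rightarrow> 'c"
  assumes send_cell: "S A \<in> cell D (v_unit D) (emb A) A (h_unit D)"
    and recv_cell: "R A \<in> cell D (emb A) (v_unit D) (h_unit D) A"
    and yank_h: "hor D (S A) (R A) = id_h D A"
    and yank_v: "ver D (R A) (S A) = id_v D (emb A)"
begin

lemma corner_typing:
  "S A \<in> cells D" "left_edge D (S A) = v_unit D" "right_edge D (S A) = emb A"
  "top_edge D (S A) = A" "bot_edge D (S A) = h_unit D"
  "R A \<in> cells D" "left_edge D (R A) = emb A" "right_edge D (R A) = v_unit D"
  "top_edge D (R A) = h_unit D" "bot_edge D (R A) = A"
  using send_cell[of A] recv_cell[of A] by (simp_all add: cell_def)

section \<open>Columns of corners\<close>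

primrec edge :: "'o list \<Rightarrow> 'v" where
  "edge [] = v_unit D"
| "edge (A # X) = v_tensor D (emb A) (edge X)"

text \<open>The order is reversed because later letters enter from the left edge and stop to the
  left of those received before.\<close>

primrec obj :: "'o list \<Rightarrow> 'o" where
  "obj [] = h_unit D"
| "obj (A # X) = h_tensor D (obj X) A"

primrec recv :: "'o list \<Rightarrow> 'c" where
  "recv [] = id_h D (h_unit D)"
| "recv (A # X) = R A \<sslash> (recv X \<bbar> id_h D A)"

primrec send :: "'o list \<Rightarrow> 'c" where
  "send [] = id_h D (h_unit D)"
| "send (A # X) = (id_h D (obj X) \<bbar> S A) \<sslash> send X"

lemma recv_typing:
  "recv X \<in> cells D" "left_edge D (recv X) = edge X" "right_edge D (recv X) = v_unit D"
  "top_edge D (recv X) = h_unit D" "bot_edge D (recv X) = obj X"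
proof -
  have "recv X \<in> cells D \<and> left_edge D (recv X) = edge X \<and> right_edge D (recv X) = v_unit D \<and>
      top_edge D (recv X) = h_unit D \<and> bot_edge D (recv X) = obj X"
    by (induction X) (auto simp: cell_simps corner_typing)
  then show "recv X \<in> cells D" "left_edge D (recv X) = edge X" "right_edge D (recv X) = v_unit D"
  "top_edge D (recv X) = h_unit D" "bot_edge D (recv X) = obj X" by auto
qed

lemma send_typing:
  "send X \<in> cells D" "right_edge D (send X) = edge X" "left_edge D (send X) = v_unit D"
  "bot_edge D (send X) = h_unit D" "top_edge D (send X) = obj X"
proof -
  have "send X \<in> cells D \<and> right_edge D (send X) = edge X \<and> left_edge D (send X) = v_unit D \<and>
      bot_edge D (send X) = h_unit D \<and> top_edge D (send X) = obj X"
    by (induction X) (auto simp: cell_simps corner_typing)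
  then show "send X \<in> cells D" "right_edge D (send X) = edge X" "left_edge D (send X) = v_unit D"
  "bot_edge D (send X) = h_unit D" "top_edge D (send X) = obj X" by auto
qed

lemmas corner_simps = cell_simps corner_typing recv_typing send_typing

lemma obj_append: "obj (X @ Y) = h_tensor D (obj Y) (obj X)"
  by (induction X) (simp_all add: edge_simps)

text \<open>Yanking for a whole column: interchange pairs the corners on the first letter and leaves
  the shorter columns to the induction.\<close>

lemma send_recv: "send X \<bbar> recv X = id_h D (obj X)"
proof (induction X)
  case Nil
  then show ?case by (simp add: corner_simps)
next
  case (Cons A X)
  have "send (A # X) \<bbar> recv (A # X) =
      ((id_h D (obj X) \<bbar> S A) \<bbar> R A) \<sslash> (send X \<bbar> (recv X \<bbar> id_h D A))"
    unfolding send.simps recv.simps by (rule interchange_cells) (simp_all add: corner_simps)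
  also have "(id_h D (obj X) \<bbar> S A) \<bbar> R A = id_h D (obj X) \<bbar> id_h D A"
    by (subst hor_assoc_cells) (simp_all add: corner_simps yank_h)
  also have "send X \<bbar> (recv X \<bbar> id_h D A) = id_h D (obj X) \<bbar> id_h D A"
    by (subst hor_assoc_cells[symmetric]) (simp_all add: corner_simps Cons)
  finally show ?case by (simp add: corner_simps)
qed

text \<open>Both sides equal \<open>(recv X' \<sslash> d) \<bbar> (c \<sslash> send Y)\<close>, the
  left by interchange and the right by \<open>hor_eq_ver\<close>. This is where two layers stacked
  vertically are made to overlap.\<close>

lemma recv_send_middle:
  assumes "c \<in> cells D" "left_edge D c = v_unit D" "right_edge D c = v_unit D"
    "d \<in> cells D" "left_edge D d = v_unit D" "right_edge D d = v_unit D"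
    "top_edge D c = obj X" "bot_edge D c = obj Y" "top_edge D d = obj X'" "bot_edge D d = obj Y'"
  shows "(recv X' \<bbar> id_h D (obj X)) \<sslash> (d \<bbar> c) \<sslash> (id_h D (obj Y') \<bbar> send Y) =
    (c \<sslash> send Y) \<sslash> (recv X' \<sslash> d)"
proof -
  have "(d \<bbar> c) \<sslash> (id_h D (obj Y') \<bbar> send Y) = (d \<sslash> id_h D (obj Y')) \<bbar> (c \<sslash> send Y)"
    using assms by (intro interchange_cells[symmetric]) (simp_all add: corner_simps)
  moreover have "(recv X' \<bbar> id_h D (obj X)) \<sslash> (d \<bbar> (c \<sslash> send Y)) =
      (recv X' \<sslash> d) \<bbar> (id_h D (obj X) \<sslash> (c \<sslash> send Y))"
    using assms by (intro interchange_cells[symmetric]) (simp_all add: corner_simps)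
  ultimately have "(recv X' \<bbar> id_h D (obj X)) \<sslash> (d \<bbar> c) \<sslash> (id_h D (obj Y') \<bbar> send Y) =
      (recv X' \<sslash> d) \<bbar> (c \<sslash> send Y)"
    using assms by (simp add: corner_simps)
  also have "\<dots> = (c \<sslash> send Y) \<sslash> (recv X' \<sslash> d)"
    using assms by (intro hor_eq_ver) (simp_all add: corner_simps)
  finally show ?thesis .
qed

lemma recv_append: "recv (X @ Y) = recv X \<sslash> (recv Y \<bbar> id_h D (obj X))"
proof (induction X)
  case Nil
  then show ?case by (simp add: corner_simps)
next
  case (Cons A X)
  have "recv (X @ Y) \<bbar> id_h D A = (recv X \<sslash> (recv Y \<bbar> id_h D (obj X))) \<bbar> (id_h D A \<sslash> id_h D A)"
    by (simp add: Cons corner_simps)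
  also have "\<dots> = (recv X \<bbar> id_h D A) \<sslash> ((recv Y \<bbar> id_h D (obj X)) \<bbar> id_h D A)"
    by (intro interchange_cells) (simp_all add: corner_simps)
  also have "(recv Y \<bbar> id_h D (obj X)) \<bbar> id_h D A = recv Y \<bbar> id_h D (obj (A # X))"
    by (subst hor_assoc_cells) (simp_all add: corner_simps)
  finally show ?case by (simp add: corner_simps)
qed

lemma send_append: "send (X @ Y) = (id_h D (obj Y) \<bbar> send X) \<sslash> send Y"
proof (induction X)
  case Nil
  then show ?case by (simp add: corner_simps)
next
  case (Cons A X)
  have "(id_h D (obj (X @ Y)) \<bbar> S A) \<sslash> (id_h D (obj Y) \<bbar> send X) =
      (id_h D (obj Y) \<bbar> (id_h D (obj X) \<bbar> S A)) \<sslash> (id_h D (obj Y) \<bbar> send X)"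
    by (subst hor_assoc_cells[symmetric]) (simp_all add: corner_simps obj_append)
  also have "\<dots> = (id_h D (obj Y) \<sslash> id_h D (obj Y)) \<bbar> ((id_h D (obj X) \<bbar> S A) \<sslash> send X)"
    by (intro interchange_cells[symmetric]) (simp_all add: corner_simps)
  finally have *: "(id_h D (obj (X @ Y)) \<bbar> S A) \<sslash> (id_h D (obj Y) \<bbar> send X) = id_h D (obj Y) \<bbar> send (A # X)"
    by (simp add: corner_simps)
  show ?case
    unfolding *[symmetric] by (simp add: Cons corner_simps obj_append)
qed

text \<open>Makes a horizontal cell out of a cell that runs from top to bottom. Morphisms of a
  single colour all have this shape, with an arrow of the base category as \<open>c\<close>.\<close>

definition lay :: "'c \<Rightarrow> 'o list \<Rightarrow> 'o list \<Rightarrow> 'c"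
  where "lay c X Y = recv X \<sslash> (c \<sslash> send Y)"

text \<open>The lower layer ends up on the left, since its word is received later.\<close>

lemma lay_ver:
  assumes "c \<in> cells D" "left_edge D c = v_unit D" "right_edge D c = v_unit D"
    "d \<in> cells D" "left_edge D d = v_unit D" "right_edge D d = v_unit D"
    "top_edge D c = obj X" "bot_edge D c = obj Y" "top_edge D d = obj X'" "bot_edge D d = obj Y'"
  shows "lay c X Y \<sslash> lay d X' Y' = lay (d \<bbar> c) (X @ X') (Y @ Y')"
proof -
  have "lay (d \<bbar> c) (X @ X') (Y @ Y') =
      recv X \<sslash> ((recv X' \<bbar> id_h D (obj X)) \<sslash> (d \<bbar> c) \<sslash> (id_h D (obj Y') \<bbar> send Y)) \<sslash> send Y'"
    using assms by (simp add: lay_def recv_append send_append corner_simps)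
  also have "\<dots> = lay c X Y \<sslash> lay d X' Y'"
    using assms by (simp only: recv_send_middle) (simp add: lay_def corner_simps)
  finally show ?thesis ..
qed

lemma lay_id: "lay (id_h D (obj X)) X X = id_v D (edge X)"
proof (induction X)
  case Nil
  then show ?case by (simp add: lay_def corner_simps id_units)
next
  case (Cons A X)
  have single: "lay (id_h D A) [A] [A] = id_v D (emb A)"
    by (simp add: lay_def corner_simps yank_v)
  have "lay (id_h D A) [A] [A] \<sslash> lay (id_h D (obj X)) X X = lay (id_h D (obj X) \<bbar> id_h D A) ([A] @ X) ([A] @ X)"
    by (rule lay_ver) (simp_all add: corner_simps)
  then show ?case by (simp add: single Cons corner_simps)
qed

text \<open>The columns that cancel need not be at the ends of their factors: \<open>U\<close>
  carries the right edge of \<open>c\<close> over the receiving column, and \<open>W\<close> carries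
  the left edge of \<open>d\<close> under the sending one. Interchange brings the columns side by
  side. The snake equations and the rules for cups and caps are instances.\<close>

lemma yank_across:
  assumes "c \<in> cells D" "d \<in> cells D" "right_edge D c = U" "left_edge D d = W"
    "bot_edge D c = obj X" "top_edge D d = obj X"
  shows "((c \<sslash> send X) \<sslash> id_v D W) \<bbar> (id_v D U \<sslash> (recv X \<sslash> d)) = c \<sslash> d"
proof -
  have "((c \<sslash> send X) \<sslash> id_v D W) \<bbar> (id_v D U \<sslash> (recv X \<sslash> d)) =
      (c \<sslash> (send X \<sslash> id_v D W)) \<bbar> (id_v D U \<sslash> (recv X \<sslash> d))"
    using assms by (simp add: corner_simps)
  also have "\<dots> = (c \<bbar> id_v D U) \<sslash> ((send X \<sslash> id_v D W) \<bbar> (recv X \<sslash> d))"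
    using assms by (intro interchange_cells) (simp_all add: corner_simps)
  also have "(send X \<sslash> id_v D W) \<bbar> (recv X \<sslash> d) = (send X \<bbar> recv X) \<sslash> (id_v D W \<bbar> d)"
    using assms by (intro interchange_cells) (simp_all add: corner_simps)
  finally show ?thesis using assms by (simp add: corner_simps send_recv)
qed

text \<open>This is \<open>yank_across\<close> with both bypassing edges empty.\<close>

lemma lay_hor:
  assumes "c \<in> cells D" "left_edge D c = v_unit D" "right_edge D c = v_unit D"
    "d \<in> cells D" "left_edge D d = v_unit D" "right_edge D d = v_unit D"
    "top_edge D c = obj X" "bot_edge D c = obj Y" "top_edge D d = obj Y" "bot_edge D d = obj Z"
  shows "lay c X Y \<bbar> lay d Y Z = lay (c \<sslash> d) X Z"
proof -
  have *: "((recv X \<sslash> c) \<sslash> send Y) \<sslash> id_v D (v_unit D) = lay c X Y"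
    "id_v D (v_unit D) \<sslash> (recv Y \<sslash> (d \<sslash> send Z)) = lay d Y Z"
    "(recv X \<sslash> c) \<sslash> (d \<sslash> send Z) = lay (c \<sslash> d) X Z"
    using assms by (simp_all add: lay_def corner_simps)
  have "(((recv X \<sslash> c) \<sslash> send Y) \<sslash> id_v D (v_unit D)) \<bbar> (id_v D (v_unit D) \<sslash> (recv Y \<sslash> (d \<sslash> send Z))) =
      (recv X \<sslash> c) \<sslash> (d \<sslash> send Z)"
    using assms by (intro yank_across) (simp_all add: corner_simps)
  then show ?thesis by (simp only: *)
qed

end

section \<open>From morphisms of T to cells\<close>

context symmetric_strict_monoidal_base
begin

abbreviation FD where "FD \<equiv> free_cornering \<A>"
abbreviation clC :: "('o, 'm) cterm \<Rightarrow> ('o, 'm) cterm set" ("\<lblot>_\<rblot>") where "\<lblot>a\<rblot> \<equiv> classC \<A> a"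
abbreviation besideC (infixr "\<triangleright>" 70) where "a \<triangleright> b \<equiv> hor (free_cornering \<A>) a b"
abbreviation aboveC (infixr "\<nabla>" 65) where "a \<nabla> b \<equiv> ver (free_cornering \<A>) a b"

sublocale W: corner "free_cornering \<A>" "\<lambda>A. A\<degree>" "\<lambda>A. classC \<A> (Send White A)" "\<lambda>A. classC \<A> (Recv White A)"
proof (rule corner.intro[OF free_cornering_double_category], unfold_locales, goal_cases)
  case (1 A) show ?case
    unfolding cell_free_cornering free_cornering_simps by (intro exI[of _ "Send White A"]) simp
next
  case (2 A) show ?case
    unfolding cell_free_cornering free_cornering_simps by (intro exI[of _ "Recv White A"]) simp
next
  case (3 A) show ?case
    by (simp add: hor_classC free_cornering_simps) (intro classC_eqI eqC.ax yank_white_h)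
next
  case (4 A) show ?case
    by (simp add: ver_classC free_cornering_simps) (intro classC_eqI eqC.ax yank_white_v)
qed

sublocale B: corner "hor_opposite (free_cornering \<A>)" "\<lambda>A. A\<bullet>" "\<lambda>A. classC \<A> (Send Black A)" "\<lambda>A. classC \<A> (Recv Black A)"
proof (rule corner.intro[OF W.double_category_hor_opposite], unfold_locales, goal_cases)
  case (1 A) show ?case
    unfolding cell_hor_opposite hor_opposite_simps cell_free_cornering free_cornering_simps by (intro exI[of _ "Send Black A"]) simp
next
  case (2 A) show ?case
    unfolding cell_hor_opposite hor_opposite_simps cell_free_cornering free_cornering_simps by (intro exI[of _ "Recv Black A"]) simp
next
  case (3 A) show ?case
    by (simp add: hor_opposite_simps hor_classC free_cornering_simps) (intro classC_eqI eqC.ax yank_black_h)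
next
  case (4 A) show ?case
    by (simp add: hor_opposite_simps ver_classC free_cornering_simps) (intro classC_eqI eqC.ax yank_black_v)
qed

lemmas FD_ob = free_cornering_simps(1-4)

lemma class_typing:
  assumes "wfC \<A> a"
  shows "\<lblot>a\<rblot> \<in> cells FD" "top_edge FD \<lblot>a\<rblot> = topC \<A> a" "bot_edge FD \<lblot>a\<rblot> = botC \<A> a"
    "left_edge FD \<lblot>a\<rblot> = leftC a" "right_edge FD \<lblot>a\<rblot> = rightC a"
  using assms by (simp_all add: free_cornering_edges) (simp add: free_cornering_def)

lemmas cell_class = hor_classC[symmetric] ver_classC[symmetric] free_cornering_simps(5,6)[symmetric]

lemmas D_simps = W.cell_simps[unfolded FD_ob] W.recv_typing[unfolded FD_ob] W.send_typing[unfolded FD_ob]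
  W.edge.simps[unfolded FD_ob] W.obj.simps[unfolded FD_ob]
  B.recv_typing[unfolded FD_ob hor_opposite_simps] B.send_typing[unfolded FD_ob hor_opposite_simps]
  B.edge.simps[unfolded FD_ob hor_opposite_simps] B.obj.simps[unfolded FD_ob hor_opposite_simps] class_typing FD_ob hor_opposite_simps

lemmas lift_eqs = classC_eqI[OF eqC.ax[OF cornering_axiom.lift_comp]]
  classC_eqI[OF eqC.ax[OF cornering_axiom.lift_tensor]] classC_eqI[OF eqC.ax[OF cornering_axiom.lift_ident]]

lemma lift_ver:
  assumes "f \<in> arrows \<A>" "g \<in> arrows \<A>" "target \<A> f = source \<A> g"
  shows "\<lblot>Lift f\<rblot> \<nabla> \<lblot>Lift g\<rblot> = \<lblot>Lift (f \<cdot>\<^bsub>\<A>\<^esub> g)\<rblot>"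
  using assms lift_eqs(1)[of f "source \<A> f" "source \<A> g" g "target \<A> g"]
  by (simp add: cell_class hom_def)

lemma lift_hor:
  assumes "f \<in> arrows \<A>" "g \<in> arrows \<A>"
  shows "\<lblot>Lift f\<rblot> \<triangleright> \<lblot>Lift g\<rblot> = \<lblot>Lift (f \<boxtimes>\<^bsub>\<A>\<^esub> g)\<rblot>"
  using assms lift_eqs(2)[of f g] by (simp add: cell_class)

lemma lift_id: "\<lblot>Lift (ident \<A> A)\<rblot> = id_h FD A"
  using lift_eqs(3)[of A] by (simp add: cell_class)

section \<open>Terms of a single colour as arrows of the base category\<close>

primrec monochrome :: "polarity \<Rightarrow> ('o, 'm) tterm \<Rightarrow> bool" where
  "monochrome p (Idn X) \<longleftrightarrow> (\<forall>x \<in> set X. snd x = p)"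
| "monochrome p (Map q f) \<longleftrightarrow> q = p"
| "monochrome p (Split q A B) \<longleftrightarrow> q = p"
| "monochrome p (Merge q A B) \<longleftrightarrow> q = p"
| "monochrome p (Iota q) \<longleftrightarrow> q = p"
| "monochrome p (Kappa q) \<longleftrightarrow> q = p"
| "monochrome p (Swap q A B) \<longleftrightarrow> q = p"
| "monochrome p (Eta A) \<longleftrightarrow> False"
| "monochrome p (Eps A) \<longleftrightarrow> False"
| "monochrome p (s ;; t) \<longleftrightarrow> monochrome p s \<and> monochrome p t"
| "monochrome p (s \<otimes> t) \<longleftrightarrow> monochrome p s \<and> monochrome p t"

text \<open>
  The first letter of a white word is received first and hence lies rightmost, so tensor products
  are reversed; for black words, composition is reversed instead. The values at \<open>Eta\<close> and \<open>Eps\<close> are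
  irrelevant.
\<close>

primrec white_arrow :: "('o, 'm) tterm \<Rightarrow> 'm" where
  "white_arrow (Idn X) = ident \<A> (W.obj (map fst X))"
| "white_arrow (Map q f) = f"
| "white_arrow (Split q A B) = \<sigma>\<^bsub>\<A>\<^esub> A B"
| "white_arrow (Merge q A B) = \<sigma>\<^bsub>\<A>\<^esub> B A"
| "white_arrow (Iota q) = ident \<A> (unit_ob \<A>)"
| "white_arrow (Kappa q) = ident \<A> (unit_ob \<A>)"
| "white_arrow (Swap q A B) = \<sigma>\<^bsub>\<A>\<^esub> B A"
| "white_arrow (Eta A) = undefined"
| "white_arrow (Eps A) = undefined"
| "white_arrow (s ;; t) = white_arrow s \<cdot>\<^bsub>\<A>\<^esub> white_arrow t"
| "white_arrow (s \<otimes> t) = white_arrow t \<boxtimes>\<^bsub>\<A>\<^esub> white_arrow s"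

text \<open>In a black word the first letter lies leftmost, so splitting and merging need no
  braiding.\<close>

primrec black_arrow :: "('o, 'm) tterm \<Rightarrow> 'm" where
  "black_arrow (Idn X) = ident \<A> (B.obj (map fst X))"
| "black_arrow (Map q f) = f"
| "black_arrow (Split q A B) = ident \<A> (A \<oplus> B)"
| "black_arrow (Merge q A B) = ident \<A> (A \<oplus> B)"
| "black_arrow (Iota q) = ident \<A> (unit_ob \<A>)"
| "black_arrow (Kappa q) = ident \<A> (unit_ob \<A>)"
| "black_arrow (Swap q A B) = \<sigma>\<^bsub>\<A>\<^esub> B A"
| "black_arrow (Eta A) = undefined"
| "black_arrow (Eps A) = undefined"
| "black_arrow (s ;; t) = black_arrow t \<cdot>\<^bsub>\<A>\<^esub> black_arrow s"
| "black_arrow (s \<otimes> t) = black_arrow s \<boxtimes>\<^bsub>\<A>\<^esub> black_arrow t"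

lemma edge_white: "(\<forall>x \<in> set X. snd x = White) \<Longrightarrow> W.edge (map fst X) = X"
  by (induction X) (auto simp: FD_ob append.simps(2))

lemma edge_black: "(\<forall>x \<in> set X. snd x = Black) \<Longrightarrow> B.edge (map fst X) = X"
  by (induction X) (auto simp: FD_ob hor_opposite_simps append.simps(2))

lemma white_obj_append: "W.obj (X @ Y) = W.obj Y \<oplus> W.obj X"
  by (simp add: W.obj_append FD_ob)

lemma black_obj_append: "B.obj (X @ Y) = B.obj X \<oplus> B.obj Y"
  by (simp add: B.obj_append FD_ob hor_opposite_simps)

lemma white_arrow_typing:
  assumes "wfT \<A> t" "monochrome White t"
  shows "white_arrow t \<in> arrows \<A>" "source \<A> (white_arrow t) = W.obj (map fst (srcT \<A> t))"
    "target \<A> (white_arrow t) = W.obj (map fst (tgtT \<A> t))"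
proof -
  have "white_arrow t \<in> arrows \<A> \<and> source \<A> (white_arrow t) = W.obj (map fst (srcT \<A> t)) \<and>
    target \<A> (white_arrow t) = W.obj (map fst (tgtT \<A> t))"
    using assms by (induction t) (auto simp: D_simps typing objs braid_arrow white_obj_append)
  then show "white_arrow t \<in> arrows \<A>" "source \<A> (white_arrow t) = W.obj (map fst (srcT \<A> t))"
    "target \<A> (white_arrow t) = W.obj (map fst (tgtT \<A> t))" by auto
qed

lemma black_arrow_typing:
  assumes "wfT \<A> t" "monochrome Black t"
  shows "black_arrow t \<in> arrows \<A>" "source \<A> (black_arrow t) = B.obj (map fst (tgtT \<A> t))"
    "target \<A> (black_arrow t) = B.obj (map fst (srcT \<A> t))"
proof -
  have "black_arrow t \<in> arrows \<A> \<and> source \<A> (black_arrow t) = B.obj (map fst (tgtT \<A> t)) \<and>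
    target \<A> (black_arrow t) = B.obj (map fst (srcT \<A> t))"
    using assms by (induction t) (auto simp: D_simps typing objs braid_arrow black_obj_append)
  then show "black_arrow t \<in> arrows \<A>" "source \<A> (black_arrow t) = B.obj (map fst (tgtT \<A> t))"
    "target \<A> (black_arrow t) = B.obj (map fst (srcT \<A> t))" by auto
qed

lemma M_seq: "wfT \<A> (s ;; t) \<Longrightarrow> \<lblot>M_term \<A> (s ;; t)\<rblot> = \<lblot>M_term \<A> s\<rblot> \<triangleright> \<lblot>M_term \<A> t\<rblot>"
  using M_term_boundary[of s] M_term_boundary[of t] by (simp add: cell_class)

lemma M_ten: "wfT \<A> (s \<otimes> t) \<Longrightarrow> \<lblot>M_term \<A> (s \<otimes> t)\<rblot> = \<lblot>M_term \<A> s\<rblot> \<nabla> \<lblot>M_term \<A> t\<rblot>"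
  using M_term_boundary[of s] M_term_boundary[of t] by (simp add: cell_class)

lemma M_Idn: "\<lblot>M_term \<A> (Idn X)\<rblot> = id_v FD X"
  by (simp add: cell_class)

text \<open>Composition and tensor of layers take place in the base category by
  \<open>W.lay_hor\<close> and \<open>W.lay_ver\<close>. Equations between white terms are thereby
  reduced to equations between arrows of \<open>\<A>\<close>.\<close>

lemma white_lay:
  assumes "wfT \<A> t" "monochrome White t"
  shows "\<lblot>M_term \<A> t\<rblot> = W.lay \<lblot>Lift (white_arrow t)\<rblot> (map fst (srcT \<A> t)) (map fst (tgtT \<A> t))"
  using assms
proof (induction t)
  case (Idn X)
  then show ?case by (simp add: cell_class lift_id W.lay_id edge_white)
next
  case (SeqT s t)
  then have "wfT \<A> s" "wfT \<A> t" "monochrome White s" "monochrome White t" "tgtT \<A> s = srcT \<A> t" by auto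
  note [simp] = this white_arrow_typing[OF this(1,3)] white_arrow_typing[OF this(2,4)]
  have "\<lblot>M_term \<A> (s ;; t)\<rblot> = W.lay \<lblot>Lift (white_arrow s)\<rblot> (map fst (srcT \<A> s)) (map fst (srcT \<A> t)) \<triangleright>
      W.lay \<lblot>Lift (white_arrow t)\<rblot> (map fst (srcT \<A> t)) (map fst (tgtT \<A> t))"
    using SeqT by (subst M_seq) simp_all
  also have "\<dots> = W.lay (\<lblot>Lift (white_arrow s)\<rblot> \<nabla> \<lblot>Lift (white_arrow t)\<rblot>) (map fst (srcT \<A> s)) (map fst (tgtT \<A> t))"
    by (rule W.lay_hor) (simp_all add: D_simps)
  finally show ?case by (simp add: lift_ver)
next
  case (TenT s t)
  then have "wfT \<A> s" "wfT \<A> t" "monochrome White s" "monochrome White t" by auto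
  note [simp] = this white_arrow_typing[OF this(1,3)] white_arrow_typing[OF this(2,4)]
  have "\<lblot>M_term \<A> (s \<otimes> t)\<rblot> = W.lay \<lblot>Lift (white_arrow s)\<rblot> (map fst (srcT \<A> s)) (map fst (tgtT \<A> s)) \<nabla>
      W.lay \<lblot>Lift (white_arrow t)\<rblot> (map fst (srcT \<A> t)) (map fst (tgtT \<A> t))"
    using TenT by (subst M_ten) simp_all
  also have "\<dots> = W.lay (\<lblot>Lift (white_arrow t)\<rblot> \<triangleright> \<lblot>Lift (white_arrow s)\<rblot>)
      (map fst (srcT \<A> s) @ map fst (srcT \<A> t)) (map fst (tgtT \<A> s) @ map fst (tgtT \<A> t))"
    by (rule W.lay_ver) (simp_all add: D_simps)
  finally show ?case by (simp add: lift_hor)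
qed (simp_all add: cell_class D_simps W.lay_def objs braid_arrow lift_id append.simps(2))

text \<open>The same argument in the reflected double category, where source and target change
  places.\<close>

lemma black_lay:
  assumes "wfT \<A> t" "monochrome Black t"
  shows "\<lblot>M_term \<A> t\<rblot> = B.lay \<lblot>Lift (black_arrow t)\<rblot> (map fst (tgtT \<A> t)) (map fst (srcT \<A> t))"
  using assms
proof (induction t)
  case (Idn X)
  then show ?case
    using B.lay_id[of "map fst X", unfolded hor_opposite_simps] by (simp add: cell_class lift_id edge_black)
next
  case (SeqT s t)
  then have "wfT \<A> s" "wfT \<A> t" "monochrome Black s" "monochrome Black t" "tgtT \<A> s = srcT \<A> t" by auto
  note [simp] = this black_arrow_typing[OF this(1,3)] black_arrow_typing[OF this(2,4)]
  have "\<lblot>M_term \<A> (s ;; t)\<rblot> = B.lay \<lblot>Lift (black_arrow s)\<rblot> (map fst (srcT \<A> t)) (map fst (srcT \<A> s)) \<triangleright>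
      B.lay \<lblot>Lift (black_arrow t)\<rblot> (map fst (tgtT \<A> t)) (map fst (srcT \<A> t))"
    using SeqT by (subst M_seq) simp_all
  also have "\<dots> = B.lay (\<lblot>Lift (black_arrow t)\<rblot> \<nabla> \<lblot>Lift (black_arrow s)\<rblot>) (map fst (tgtT \<A> t)) (map fst (srcT \<A> s))"
    by (rule B.lay_hor[unfolded hor_opposite_simps]) (simp_all add: D_simps)
  finally show ?case by (simp add: lift_ver)
next
  case (TenT s t)
  then have "wfT \<A> s" "wfT \<A> t" "monochrome Black s" "monochrome Black t" by auto
  note [simp] = this black_arrow_typing[OF this(1,3)] black_arrow_typing[OF this(2,4)]
  have "\<lblot>M_term \<A> (s \<otimes> t)\<rblot> = B.lay \<lblot>Lift (black_arrow s)\<rblot> (map fst (tgtT \<A> s)) (map fst (srcT \<A> s)) \<nabla>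
      B.lay \<lblot>Lift (black_arrow t)\<rblot> (map fst (tgtT \<A> t)) (map fst (srcT \<A> t))"
    using TenT by (subst M_ten) simp_all
  also have "\<dots> = B.lay (\<lblot>Lift (black_arrow s)\<rblot> \<triangleright> \<lblot>Lift (black_arrow t)\<rblot>)
      (map fst (tgtT \<A> s) @ map fst (tgtT \<A> t)) (map fst (srcT \<A> s) @ map fst (srcT \<A> t))"
    by (rule B.lay_ver[unfolded hor_opposite_simps]) (simp_all add: D_simps)
  finally show ?case by (simp add: lift_hor)
qed (simp_all add: cell_class D_simps B.lay_def hor_opposite_simps objs braid_arrow lift_id append.simps(2))

subsection \<open>Crossing cells\<close>

text \<open>By the first hexagon the right-hand side is a left inverse of the braiding of
  \<open>B \<oplus> D\<close> past \<open>A\<close>; by symmetry the left-hand side is a right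
  inverse.\<close>

lemma braid_hexagon': "\<sigma>\<^bsub>\<A>\<^esub> A (B \<oplus> D) = (\<sigma>\<^bsub>\<A>\<^esub> A B \<boxtimes>\<^bsub>\<A>\<^esub> ident \<A> D) \<cdot>\<^bsub>\<A>\<^esub> (ident \<A> B \<boxtimes>\<^bsub>\<A>\<^esub> \<sigma>\<^bsub>\<A>\<^esub> A D)"
proof -
  note [simp] = braid_arrow typing objs comp_ident_arr
  let ?h = "(\<sigma>\<^bsub>\<A>\<^esub> A B \<boxtimes>\<^bsub>\<A>\<^esub> ident \<A> D) \<cdot>\<^bsub>\<A>\<^esub> (ident \<A> B \<boxtimes>\<^bsub>\<A>\<^esub> \<sigma>\<^bsub>\<A>\<^esub> A D)"
  have 1: "(ident \<A> B \<boxtimes>\<^bsub>\<A>\<^esub> \<sigma>\<^bsub>\<A>\<^esub> A D) \<cdot>\<^bsub>\<A>\<^esub> (ident \<A> B \<boxtimes>\<^bsub>\<A>\<^esub> \<sigma>\<^bsub>\<A>\<^esub> D A) = ident \<A> (B \<oplus> A \<oplus> D)"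
    by (subst tensor_comp_arr[symmetric]) (simp_all add: braid_symmetric tensor_ident)
  have 2: "(\<sigma>\<^bsub>\<A>\<^esub> A B \<boxtimes>\<^bsub>\<A>\<^esub> ident \<A> D) \<cdot>\<^bsub>\<A>\<^esub> (\<sigma>\<^bsub>\<A>\<^esub> B A \<boxtimes>\<^bsub>\<A>\<^esub> ident \<A> D) = ident \<A> (A \<oplus> B \<oplus> D)"
    by (subst tensor_comp_arr[symmetric]) (simp_all add: braid_symmetric tensor_ident)
  have h: "?h \<cdot>\<^bsub>\<A>\<^esub> \<sigma>\<^bsub>\<A>\<^esub> (B \<oplus> D) A = ident \<A> (A \<oplus> B \<oplus> D)"
    unfolding braid_hexagon by (simp add: comp_assoc_arr comp_reassoc[OF 1] 2)
  have "?h \<cdot>\<^bsub>\<A>\<^esub> (\<sigma>\<^bsub>\<A>\<^esub> (B \<oplus> D) A \<cdot>\<^bsub>\<A>\<^esub> \<sigma>\<^bsub>\<A>\<^esub> A (B \<oplus> D)) = \<sigma>\<^bsub>\<A>\<^esub> A (B \<oplus> D)"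
    by (subst comp_assoc_arr[symmetric]) (simp_all add: h del: comp_assoc_arr)
  then show ?thesis by (simp add: braid_symmetric comp_assoc_arr)
qed

abbreviation brd ("\<tau>") where "\<tau> A B \<equiv> \<lblot>Lift (\<sigma>\<^bsub>\<A>\<^esub> A B)\<rblot>"
abbreviation "idH \<equiv> id_h (free_cornering \<A>)"

lemma tau_inverse: "\<tau> A B \<nabla> \<tau> B A = idH (A \<oplus> B)"
  by (simp add: lift_ver braid_arrow braid_symmetric lift_id)

lemma tau_unit: "\<tau> A I = idH A" "\<tau> I A = idH A"
  by (simp_all add: braid_unit_left braid_unit_right lift_id)

text \<open>The strand of \<open>U\<close> runs vertically across the horizontal strands of a vertical edge.\<close>

primrec cross1 :: "'o \<Rightarrow> 'o \<Rightarrow> polarity \<Rightarrow> ('o, 'm) cterm set" where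
  "cross1 U A White = (\<lblot>Recv White A\<rblot> \<triangleright> idH U) \<nabla> \<tau> A U \<nabla> (idH U \<triangleright> \<lblot>Send White A\<rblot>)"
| "cross1 U A Black = (idH U \<triangleright> \<lblot>Recv Black A\<rblot>) \<nabla> \<tau> U A \<nabla> (\<lblot>Send Black A\<rblot> \<triangleright> idH U)"

primrec cross :: "'o \<Rightarrow> 'o vedge \<Rightarrow> ('o, 'm) cterm set" where
  "cross U [] = idH U"
| "cross U (x # X) = cross1 U (fst x) (snd x) \<nabla> cross U X"

lemma cross1_typing:
  "cross1 U A p \<in> cells FD" "left_edge FD (cross1 U A p) = [(A, p)]" "right_edge FD (cross1 U A p) = [(A, p)]"
  "top_edge FD (cross1 U A p) = U" "bot_edge FD (cross1 U A p) = U"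
  by (cases p; simp add: D_simps objs braid_arrow)+

lemma cross_typing:
  "cross U X \<in> cells FD" "left_edge FD (cross U X) = X" "right_edge FD (cross U X) = X"
  "top_edge FD (cross U X) = U" "bot_edge FD (cross U X) = U"
proof -
  have "cross U X \<in> cells FD \<and> left_edge FD (cross U X) = X \<and> right_edge FD (cross U X) = X \<and>
    top_edge FD (cross U X) = U \<and> bot_edge FD (cross U X) = U"
    by (induction X) (auto simp: D_simps cross1_typing append.simps(2))
  then show "cross U X \<in> cells FD" "left_edge FD (cross U X) = X" "right_edge FD (cross U X) = X"
  "top_edge FD (cross U X) = U" "bot_edge FD (cross U X) = U" by auto
qed

lemma cross_single: "cross U [(A, p)] = cross1 U A p"
  using cross1_typing[of U A p] by (simp add: D_simps)

lemma cross_append: "cross U (X @ Y) = cross U X \<nabla> cross U Y"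
  by (induction X) (simp_all add: D_simps cross_typing cross1_typing append.simps(2))

lemmas yanks = W.yank_h W.yank_v B.yank_h[unfolded hor_opposite_simps] B.yank_v[unfolded hor_opposite_simps]

text \<open>The braiding of \<open>\<A>\<close> extended to a crossing of a strand \<open>U\<close>
  with any cell. Lifted arrows use naturality of the braiding, corners use yanking together with
  symmetry, and horizontal composites use the second hexagon.\<close>

lemma cross_natural:
  assumes "wfC \<A> a"
  shows "(cross U (leftC a) \<triangleright> \<lblot>a\<rblot>) \<nabla> \<tau> U (botC \<A> a) = \<tau> U (topC \<A> a) \<nabla> (\<lblot>a\<rblot> \<triangleright> cross U (rightC a))"
  using assms
proof (induction a)
  case (IdH A)
  then show ?case by (simp add: cell_class D_simps objs braid_arrow)
next
  case (IdV X)
  then show ?case by (simp add: cell_class D_simps objs braid_arrow tau_unit cross_typing)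
next
  case (Lift f)
  then have f: "f \<in> arrows \<A>" by simp
  then show ?case
    using braid_natural[OF ident_hom arrows_hom, of f U]
    by (simp add: D_simps objs braid_arrow lift_id[symmetric] lift_hor lift_ver typing)
next
  case (Send p A)
  note [simp] = D_simps objs braid_arrow tau_unit cross_typing cross1_typing
  show ?case
  proof (cases p)
    case White
    let ?s = "\<lblot>Send White A\<rblot>" let ?r = "\<lblot>Recv White A\<rblot>"
    \<comment> \<open>Padding with unit cells gives both factors three rows, so that interchange
      applies row by row; the first row is then yanked.\<close>
    have "?s \<triangleright> cross1 U A White = (?s \<nabla> idH I \<nabla> idH I) \<triangleright> ((?r \<triangleright> idH U) \<nabla> \<tau> A U \<nabla> (idH U \<triangleright> ?s))"
      by simp
    also have "\<dots> = (?s \<triangleright> (?r \<triangleright> idH U)) \<nabla> (idH I \<triangleright> \<tau> A U) \<nabla> (idH I \<triangleright> (idH U \<triangleright> ?s))"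
      by (subst W.interchange_cells, simp_all del: W.unit_laws)+
    also have "?s \<triangleright> (?r \<triangleright> idH U) = idH (A \<oplus> U)"
      by (subst W.hor_assoc_cells[symmetric]) (simp_all add: yanks)
    finally have "\<tau> U A \<nabla> (?s \<triangleright> cross1 U A White) = (\<tau> U A \<nabla> \<tau> A U) \<nabla> (idH U \<triangleright> ?s)" by simp
    then show ?thesis using White by (simp add: tau_inverse cross_single del: W.ver_assoc_cells)
  next
    case Black
    let ?s = "\<lblot>Send Black A\<rblot>" let ?r = "\<lblot>Recv Black A\<rblot>"
    have "cross1 U A Black \<triangleright> ?s = ((idH U \<triangleright> ?r) \<nabla> \<tau> U A \<nabla> (?s \<triangleright> idH U)) \<triangleright> (?s \<nabla> idH I \<nabla> idH I)"
      by simp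
    also have "\<dots> = ((idH U \<triangleright> ?r) \<triangleright> ?s) \<nabla> (\<tau> U A \<triangleright> idH I) \<nabla> ((?s \<triangleright> idH U) \<triangleright> idH I)"
      by (subst W.interchange_cells, simp_all del: W.unit_laws)+
    also have "(idH U \<triangleright> ?r) \<triangleright> ?s = idH (U \<oplus> A)"
      by (subst W.hor_assoc_cells) (simp_all add: yanks)
    finally show ?thesis using Black by (simp add: cross_single)
  qed
next
  case (Recv p A)
  note [simp] = D_simps objs braid_arrow tau_unit cross_typing cross1_typing
  show ?case
  proof (cases p)
    case White
    let ?s = "\<lblot>Send White A\<rblot>" let ?r = "\<lblot>Recv White A\<rblot>"
    have "cross1 U A White \<triangleright> ?r = ((?r \<triangleright> idH U) \<nabla> \<tau> A U \<nabla> (idH U \<triangleright> ?s)) \<triangleright> (idH I \<nabla> idH I \<nabla> ?r)"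
      by simp
    also have "\<dots> = ((?r \<triangleright> idH U) \<triangleright> idH I) \<nabla> (\<tau> A U \<triangleright> idH I) \<nabla> ((idH U \<triangleright> ?s) \<triangleright> ?r)"
      by (subst W.interchange_cells, simp_all del: W.unit_laws)+
    also have "(idH U \<triangleright> ?s) \<triangleright> ?r = idH (U \<oplus> A)"
      by (subst W.hor_assoc_cells) (simp_all add: yanks)
    finally have "(cross1 U A White \<triangleright> ?r) \<nabla> \<tau> U A = (?r \<triangleright> idH U) \<nabla> (\<tau> A U \<nabla> \<tau> U A)" by simp
    then show ?thesis using White by (simp add: tau_inverse cross_single)
  next
    case Black
    let ?s = "\<lblot>Send Black A\<rblot>" let ?r = "\<lblot>Recv Black A\<rblot>"
    have "?r \<triangleright> cross1 U A Black = (idH I \<nabla> idH I \<nabla> ?r) \<triangleright> ((idH U \<triangleright> ?r) \<nabla> \<tau> U A \<nabla> (?s \<triangleright> idH U))"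
      by simp
    also have "\<dots> = (idH I \<triangleright> (idH U \<triangleright> ?r)) \<nabla> (idH I \<triangleright> \<tau> U A) \<nabla> (?r \<triangleright> (?s \<triangleright> idH U))"
      by (subst W.interchange_cells, simp_all del: W.unit_laws)+
    also have "?r \<triangleright> (?s \<triangleright> idH U) = idH (A \<oplus> U)"
      by (subst W.hor_assoc_cells[symmetric]) (simp_all add: yanks)
    finally show ?thesis using Black by (simp add: cross_single)
  qed
next
  case (HorC a b)
  let ?X = "leftC a" let ?Y = "leftC b" let ?Z = "rightC b"
  let ?A = "topC \<A> a" let ?B = "botC \<A> a" let ?A' = "topC \<A> b" let ?B' = "botC \<A> b"
  let ?a = "\<lblot>a\<rblot>" let ?b = "\<lblot>b\<rblot>"
  have wf: "wfC \<A> a" "wfC \<A> b" "rightC a = ?Y" using HorC by auto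
  note [simp] = D_simps objs braid_arrow cross_typing wf
  have hex: "\<tau> U (C \<oplus> C') = (\<tau> U C \<triangleright> idH C') \<nabla> (idH C \<triangleright> \<tau> U C')" for C C'
    unfolding braid_hexagon'[of U C C'] by (simp add: lift_id[symmetric] lift_hor lift_ver typing)
  have IH: "(cross U ?X \<triangleright> ?a) \<nabla> \<tau> U ?B = \<tau> U ?A \<nabla> (?a \<triangleright> cross U ?Y)"
    "(cross U ?Y \<triangleright> ?b) \<nabla> \<tau> U ?B' = \<tau> U ?A' \<nabla> (?b \<triangleright> cross U ?Z)"
    using HorC.IH wf by simp_all
  have "((cross U ?X \<triangleright> ?a) \<triangleright> ?b) \<nabla> (\<tau> U ?B \<triangleright> idH ?B') = ((cross U ?X \<triangleright> ?a) \<nabla> \<tau> U ?B) \<triangleright> (?b \<nabla> idH ?B')"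
    by (rule W.interchange_cells[symmetric]) simp_all
  also have "\<dots> = (\<tau> U ?A \<nabla> (?a \<triangleright> cross U ?Y)) \<triangleright> (idH ?A' \<nabla> ?b)"
    by (simp add: IH del: W.ver_assoc_cells)
  also have "\<dots> = (\<tau> U ?A \<triangleright> idH ?A') \<nabla> ((?a \<triangleright> cross U ?Y) \<triangleright> ?b)"
    by (rule W.interchange_cells) simp_all
  finally have 1: "((cross U ?X \<triangleright> ?a) \<triangleright> ?b) \<nabla> (\<tau> U ?B \<triangleright> idH ?B') = (\<tau> U ?A \<triangleright> idH ?A') \<nabla> (?a \<triangleright> (cross U ?Y \<triangleright> ?b))"
    by (simp add: W.hor_assoc_cells)
  have "(?a \<triangleright> (cross U ?Y \<triangleright> ?b)) \<nabla> (idH ?B \<triangleright> \<tau> U ?B') = (?a \<nabla> idH ?B) \<triangleright> ((cross U ?Y \<triangleright> ?b) \<nabla> \<tau> U ?B')"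
    by (rule W.interchange_cells[symmetric]) simp_all
  also have "\<dots> = (idH ?A \<nabla> ?a) \<triangleright> (\<tau> U ?A' \<nabla> (?b \<triangleright> cross U ?Z))"
    by (simp add: IH del: W.ver_assoc_cells)
  also have "\<dots> = (idH ?A \<triangleright> \<tau> U ?A') \<nabla> (?a \<triangleright> (?b \<triangleright> cross U ?Z))"
    by (rule W.interchange_cells) simp_all
  finally have 2: "(?a \<triangleright> (cross U ?Y \<triangleright> ?b)) \<nabla> (idH ?B \<triangleright> \<tau> U ?B') = (idH ?A \<triangleright> \<tau> U ?A') \<nabla> (?a \<triangleright> (?b \<triangleright> cross U ?Z))" .
  have "(cross U ?X \<triangleright> (?a \<triangleright> ?b)) \<nabla> \<tau> U (?B \<oplus> ?B') =
      (((cross U ?X \<triangleright> ?a) \<triangleright> ?b) \<nabla> (\<tau> U ?B \<triangleright> idH ?B')) \<nabla> (idH ?B \<triangleright> \<tau> U ?B')"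
    unfolding hex by (simp add: W.hor_assoc_cells)
  also have "\<dots> = (\<tau> U ?A \<triangleright> idH ?A') \<nabla> ((?a \<triangleright> (cross U ?Y \<triangleright> ?b)) \<nabla> (idH ?B \<triangleright> \<tau> U ?B'))"
    unfolding 1 by simp
  also have "\<dots> = \<tau> U (?A \<oplus> ?A') \<nabla> ((?a \<triangleright> ?b) \<triangleright> cross U ?Z)"
    unfolding 2 hex by (simp add: W.hor_assoc_cells)
  finally show ?case by (simp add: cell_class)
next
  case (VerC a b)
  let ?a = "\<lblot>a\<rblot>" let ?b = "\<lblot>b\<rblot>"
  have wf: "wfC \<A> a" "wfC \<A> b" "botC \<A> a = topC \<A> b" using VerC by auto
  note [simp] = D_simps objs braid_arrow cross_typing wf
  let ?U = "\<lambda>X. cross U X"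
  have IH: "(?U (leftC a) \<triangleright> ?a) \<nabla> \<tau> U (topC \<A> b) = \<tau> U (topC \<A> a) \<nabla> (?a \<triangleright> ?U (rightC a))"
    "(?U (leftC b) \<triangleright> ?b) \<nabla> \<tau> U (botC \<A> b) = \<tau> U (topC \<A> b) \<nabla> (?b \<triangleright> ?U (rightC b))"
    using VerC.IH wf by simp_all
  have "(?U (leftC a) \<nabla> ?U (leftC b)) \<triangleright> (?a \<nabla> ?b) = (?U (leftC a) \<triangleright> ?a) \<nabla> (?U (leftC b) \<triangleright> ?b)"
    "(?a \<nabla> ?b) \<triangleright> (?U (rightC a) \<nabla> ?U (rightC b)) = (?a \<triangleright> ?U (rightC a)) \<nabla> (?b \<triangleright> ?U (rightC b))"
    by (rule W.interchange_cells, simp_all)+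
  note 1 = this
  have "((?U (leftC a) \<triangleright> ?a) \<nabla> (?U (leftC b) \<triangleright> ?b)) \<nabla> \<tau> U (botC \<A> b) =
      ((?U (leftC a) \<triangleright> ?a) \<nabla> \<tau> U (topC \<A> b)) \<nabla> (?b \<triangleright> ?U (rightC b))"
    using IH(2) by simp
  also have "\<dots> = \<tau> U (topC \<A> a) \<nabla> ((?a \<triangleright> ?U (rightC a)) \<nabla> (?b \<triangleright> ?U (rightC b)))"
    unfolding IH(1) by simp
  finally show ?case by (simp add: cell_class cross_append 1)
qed

text \<open>With unit edges, \<open>cross_natural\<close> says that \<open>h\<close> may pass from
  one side of a strand \<open>A\<close> to the other. The identity on a letter is a receive corner
  above a send corner, and \<open>h\<close> goes around it: past the first corner to a place beside
  the strand, across if necessary, and out past the second.\<close>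

lemma spatial_cells:
  assumes "wfC \<A> h" "leftC h = []" "rightC h = []" "topC \<A> h = I" "botC \<A> h = I"
  shows "\<lblot>h\<rblot> \<nabla> id_v FD X = id_v FD X \<nabla> \<lblot>h\<rblot>"
proof (induction X)
  case Nil
  then show ?case using assms by (simp add: D_simps)
next
  case (Cons x X)
  obtain A p where x: "x = (A, p)" by (cases x)
  let ?h = "\<lblot>h\<rblot>" let ?r = "\<lblot>Recv p A\<rblot>" let ?s = "\<lblot>Send p A\<rblot>"
  note [simp] = D_simps assms objs tau_unit
  have c: "idH A \<triangleright> ?h = ?h \<triangleright> idH A"
    using cross_natural[OF assms(1), of A] by simp
  have "?h \<nabla> ?r = ?r \<nabla> (?h \<triangleright> idH A)"
  proof (cases p)
    case White
    have "(idH I \<nabla> ?r) \<triangleright> (?h \<nabla> idH I) = (idH I \<triangleright> ?h) \<nabla> (?r \<triangleright> idH I)"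
      "(?r \<nabla> idH A) \<triangleright> (idH I \<nabla> ?h) = (?r \<triangleright> idH I) \<nabla> (idH A \<triangleright> ?h)"
      using White by (intro W.interchange_cells; simp)+
    then show ?thesis using White by (simp add: c)
  next
    case Black
    have "(?h \<nabla> idH I) \<triangleright> (idH I \<nabla> ?r) = (?h \<triangleright> idH I) \<nabla> (idH I \<triangleright> ?r)"
      "(idH I \<nabla> ?h) \<triangleright> (?r \<nabla> idH A) = (idH I \<triangleright> ?r) \<nabla> (?h \<triangleright> idH A)"
      using Black by (intro W.interchange_cells; simp)+
    then show ?thesis using Black by simp
  qed
  moreover have "(?h \<triangleright> idH A) \<nabla> ?s = ?s \<nabla> ?h"
  proof (cases p)
    case White
    have "(?h \<nabla> idH I) \<triangleright> (idH A \<nabla> ?s) = (?h \<triangleright> idH A) \<nabla> (idH I \<triangleright> ?s)"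
      "(idH I \<nabla> ?h) \<triangleright> (?s \<nabla> idH I) = (idH I \<triangleright> ?s) \<nabla> (?h \<triangleright> idH I)"
      using White by (intro W.interchange_cells; simp)+
    then show ?thesis using White by simp
  next
    case Black
    have "(idH A \<nabla> ?s) \<triangleright> (?h \<nabla> idH I) = (idH A \<triangleright> ?h) \<nabla> (?s \<triangleright> idH I)"
      "(?s \<nabla> idH I) \<triangleright> (idH I \<nabla> ?h) = (?s \<triangleright> idH I) \<nabla> (idH I \<triangleright> ?h)"
      using Black by (intro W.interchange_cells; simp)+
    then show ?thesis using Black by (simp add: c)
  qed
  moreover have "?h \<nabla> (?r \<nabla> ?s) = (?h \<nabla> ?r) \<nabla> ?s" "(?r \<nabla> ?s) \<nabla> ?h = ?r \<nabla> (?s \<nabla> ?h)"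
    "?r \<nabla> ((?h \<triangleright> idH A) \<nabla> ?s) = (?r \<nabla> (?h \<triangleright> idH A)) \<nabla> ?s"
    by (cases p; simp)+
  moreover have "?r \<nabla> ?s = id_v FD [(A, p)]" by (cases p) (simp_all add: yanks)
  ultimately have 1: "?h \<nabla> id_v FD [(A, p)] = id_v FD [(A, p)] \<nabla> ?h" by metis
  have 2: "id_v FD (x # X) = id_v FD [(A, p)] \<nabla> id_v FD X" by (simp add: x append.simps(2))
  have "?h \<nabla> id_v FD (x # X) = (?h \<nabla> id_v FD [(A, p)]) \<nabla> id_v FD X"
    unfolding 2 by simp
  also have "\<dots> = id_v FD [(A, p)] \<nabla> (?h \<nabla> id_v FD X)" unfolding 1 by simp
  also have "\<dots> = id_v FD (x # X) \<nabla> ?h"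
    unfolding 2 Cons by (rule W.ver_assoc_cells[symmetric]) simp_all
  finally show ?case .
qed

subsection \<open>M is well defined\<close>

lemma white_axiom:
  assumes "T_axiom \<A> s t" "monochrome White s" "monochrome White t" "white_arrow s = white_arrow t"
  shows "\<lblot>M_term \<A> s\<rblot> = \<lblot>M_term \<A> t\<rblot>"
  using eqT_boundary[OF eqT.ax[OF assms(1)]] assms by (simp add: white_lay)

lemma black_axiom:
  assumes "T_axiom \<A> s t" "monochrome Black s" "monochrome Black t" "black_arrow s = black_arrow t"
  shows "\<lblot>M_term \<A> s\<rblot> = \<lblot>M_term \<A> t\<rblot>"
  using eqT_boundary[OF eqT.ax[OF assms(1)]] assms by (simp add: black_lay)

lemma monochrome_axiom:
  assumes "T_axiom \<A> s t" "monochrome p s" "monochrome p t"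
    "p = White \<Longrightarrow> white_arrow s = white_arrow t" "p = Black \<Longrightarrow> black_arrow s = black_arrow t"
  shows "\<lblot>M_term \<A> s\<rblot> = \<lblot>M_term \<A> t\<rblot>"
  using assms white_axiom black_axiom by (cases p) auto

section \<open>Coherence equations in the base category\<close>

abbreviation seqA (infixr "\<cdot>" 60) where "f \<cdot> g \<equiv> f \<cdot>\<^bsub>\<A>\<^esub> g"

lemma hexagons:
  "\<sigma>\<^bsub>\<A>\<^esub> (A \<oplus> B) D = whisker A (\<sigma>\<^bsub>\<A>\<^esub> B D) I \<cdot> whisker I (\<sigma>\<^bsub>\<A>\<^esub> A D) B"
  "\<sigma>\<^bsub>\<A>\<^esub> A (B \<oplus> D) = whisker I (\<sigma>\<^bsub>\<A>\<^esub> A B) D \<cdot> whisker B (\<sigma>\<^bsub>\<A>\<^esub> A D) I"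
  unfolding braid_hexagon[of A B D] braid_hexagon'[of A B D]
  by (simp_all add: tensor_ident_whisker braid_arrow)

lemmas A_simps = tensor_whisker whisker_comp whisker_whisker whisker_ident whisker_unit
  comp_assoc_arr comp_ident_arr typing braid_arrow objs braid_unit_left braid_unit_right

text \<open>Naturality of the braiding past \<open>C\<close> with respect to
  \<open>\<sigma> A B\<close>, with both composite braidings expanded by hexagons.\<close>

lemma yang_baxter:
  "whisker I (\<sigma>\<^bsub>\<A>\<^esub> A B) C \<cdot> whisker B (\<sigma>\<^bsub>\<A>\<^esub> A C) I \<cdot> whisker I (\<sigma>\<^bsub>\<A>\<^esub> B C) A =
    whisker A (\<sigma>\<^bsub>\<A>\<^esub> B C) I \<cdot> whisker I (\<sigma>\<^bsub>\<A>\<^esub> A C) B \<cdot> whisker C (\<sigma>\<^bsub>\<A>\<^esub> A B) I"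
  using braid_natural[OF braid_hom[of A B] ident_hom[of C]]
  by (simp add: A_simps hexagons)

lemmas colour_simps = D_simps A_simps append.simps(2) braid_symmetric

text \<open>What remains of each axiom is an equation of arrows in \<open>\<A>\<close>: naturality,
  symmetry, a hexagon or the Yang-Baxter equation.\<close>

lemma monochrome_T_axiom:
  assumes "T_axiom \<A> s t" "monochrome p s" "monochrome p t"
  shows "\<lblot>M_term \<A> s\<rblot> = \<lblot>M_term \<A> t\<rblot>"
proof (rule monochrome_axiom[OF assms])
  assume p: "p = White"
  show "white_arrow s = white_arrow t" using assms(1)
  proof cases
    case (swap_white_left f A B C)
    then show ?thesis using braid_natural[OF ident_hom swap_white_left(3), of C] homD[OF swap_white_left(3)]
      by (simp add: colour_simps)
  next
    case (swap_white_right f A B C)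
    then show ?thesis using braid_natural[OF swap_white_right(3) ident_hom, of C] homD[OF swap_white_right(3)]
      by (simp add: colour_simps)
  next
    case (map_white_tensor f A B g A' B')
    note [simp] = homD[OF map_white_tensor(3)] homD[OF map_white_tensor(4)] typing braid_arrow
    \<comment> \<open>White words reverse the tensor, so \<open>f\<close> and \<open>g\<close>
      appear exchanged between two braidings; naturality turns them round and symmetry removes the
      braidings.\<close>
    have "(g \<boxtimes>\<^bsub>\<A>\<^esub> f) \<cdot> \<sigma>\<^bsub>\<A>\<^esub> B' B = \<sigma>\<^bsub>\<A>\<^esub> A' A \<cdot> (f \<boxtimes>\<^bsub>\<A>\<^esub> g)"
      using map_white_tensor(3,4) by (rule braid_natural[rotated])
    moreover have "\<sigma>\<^bsub>\<A>\<^esub> A A' \<cdot> (\<sigma>\<^bsub>\<A>\<^esub> A' A \<cdot> (f \<boxtimes>\<^bsub>\<A>\<^esub> g)) = f \<boxtimes>\<^bsub>\<A>\<^esub> g"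
      by (subst comp_assoc_arr[symmetric]) (simp_all add: braid_symmetric comp_ident_arr)
    ultimately show ?thesis using map_white_tensor by simp
  next
    case (map_white_braid A B)
    have "\<sigma>\<^bsub>\<A>\<^esub> B A \<cdot> (\<sigma>\<^bsub>\<A>\<^esub> A B \<cdot> \<sigma>\<^bsub>\<A>\<^esub> B A) = \<sigma>\<^bsub>\<A>\<^esub> B A"
      by (simp add: braid_symmetric comp_ident_arr braid_arrow)
    then show ?thesis using map_white_braid by simp
  qed (use p assms(2,3) in \<open>auto simp: colour_simps hexagons yang_baxter\<close>)
next
  assume p: "p = Black"
  show "black_arrow s = black_arrow t" using assms(1)
  proof cases
    case (swap_black_left f A B C)
    then show ?thesis using braid_natural[OF ident_hom swap_black_left(3), of C] homD[OF swap_black_left(3)]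
      by (simp add: colour_simps)
  next
    case (swap_black_right f A B C)
    then show ?thesis using braid_natural[OF swap_black_right(3) ident_hom, of C] homD[OF swap_black_right(3)]
      by (simp add: colour_simps)
  next
    case (map_black_tensor f A B g A' B')
    then show ?thesis using homD[OF map_black_tensor(3)] homD[OF map_black_tensor(4)]
      by (simp add: comp_ident_arr typing)
  qed (use p assms(2,3) in \<open>auto simp: colour_simps hexagons yang_baxter\<close>)
qed

section \<open>Cups and caps: morphisms joining the two colours\<close>

definition cup :: "'m \<Rightarrow> 'o list \<Rightarrow> 'o list \<Rightarrow> ('o, 'm) cterm set"
  where "cup f X Y = B.recv X \<nabla> (\<lblot>Lift f\<rblot> \<nabla> W.send Y)"

text \<open>Like \<open>cup\<close>, a mixed counterpart of \<open>W.lay\<close>. A cup has all its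
  strands on the right and a cap on the left; in both, the entire content is the connecting arrow
  \<open>f\<close>.\<close>

definition cap :: "'m \<Rightarrow> 'o list \<Rightarrow> 'o list \<Rightarrow> ('o, 'm) cterm set"
  where "cap f X Y = W.recv X \<nabla> (\<lblot>Lift f\<rblot> \<nabla> B.send Y)"

lemmas B_yank_across = B.yank_across[unfolded hor_opposite_simps]

lemma lift_ver_rest:
  assumes "f \<in> arrows \<A>" "g \<in> arrows \<A>" "target \<A> f = source \<A> g" "c \<in> cells FD" "top_edge FD c = target \<A> g"
  shows "\<lblot>Lift f\<rblot> \<nabla> (\<lblot>Lift g\<rblot> \<nabla> c) = \<lblot>Lift (f \<cdot> g)\<rblot> \<nabla> c"
  using assms by (simp add: lift_ver[symmetric] D_simps)

text \<open>By \<open>W.yank_across\<close>, with the black strands \<open>U\<close> as the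
  bypassing edge, the white columns cancel and \<open>t\<close> acts after \<open>f\<close>.\<close>

lemma cup_white:
  assumes M: "\<lblot>M_term \<A> s\<rblot> = cup f X Y"
    and wf: "wfT \<A> (s ;; (Idn U \<otimes> t))" and t: "monochrome White t" "map fst (srcT \<A> t) = Y" "map fst (tgtT \<A> t) = Z"
    and U: "B.edge X = U" and f: "f \<in> arrows \<A>" "source \<A> f = B.obj X" "target \<A> f = W.obj Y"
  shows "\<lblot>M_term \<A> (s ;; (Idn U \<otimes> t))\<rblot> = cup (f \<cdot> white_arrow t) X Z"
proof -
  let ?g = "\<lblot>Lift (white_arrow t)\<rblot>" let ?f = "\<lblot>Lift f\<rblot>"
  have wft: "wfT \<A> t" using wf by simp
  note [simp] = D_simps f t(2,3) U white_arrow_typing[OF wft t(1)] wft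
  have "\<lblot>M_term \<A> (s ;; (Idn U \<otimes> t))\<rblot> = \<lblot>M_term \<A> s\<rblot> \<triangleright> (id_v FD U \<nabla> \<lblot>M_term \<A> t\<rblot>)"
    using wf by (subst M_seq, simp, subst M_ten, simp, subst M_Idn) (rule HOL.refl)
  also have "\<dots> = (((B.recv X \<nabla> ?f) \<nabla> W.send Y) \<nabla> id_v FD []) \<triangleright> (id_v FD U \<nabla> (W.recv Y \<nabla> (?g \<nabla> W.send Z)))"
    using white_lay[OF wft t(1)] by (simp add: M cup_def W.lay_def)
  also have "\<dots> = (B.recv X \<nabla> ?f) \<nabla> (?g \<nabla> W.send Z)"
    by (rule W.yank_across) simp_all
  finally show ?thesis by (simp add: cup_def lift_ver_rest)
qed

text \<open>Black terms are contravariant in their arrows, so \<open>t\<close> acts before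
  \<open>f\<close>; the bypassing edge is the white part of the cup.\<close>

lemma cup_black:
  assumes M: "\<lblot>M_term \<A> s\<rblot> = cup f X Y"
    and wf: "wfT \<A> (s ;; (t \<otimes> Idn U))" and t: "monochrome Black t" "map fst (srcT \<A> t) = X" "map fst (tgtT \<A> t) = Z"
    and U: "W.edge Y = U" and f: "f \<in> arrows \<A>" "source \<A> f = B.obj X" "target \<A> f = W.obj Y"
  shows "\<lblot>M_term \<A> (s ;; (t \<otimes> Idn U))\<rblot> = cup (black_arrow t \<cdot> f) Z Y"
proof -
  let ?g = "\<lblot>Lift (black_arrow t)\<rblot>" let ?f = "\<lblot>Lift f\<rblot>"
  have wft: "wfT \<A> t" using wf by simp
  note [simp] = D_simps f t(2,3) U black_arrow_typing[OF wft t(1)] wft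
  have "\<lblot>M_term \<A> (s ;; (t \<otimes> Idn U))\<rblot> = \<lblot>M_term \<A> s\<rblot> \<triangleright> (\<lblot>M_term \<A> t\<rblot> \<nabla> id_v FD U)"
    using wf by (subst M_seq, simp, subst M_ten, simp, subst M_Idn) (rule HOL.refl)
  also have "\<dots> = (id_v FD [] \<nabla> (B.recv X \<nabla> (?f \<nabla> W.send Y))) \<triangleright> (((B.recv Z \<nabla> ?g) \<nabla> B.send X) \<nabla> id_v FD U)"
    using black_lay[OF wft t(1)] by (simp add: M cup_def B.lay_def)
  also have "\<dots> = (B.recv Z \<nabla> ?g) \<nabla> (?f \<nabla> W.send Y)"
    by (rule B_yank_across) simp_all
  finally show ?thesis by (simp add: cup_def lift_ver_rest)
qed

lemma cap_white:
  assumes M: "\<lblot>M_term \<A> s\<rblot> = cap f X Y"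
    and wf: "wfT \<A> ((t \<otimes> Idn U) ;; s)" and t: "monochrome White t" "map fst (srcT \<A> t) = Z" "map fst (tgtT \<A> t) = X"
    and U: "B.edge Y = U" and f: "f \<in> arrows \<A>" "source \<A> f = W.obj X" "target \<A> f = B.obj Y"
  shows "\<lblot>M_term \<A> ((t \<otimes> Idn U) ;; s)\<rblot> = cap (white_arrow t \<cdot> f) Z Y"
proof -
  let ?g = "\<lblot>Lift (white_arrow t)\<rblot>" let ?f = "\<lblot>Lift f\<rblot>"
  have wft: "wfT \<A> t" using wf by simp
  note [simp] = D_simps f t(2,3) U white_arrow_typing[OF wft t(1)] wft
  have "\<lblot>M_term \<A> ((t \<otimes> Idn U) ;; s)\<rblot> = (\<lblot>M_term \<A> t\<rblot> \<nabla> id_v FD U) \<triangleright> \<lblot>M_term \<A> s\<rblot>"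
    using wf by (subst M_seq, simp, subst M_ten, simp, subst M_Idn) (rule HOL.refl)
  also have "\<dots> = (((W.recv Z \<nabla> ?g) \<nabla> W.send X) \<nabla> id_v FD U) \<triangleright> (id_v FD [] \<nabla> (W.recv X \<nabla> (?f \<nabla> B.send Y)))"
    using white_lay[OF wft t(1)] by (simp add: M cap_def W.lay_def)
  also have "\<dots> = (W.recv Z \<nabla> ?g) \<nabla> (?f \<nabla> B.send Y)"
    by (rule W.yank_across) simp_all
  finally show ?thesis by (simp add: cap_def lift_ver_rest)
qed

lemma cap_black:
  assumes M: "\<lblot>M_term \<A> s\<rblot> = cap f X Y"
    and wf: "wfT \<A> ((Idn U \<otimes> t) ;; s)" and t: "monochrome Black t" "map fst (srcT \<A> t) = Z" "map fst (tgtT \<A> t) = Y"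
    and U: "W.edge X = U" and f: "f \<in> arrows \<A>" "source \<A> f = W.obj X" "target \<A> f = B.obj Y"
  shows "\<lblot>M_term \<A> ((Idn U \<otimes> t) ;; s)\<rblot> = cap (f \<cdot> black_arrow t) X Z"
proof -
  let ?g = "\<lblot>Lift (black_arrow t)\<rblot>" let ?f = "\<lblot>Lift f\<rblot>"
  have wft: "wfT \<A> t" using wf by simp
  note [simp] = D_simps f t(2,3) U black_arrow_typing[OF wft t(1)] wft
  have "\<lblot>M_term \<A> ((Idn U \<otimes> t) ;; s)\<rblot> = (id_v FD U \<nabla> \<lblot>M_term \<A> t\<rblot>) \<triangleright> \<lblot>M_term \<A> s\<rblot>"
    using wf by (subst M_seq, simp, subst M_ten, simp, subst M_Idn) (rule HOL.refl)
  also have "\<dots> = (id_v FD U \<nabla> (B.recv Y \<nabla> (?g \<nabla> B.send Z))) \<triangleright> (((W.recv X \<nabla> ?f) \<nabla> B.send Y) \<nabla> id_v FD [])"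
    using black_lay[OF wft t(1)] by (simp add: M cap_def B.lay_def)
  also have "\<dots> = (W.recv X \<nabla> ?f) \<nabla> (?g \<nabla> B.send Z)"
    by (rule B_yank_across) simp_all
  finally show ?thesis by (simp add: cap_def lift_ver_rest)
qed

lemma M_Eta: "\<lblot>M_term \<A> (Eta A)\<rblot> = cup (ident \<A> A) [A] [A]"
  by (simp add: cup_def cell_class D_simps lift_id)

lemma M_Eps: "\<lblot>M_term \<A> (Eps A)\<rblot> = cap (ident \<A> A) [A] [A]"
  by (simp add: cap_def cell_class D_simps lift_id)

text \<open>The connecting arrow is an identity because the nesting fits the two reading orders: the
  black word \<open>[B, A]\<close> and the white word \<open>[A, B]\<close> both denote
  \<open>B \<oplus> A\<close>.\<close>

lemma M_EtaN: "\<lblot>M_term \<A> (EtaN A B)\<rblot> = cup (ident \<A> (B \<oplus> A)) [B, A] [A, B]"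
proof -
  note [simp] = D_simps objs
  let ?rA = "\<lblot>Recv Black A\<rblot>" let ?rB = "\<lblot>Recv Black B\<rblot>" let ?sA = "\<lblot>Send White A\<rblot>" let ?sB = "\<lblot>Send White B\<rblot>"
  have "\<lblot>M_term \<A> (EtaN A B)\<rblot> = (?rB \<nabla> ?sB) \<triangleright> (id_v FD (B\<bullet>) \<nabla> ((?rA \<nabla> ?sA) \<nabla> id_v FD (B\<degree>)))"
    by (simp add: EtaN_def cell_class)
  also have "\<dots> = (?rB \<nabla> (idH B \<nabla> (idH B \<nabla> ?sB))) \<triangleright> (id_v FD (B\<bullet>) \<nabla> (?rA \<nabla> (?sA \<nabla> id_v FD (B\<degree>))))"
    by simp
  also have "\<dots> = (?rB \<triangleright> id_v FD (B\<bullet>)) \<nabla> ((idH B \<triangleright> ?rA) \<nabla> ((idH B \<triangleright> ?sA) \<nabla> (?sB \<triangleright> id_v FD (B\<degree>))))"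
    by (subst W.interchange_cells, simp_all del: W.unit_laws)+
  finally show ?thesis by (simp add: cup_def lift_id)
qed

lemma M_EpsN: "\<lblot>M_term \<A> (EpsN A B)\<rblot> = cap (ident \<A> (B \<oplus> A)) [A, B] [B, A]"
proof -
  note [simp] = D_simps objs
  let ?rA = "\<lblot>Recv White A\<rblot>" let ?rB = "\<lblot>Recv White B\<rblot>" let ?sA = "\<lblot>Send Black A\<rblot>" let ?sB = "\<lblot>Send Black B\<rblot>"
  have "\<lblot>M_term \<A> (EpsN A B)\<rblot> = (id_v FD (A\<degree>) \<nabla> ((?rB \<nabla> ?sB) \<nabla> id_v FD (A\<bullet>))) \<triangleright> (?rA \<nabla> ?sA)"
    by (simp add: EpsN_def cell_class)
  also have "\<dots> = (id_v FD (A\<degree>) \<nabla> (?rB \<nabla> (?sB \<nabla> id_v FD (A\<bullet>)))) \<triangleright> (?rA \<nabla> (idH A \<nabla> (idH A \<nabla> ?sA)))"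
    by simp
  also have "\<dots> = (id_v FD (A\<degree>) \<triangleright> ?rA) \<nabla> ((?rB \<triangleright> idH A) \<nabla> ((?sB \<triangleright> idH A) \<nabla> (id_v FD (A\<bullet>) \<triangleright> ?sA)))"
    by (subst W.interchange_cells, simp_all del: W.unit_laws)+
  finally show ?thesis by (simp add: cap_def lift_id)
qed

lemma M_seq_assoc:
  "wfT \<A> ((s ;; t) ;; u) \<Longrightarrow> \<lblot>M_term \<A> (s ;; (t ;; u))\<rblot> = \<lblot>M_term \<A> ((s ;; t) ;; u)\<rblot>"
  using M_term_boundary[of s] M_term_boundary[of t] M_term_boundary[of u]
  by (simp add: cell_class W.hor_assoc_cells D_simps)

lemmas cup_cap_simps = D_simps A_simps append.simps(2) braid_symmetric EtaN_def EpsN_def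

text \<open>Apart from the snakes, both sides of a mixed axiom are cups or caps on the same words,
  and their connecting arrows in \<open>\<A>\<close> agree.\<close>

lemma M_axiom:
  assumes "T_axiom \<A> s t"
  shows "\<lblot>M_term \<A> s\<rblot> = \<lblot>M_term \<A> t\<rblot>"
proof (cases "\<exists>p. monochrome p s \<and> monochrome p t")
  case True
  then show ?thesis using monochrome_T_axiom[OF assms] by blast
next
  case False
  show ?thesis using assms
  proof cases
    case (snake_white A)
    have "\<lblot>M_term \<A> s\<rblot> = (id_v FD (A\<degree>) \<nabla> (\<lblot>Recv Black A\<rblot> \<nabla> \<lblot>Send White A\<rblot>)) \<triangleright>
        ((\<lblot>Recv White A\<rblot> \<nabla> \<lblot>Send Black A\<rblot>) \<nabla> id_v FD (A\<degree>))"
      by (simp add: snake_white cell_class append.simps(2))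
    also have "\<dots> = \<lblot>Recv White A\<rblot> \<nabla> \<lblot>Send White A\<rblot>"
      using B_yank_across[of "\<lblot>Recv White A\<rblot>" "\<lblot>Send White A\<rblot>" "A\<degree>" "A\<degree>" "[A]"] by (simp add: D_simps objs)
    finally show ?thesis by (simp add: snake_white yanks cell_class)
  next
    case (snake_black A)
    have "\<lblot>M_term \<A> s\<rblot> = ((\<lblot>Recv Black A\<rblot> \<nabla> \<lblot>Send White A\<rblot>) \<nabla> id_v FD (A\<bullet>)) \<triangleright>
        (id_v FD (A\<bullet>) \<nabla> (\<lblot>Recv White A\<rblot> \<nabla> \<lblot>Send Black A\<rblot>))"
      by (simp add: snake_black cell_class append.simps(2))
    also have "\<dots> = \<lblot>Recv Black A\<rblot> \<nabla> \<lblot>Send Black A\<rblot>"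
      using W.yank_across[of "\<lblot>Recv Black A\<rblot>" "\<lblot>Send Black A\<rblot>" "A\<bullet>" "A\<bullet>" "[A]"] by (simp add: D_simps objs)
    finally show ?thesis by (simp add: snake_black yanks cell_class)
  next
    case (eta_map f A B)
    note [simp] = homD[OF eta_map(3)]
    have "\<lblot>M_term \<A> s\<rblot> = cup f [A] [B]"
      unfolding eta_map(1,2) by (subst cup_white[OF M_Eta, where Z = "[B]"]) (simp_all add: cup_cap_simps)
    moreover have "\<lblot>M_term \<A> t\<rblot> = cup f [A] [B]"
      unfolding eta_map(1,2) by (subst cup_black[OF M_Eta, where Z = "[A]"]) (simp_all add: cup_cap_simps)
    ultimately show ?thesis by simp
  next
    case (map_eps f A B)
    note [simp] = homD[OF map_eps(3)]
    have "\<lblot>M_term \<A> s\<rblot> = cap f [A] [B]"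
      unfolding map_eps(1,2) by (subst cap_white[OF M_Eps, where Z = "[A]"]) (simp_all add: cup_cap_simps)
    moreover have "\<lblot>M_term \<A> t\<rblot> = cap f [A] [B]"
      unfolding map_eps(1,2) by (subst cap_black[OF M_Eps, where Z = "[B]"]) (simp_all add: cup_cap_simps)
    ultimately show ?thesis by simp
  next
    case (etaN_swap A B)
    have "\<lblot>M_term \<A> s\<rblot> = cup (\<sigma>\<^bsub>\<A>\<^esub> B A) [B, A] [B, A]"
      unfolding etaN_swap by (subst cup_white[OF M_EtaN, where Z = "[B, A]"]) (simp_all add: cup_cap_simps)
    moreover have "\<lblot>M_term \<A> t\<rblot> = cup (\<sigma>\<^bsub>\<A>\<^esub> B A) [B, A] [B, A]"
      unfolding etaN_swap by (subst cup_black[OF M_EtaN, where Z = "[B, A]"]) (simp_all add: cup_cap_simps)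
    ultimately show ?thesis by simp
  next
    case (swap_epsN A B)
    have "\<lblot>M_term \<A> s\<rblot> = cap (\<sigma>\<^bsub>\<A>\<^esub> B A) [A, B] [A, B]"
      unfolding swap_epsN by (subst cap_white[OF M_EpsN, where Z = "[A, B]"]) (simp_all add: cup_cap_simps)
    moreover have "\<lblot>M_term \<A> t\<rblot> = cap (\<sigma>\<^bsub>\<A>\<^esub> B A) [A, B] [A, B]"
      unfolding swap_epsN by (subst cap_black[OF M_EpsN, where Z = "[A, B]"]) (simp_all add: cup_cap_simps)
    ultimately show ?thesis by simp
  next
    case (eta_split_black A B)
    have 1: "\<lblot>M_term \<A> (EtaN B A ;; (Idn (A\<bullet> @ B\<bullet>) \<otimes> Swap White B A))\<rblot> = cup (\<sigma>\<^bsub>\<A>\<^esub> A B) [A, B] [A, B]"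
      by (subst cup_white[OF M_EtaN, where Z = "[A, B]"]) (simp_all add: cup_cap_simps)
    have "\<lblot>M_term \<A> s\<rblot> = cup (ident \<A> (A \<oplus> B)) [A, B] [A \<oplus> B]"
      unfolding eta_split_black by (subst cup_black[OF M_Eta, where Z = "[A, B]"]) (simp_all add: cup_cap_simps)
    \<comment> \<open>\<open>cup_white\<close> composes with the last factor, whereas
      \<open>;;\<close> associates to the right.\<close>
    moreover have "\<lblot>M_term \<A> t\<rblot> = cup (ident \<A> (A \<oplus> B)) [A, B] [A \<oplus> B]"
      unfolding eta_split_black by (subst M_seq_assoc, simp add: cup_cap_simps, subst cup_white[OF 1, where Z = "[A \<oplus> B]"]) (simp_all add: cup_cap_simps)
    ultimately show ?thesis by simp
  next
    case (eta_split_white A B)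
    have 1: "\<lblot>M_term \<A> (EtaN A B ;; (Swap Black B A \<otimes> Idn (A\<degree> @ B\<degree>)))\<rblot> = cup (\<sigma>\<^bsub>\<A>\<^esub> A B) [A, B] [A, B]"
      by (subst cup_black[OF M_EtaN, where Z = "[A, B]"]) (simp_all add: cup_cap_simps)
    have "\<lblot>M_term \<A> s\<rblot> = cup (\<sigma>\<^bsub>\<A>\<^esub> A B) [A \<oplus> B] [A, B]"
      unfolding eta_split_white by (subst cup_white[OF M_Eta, where Z = "[A, B]"]) (simp_all add: cup_cap_simps)
    moreover have "\<lblot>M_term \<A> t\<rblot> = cup (\<sigma>\<^bsub>\<A>\<^esub> A B) [A \<oplus> B] [A, B]"
      unfolding eta_split_white by (subst M_seq_assoc, simp add: cup_cap_simps, subst cup_black[OF 1, where Z = "[A \<oplus> B]"]) (simp_all add: cup_cap_simps)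
    ultimately show ?thesis by simp
  next
    case (merge_white_eps A B)
    have 1: "\<lblot>M_term \<A> ((Idn (A\<degree> @ B\<degree>) \<otimes> Swap Black A B) ;; EpsN A B)\<rblot> = cap (\<sigma>\<^bsub>\<A>\<^esub> B A) [A, B] [A, B]"
      by (subst cap_black[OF M_EpsN, where Z = "[A, B]"]) (simp_all add: cup_cap_simps)
    have "\<lblot>M_term \<A> s\<rblot> = cap (\<sigma>\<^bsub>\<A>\<^esub> B A) [A, B] [A \<oplus> B]"
      unfolding merge_white_eps by (subst cap_white[OF M_Eps, where Z = "[A, B]"]) (simp_all add: cup_cap_simps)
    moreover have "\<lblot>M_term \<A> t\<rblot> = cap (\<sigma>\<^bsub>\<A>\<^esub> B A) [A, B] [A \<oplus> B]"
      unfolding merge_white_eps by (subst cap_black[OF 1, where Z = "[A \<oplus> B]"]) (simp_all add: cup_cap_simps)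
    ultimately show ?thesis by simp
  next
    case (merge_black_eps A B)
    have 1: "\<lblot>M_term \<A> ((Swap White A B \<otimes> Idn (A\<bullet> @ B\<bullet>)) ;; EpsN B A)\<rblot> = cap (\<sigma>\<^bsub>\<A>\<^esub> B A) [A, B] [A, B]"
      by (subst cap_white[OF M_EpsN, where Z = "[A, B]"]) (simp_all add: cup_cap_simps)
    have "\<lblot>M_term \<A> s\<rblot> = cap (ident \<A> (A \<oplus> B)) [A \<oplus> B] [A, B]"
      unfolding merge_black_eps by (subst cap_black[OF M_Eps, where Z = "[A, B]"]) (simp_all add: cup_cap_simps)
    moreover have "\<lblot>M_term \<A> t\<rblot> = cap (ident \<A> (A \<oplus> B)) [A \<oplus> B] [A, B]"
      unfolding merge_black_eps by (subst cap_white[OF 1, where Z = "[A \<oplus> B]"]) (simp_all add: cup_cap_simps)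
    ultimately show ?thesis by simp
  qed (use False in \<open>auto\<close>)
qed

theorem eqT_M:
  assumes "eqT \<A> s t"
  shows "\<lblot>M_term \<A> s\<rblot> = \<lblot>M_term \<A> t\<rblot>"
  using assms
proof (induction rule: eqT.induct)
  case (ax s t)
  then show ?case by (rule M_axiom)
next
  case (seq_cong s s' t t')
  then show ?case using eqT_boundary[OF seq_cong(1)] eqT_boundary[OF seq_cong(2)]
    by (subst (1 2) M_seq) simp_all
next
  case (ten_cong s s' t t')
  then show ?case using eqT_boundary[OF ten_cong(1)] eqT_boundary[OF ten_cong(2)]
    by (subst (1 2) M_ten) simp_all
next
  case (seq_assoc s t u)
  then show ?case using M_seq_assoc by simp
next
  case (seq_ident_left t)
  then show ?case using M_term_boundary[of t] by (simp add: cell_class D_simps)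
next
  case (seq_ident_right t)
  then show ?case using M_term_boundary[of t] by (simp add: cell_class D_simps)
next
  case (ten_assoc s t u)
  then show ?case using M_term_boundary[of s] M_term_boundary[of t] M_term_boundary[of u]
    by (simp add: cell_class D_simps)
next
  case (ten_unit_left t)
  then show ?case using M_term_boundary[of t] by (simp add: cell_class D_simps)
next
  case (ten_unit_right t)
  then show ?case using M_term_boundary[of t] by (simp add: cell_class D_simps)
next
  case (ten_ident X Y)
  then show ?case by (simp add: cell_class D_simps)
next
  case (ten_seq s t u v)
  then show ?case
    using M_term_boundary[of s] M_term_boundary[of t] M_term_boundary[of u] M_term_boundary[of v]
    by (simp add: cell_class W.interchange_cells D_simps)
next
  case (spatial h X)
  then show ?case using M_term_boundary[of h] spatial_cells[of "M_term \<A> h" X]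
    by (simp add: cell_class D_simps)
qed simp_all

text \<open>In composites, the black corners of neighbouring factors face each other and yank. For
  horizontal composites, split and merge leave behind just the corners on the tensor of the
  edges.\<close>

lemma M_bend:
  assumes "wfC \<A> a"
  shows "\<lblot>M_term \<A> (bend a)\<rblot> = \<lblot>Recv Black (topC \<A> a)\<rblot> \<nabla> (\<lblot>a\<rblot> \<nabla> \<lblot>Send Black (botC \<A> a)\<rblot>)"
  using assms
proof (induction a)
  case (IdH A)
  then show ?case by (simp add: cell_class D_simps yanks)
next
  case (IdV X)
  note [simp] = D_simps
  let ?r = "\<lblot>Recv Black I\<rblot>" let ?s = "\<lblot>Send Black I\<rblot>"
  have "(id_v FD X \<nabla> ?s) \<triangleright> (?r \<nabla> id_v FD X) = (idH I \<nabla> (id_v FD X \<nabla> ?s)) \<triangleright> (?r \<nabla> (id_v FD X \<nabla> idH I))"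
    by simp
  also have "\<dots> = (idH I \<triangleright> ?r) \<nabla> ((id_v FD X \<triangleright> id_v FD X) \<nabla> (?s \<triangleright> idH I))"
    by (subst W.interchange_cells, simp_all del: W.unit_laws)+
  finally show ?case by (simp add: cell_class)
next
  case (Send p A)
  note [simp] = D_simps
  show ?case
  proof (cases p)
    case White
    have "\<lblot>Send Black I\<rblot> \<triangleright> (\<lblot>Recv Black A\<rblot> \<nabla> \<lblot>Send White A\<rblot>) = (\<lblot>Recv Black A\<rblot> \<nabla> \<lblot>Send White A\<rblot>) \<nabla> \<lblot>Send Black I\<rblot>"
      by (rule W.hor_eq_ver) simp_all
    then show ?thesis using White by (simp add: cell_class)
  next
    case Black
    have "\<lblot>Recv Black A\<rblot> \<nabla> (\<lblot>Send Black A\<rblot> \<nabla> \<lblot>Send Black I\<rblot>) = (\<lblot>Recv Black A\<rblot> \<nabla> \<lblot>Send Black A\<rblot>) \<nabla> \<lblot>Send Black I\<rblot>"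
      by simp
    then show ?thesis using Black by (simp add: cell_class yanks del: W.ver_assoc_cells)
  qed
next
  case (Recv p A)
  note [simp] = D_simps
  show ?case
  proof (cases p)
    case White
    have "(\<lblot>Recv White A\<rblot> \<nabla> \<lblot>Send Black A\<rblot>) \<triangleright> \<lblot>Recv Black I\<rblot> = \<lblot>Recv Black I\<rblot> \<nabla> (\<lblot>Recv White A\<rblot> \<nabla> \<lblot>Send Black A\<rblot>)"
      by (rule W.hor_eq_ver) simp_all
    then show ?thesis using White by (simp add: cell_class)
  next
    case Black
    then show ?thesis by (simp add: cell_class yanks)
  qed
next
  case (Lift f)
  then show ?case by (simp add: cell_class)
next
  case (HorC a b)
  let ?A = "topC \<A> a" let ?B = "botC \<A> a" let ?A' = "topC \<A> b" let ?B' = "botC \<A> b"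
  let ?X = "leftC a" let ?Y = "leftC b" let ?Z = "rightC b"
  let ?a = "\<lblot>a\<rblot>" let ?b = "\<lblot>b\<rblot>" let ?r = "\<lambda>A. \<lblot>Recv Black A\<rblot>" let ?s = "\<lambda>A. \<lblot>Send Black A\<rblot>"
  have wf: "wfC \<A> a" "wfC \<A> b" "rightC a = ?Y" using HorC by auto
  have wfT: "wfT \<A> (bend (a \<parallel> b))" using HorC.prems by (rule bend_wf)
  have IH: "\<lblot>M_term \<A> (bend a)\<rblot> = ?r ?A \<nabla> (?a \<nabla> ?s ?B)" "\<lblot>M_term \<A> (bend b)\<rblot> = ?r ?A' \<nabla> (?b \<nabla> ?s ?B')"
    using HorC.IH wf by simp_all
  note [simp] = D_simps objs wf bend_wf
  let ?top = "?r (?A \<oplus> ?A') \<nabla> (?s ?A \<triangleright> idH ?A')"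
  let ?bot = "(?s ?B \<triangleright> idH ?B') \<nabla> ?s ?B'"
  have "\<lblot>M_term \<A> (bend (a \<parallel> b))\<rblot> = \<lblot>M_term \<A> (Idn ?X \<otimes> Split Black ?B ?B')\<rblot> \<triangleright>
      (\<lblot>M_term \<A> (bend a \<otimes> Idn (?B'\<bullet>))\<rblot> \<triangleright> (\<lblot>M_term \<A> (Idn (?A\<bullet>) \<otimes> bend b)\<rblot> \<triangleright>
      \<lblot>M_term \<A> (Merge Black ?A ?A' \<otimes> Idn ?Z)\<rblot>))"
    using wfT by (simp add: M_seq del: M_term.simps(10,11))
  \<comment> \<open>Evaluated from the right: the send corner on \<open>?A'\<close> in the merge
    cancels the receive corner of \<open>bend b\<close>.\<close>
  also have "\<lblot>M_term \<A> (Idn (?A\<bullet>) \<otimes> bend b)\<rblot> \<triangleright> \<lblot>M_term \<A> (Merge Black ?A ?A' \<otimes> Idn ?Z)\<rblot> =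
      (id_v FD (?A\<bullet>) \<nabla> (?r ?A' \<nabla> (?b \<nabla> ?s ?B'))) \<triangleright> ((?top \<nabla> ?s ?A') \<nabla> id_v FD ?Z)"
    by (simp add: M_ten IH cell_class del: M_term.simps(11))
  also have "\<dots> = ?top \<nabla> (?b \<nabla> ?s ?B')"
    using B_yank_across[of ?top "?b \<nabla> ?s ?B'" "?A\<bullet>" ?Z "[?A']"] by simp
  \<comment> \<open>Both factors are written with five rows, so that \<open>a\<close> and
    \<open>b\<close> stand side by side and the corners on \<open>?A\<close> yank.\<close>
  also have "\<lblot>M_term \<A> (bend a \<otimes> Idn (?B'\<bullet>))\<rblot> \<triangleright> (?top \<nabla> (?b \<nabla> ?s ?B')) =
      (idH I \<nabla> (?r ?A \<nabla> (?a \<nabla> (?s ?B \<nabla> id_v FD (?B'\<bullet>))))) \<triangleright>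
      (?r (?A \<oplus> ?A') \<nabla> ((?s ?A \<triangleright> idH ?A') \<nabla> (?b \<nabla> (idH ?B' \<nabla> ?s ?B'))))"
    by (simp add: M_ten IH cell_class del: M_term.simps(11))
  also have "\<dots> = (idH I \<triangleright> ?r (?A \<oplus> ?A')) \<nabla> ((?r ?A \<triangleright> (?s ?A \<triangleright> idH ?A')) \<nabla> ((?a \<triangleright> ?b) \<nabla>
      ((?s ?B \<triangleright> idH ?B') \<nabla> (id_v FD (?B'\<bullet>) \<triangleright> ?s ?B'))))"
    by (subst W.interchange_cells, simp_all del: W.unit_laws)+
  also have "?r ?A \<triangleright> (?s ?A \<triangleright> idH ?A') = idH (?A \<oplus> ?A')"
    by (subst W.hor_assoc_cells[symmetric]) (simp_all add: yanks)
  also have "(idH I \<triangleright> ?r (?A \<oplus> ?A')) \<nabla> (idH (?A \<oplus> ?A') \<nabla> ((?a \<triangleright> ?b) \<nabla>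
      ((?s ?B \<triangleright> idH ?B') \<nabla> (id_v FD (?B'\<bullet>) \<triangleright> ?s ?B')))) = (?r (?A \<oplus> ?A') \<nabla> (?a \<triangleright> ?b)) \<nabla> B.send [?B, ?B']"
    by simp
  also have "\<lblot>M_term \<A> (Idn ?X \<otimes> Split Black ?B ?B')\<rblot> \<triangleright> ((?r (?A \<oplus> ?A') \<nabla> (?a \<triangleright> ?b)) \<nabla> B.send [?B, ?B']) =
      (id_v FD ?X \<nabla> (B.recv [?B, ?B'] \<nabla> ?s (?B \<oplus> ?B'))) \<triangleright> (((?r (?A \<oplus> ?A') \<nabla> (?a \<triangleright> ?b)) \<nabla> B.send [?B, ?B']) \<nabla> id_v FD [])"
    by (simp add: cell_class)
  also have "\<dots> = (?r (?A \<oplus> ?A') \<nabla> (?a \<triangleright> ?b)) \<nabla> ?s (?B \<oplus> ?B')"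
    by (rule B_yank_across) simp_all
  finally show ?case by (simp add: cell_class del: M_term.simps bend.simps)
next
  case (VerC a b)
  let ?A = "topC \<A> a" let ?B = "topC \<A> b" let ?C = "botC \<A> b"
  let ?a = "\<lblot>a\<rblot>" let ?b = "\<lblot>b\<rblot>" let ?r = "\<lambda>A. \<lblot>Recv Black A\<rblot>" let ?s = "\<lambda>A. \<lblot>Send Black A\<rblot>"
  have wf: "wfC \<A> a" "wfC \<A> b" "botC \<A> a = ?B" using VerC by auto
  have wfT: "wfT \<A> (bend (a \<Down> b))" using VerC.prems by (rule bend_wf)
  have IH: "\<lblot>M_term \<A> (bend a)\<rblot> = ?r ?A \<nabla> (?a \<nabla> ?s ?B)" "\<lblot>M_term \<A> (bend b)\<rblot> = ?r ?B \<nabla> (?b \<nabla> ?s ?C)"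
    using VerC.IH wf by simp_all
  note [simp] = D_simps objs wf bend_wf
  have "\<lblot>M_term \<A> (bend (a \<Down> b))\<rblot> = \<lblot>M_term \<A> (Idn (leftC a) \<otimes> bend b)\<rblot> \<triangleright> \<lblot>M_term \<A> (bend a \<otimes> Idn (rightC b))\<rblot>"
    using wfT by (simp add: M_seq del: M_term.simps(10,11))
  also have "\<dots> = (id_v FD (leftC a) \<nabla> (B.recv [?B] \<nabla> (?b \<nabla> ?s ?C))) \<triangleright> (((?r ?A \<nabla> ?a) \<nabla> B.send [?B]) \<nabla> id_v FD (rightC b))"
    by (simp add: M_ten IH cell_class del: M_term.simps(11))
  also have "\<dots> = (?r ?A \<nabla> ?a) \<nabla> (?b \<nabla> ?s ?C)"
    by (rule B_yank_across) simp_all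
  finally show ?case by (simp add: cell_class del: M_term.simps bend.simps)
qed

section \<open>The functor, its fullness and its faithfulness\<close>

lemma M_functor_class:
  assumes "wfT \<A> t"
  shows "arr_map (M_functor \<A>) (classT \<A> t) = \<lblot>M_term \<A> t\<rblot>"
proof -
  have "\<lblot>M_term \<A> u\<rblot> = \<lblot>M_term \<A> t\<rblot>" if "u \<in> classT \<A> t" for u
    using that eqT_M[of t u] by (simp add: classT_def)
  then have "(\<Union>u \<in> classT \<A> t. \<lblot>M_term \<A> u\<rblot>) = \<lblot>M_term \<A> t\<rblot>"
    using classT_self[OF assms] by blast
  then show ?thesis by (simp add: M_functor_def)
qed

lemma M_functor_ob: "ob_map (M_functor \<A>) X = X"
  by (simp add: M_functor_def)

lemma horizontal_cells_simps:
  "ident (horizontal_cells FD) X = id_v FD X" "comp_arr (horizontal_cells FD) a b = a \<triangleright> b"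
  "tensor_ob (horizontal_cells FD) = (@)" "unit_ob (horizontal_cells FD) = []"
  "tensor_arr (horizontal_cells FD) a b = a \<nabla> b"
  by (simp_all add: horizontal_cells_def FD_ob)

lemma strict_monoidal_functor_M:
  "strict_monoidal_functor (T_category \<A>) (horizontal_cells FD) (M_functor \<A>)"
proof (intro strict_monoidal_functor.intro strict_monoidal_functor_axioms.intro, goal_cases)
  case 1 show ?case by (rule T.strict_monoidal_category_axioms)
next
  case 2 show ?case by (rule W.strict_monoidal_category_horizontal_cells)
next
  case (3 f X Y)
  then obtain t where "f = \<langle>t\<rangle>" "wfT \<A> t" "srcT \<A> t = X" "tgtT \<A> t = Y" by (auto simp: hom_T_category)
  then show ?case
    using M_term_boundary[of t]
    by (auto simp: hom_horizontal_cells cell_free_cornering M_functor_class M_functor_ob FD_ob)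
next
  case (4 X)
  then show ?case
    by (simp add: T_category_simps(3) M_functor_class M_Idn M_functor_ob horizontal_cells_simps del: M_term.simps)
next
  case (5 f X Y g Z)
  then obtain s t where "f = \<langle>s\<rangle>" "wfT \<A> s" "tgtT \<A> s = Y" "g = \<langle>t\<rangle>" "wfT \<A> t" "srcT \<A> t = Y"
    by (auto simp: hom_T_category)
  then show ?case
    by (simp add: seq_classT M_functor_class M_seq horizontal_cells_simps del: M_term.simps)
next
  case (6 X Y)
  then show ?case by (simp add: M_functor_ob horizontal_cells_simps T_category_simps)
next
  case 7
  then show ?case by (simp add: M_functor_ob horizontal_cells_simps T_category_simps)
next
  case (8 f g)
  then obtain s t where "f = \<langle>s\<rangle>" "wfT \<A> s" "g = \<langle>t\<rangle>" "wfT \<A> t"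
    by (auto simp: arrows_T_category)
  then show ?case
    by (simp add: ten_classT M_functor_class M_ten horizontal_cells_simps del: M_term.simps)
qed

lemma full_M: "full (T_category \<A>) (horizontal_cells FD) (M_functor \<A>)"
  unfolding full_def
proof (intro allI ballI)
  fix X Y g
  assume "g \<in> hom (horizontal_cells FD) (ob_map (M_functor \<A>) X) (ob_map (M_functor \<A>) Y)"
  then obtain a where a: "g = \<lblot>a\<rblot>" "wfC \<A> a" "leftC a = X" "rightC a = Y" "topC \<A> a = I" "botC \<A> a = I"
    by (auto simp: hom_horizontal_cells cell_free_cornering M_functor_ob FD_ob)
  note [simp] = D_simps a bend_wf
  let ?r = "\<lblot>Recv Black I\<rblot>" let ?s = "\<lblot>Send Black I\<rblot>"
  \<comment> \<open>\<open>M\<close> sends \<open>Iota Black\<close> and \<open>Kappa Black\<close>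
    to black corners on \<open>I\<close>; these yank against the two corners that
    \<open>M_bend\<close> leaves around \<open>a\<close>.\<close>
  let ?t = "(Idn X \<otimes> Iota Black) ;; bend a ;; (Kappa Black \<otimes> Idn Y)"
  have wf: "wfT \<A> ?t" by simp
  have "\<lblot>M_term \<A> ?t\<rblot> = (id_v FD X \<nabla> ?r) \<triangleright> ((?r \<nabla> (\<lblot>a\<rblot> \<nabla> ?s)) \<triangleright> (?s \<nabla> id_v FD Y))"
    using wf by (simp add: M_seq M_ten M_Idn M_bend del: M_term.simps(1,10,11))
  also have "(?r \<nabla> (\<lblot>a\<rblot> \<nabla> ?s)) \<triangleright> (?s \<nabla> id_v FD Y) = (?r \<nabla> (\<lblot>a\<rblot> \<nabla> ?s)) \<triangleright> (?s \<nabla> (id_v FD Y \<nabla> idH I))"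
    by simp
  also have "\<dots> = (?r \<triangleright> ?s) \<nabla> ((\<lblot>a\<rblot> \<triangleright> id_v FD Y) \<nabla> (?s \<triangleright> idH I))"
    by (subst W.interchange_cells, simp_all del: W.unit_laws)+
  also have "\<dots> = \<lblot>a\<rblot> \<nabla> ?s"
    by (simp add: yanks)
  also have "(id_v FD X \<nabla> ?r) \<triangleright> (\<lblot>a\<rblot> \<nabla> ?s) = (id_v FD X \<triangleright> \<lblot>a\<rblot>) \<nabla> (?r \<triangleright> ?s)"
    by (rule W.interchange_cells) simp_all
  finally have "\<lblot>M_term \<A> ?t\<rblot> = g" by (simp add: yanks)
  then have "arr_map (M_functor \<A>) \<langle>?t\<rangle> = g" using M_functor_class[OF wf] by simp
  moreover have "\<langle>?t\<rangle> \<in> hom (T_category \<A>) X Y"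
    unfolding hom_T_category by (intro exI[of _ ?t]) simp
  ultimately show "\<exists>f \<in> hom (T_category \<A>) X Y. arr_map (M_functor \<A>) f = g" by blast
qed

text \<open>Padding composes with invertible arrows only, so it loses no information about
  \<open>t\<close>; this gives faithfulness.\<close>

lemma pad_cancel:
  assumes "wfT \<A> t"
  shows "wh (srcT \<A> t) \<iota>b [] \<star> pad t \<star> wh [] \<kappa>b (tgtT \<A> t) = \<langle>t\<rangle>"
  unfolding pad_def using assms
  by (simp add: T_simps T.comp_reassoc[OF iota_kappa_wh(1)] iota_kappa_wh)

lemma faithful_M: "faithful (T_category \<A>) (M_functor \<A>)"
  unfolding faithful_def
proof (intro allI ballI impI)
  fix X Y f g
  assume "f \<in> hom (T_category \<A>) X Y" "g \<in> hom (T_category \<A>) X Y"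
    and eq: "arr_map (M_functor \<A>) f = arr_map (M_functor \<A>) g"
  then obtain s t where f: "f = \<langle>s\<rangle>" "wfT \<A> s" "srcT \<A> s = X" "tgtT \<A> s = Y"
    and g: "g = \<langle>t\<rangle>" "wfT \<A> t" "srcT \<A> t = X" "tgtT \<A> t = Y"
    by (auto simp: hom_T_category)
  have "\<lblot>M_term \<A> s\<rblot> = \<lblot>M_term \<A> t\<rblot>" using eq f g by (simp add: M_functor_class)
  then have "eqC \<A> (M_term \<A> s) (M_term \<A> t)"
    using classC_eq_iff[of "M_term \<A> s"] M_term_boundary[OF f(2)] by simp
  then have "pad s = pad t" using eqC_bend bend_M f(2) g(2) by metis
  then show "f = g" using pad_cancel[OF f(2)] pad_cancel[OF g(2)] f g by simp
qed

end

theorem proposition7p1: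
  fixes \<A> :: "('o, 'm) ssmc"
  assumes "symmetric_strict_monoidal_category \<A>"
  shows "strict_monoidal_functor (T_category \<A>) (horizontal_cells (free_cornering \<A>)) (M_functor \<A>)
    \<and> full (T_category \<A>) (horizontal_cells (free_cornering \<A>)) (M_functor \<A>)
    \<and> faithful (T_category \<A>) (M_functor \<A>)
    \<and> identity_on_objects (M_functor \<A>)"
proof -
  interpret symmetric_strict_monoidal_base \<A>
    using assms by (rule symmetric_strict_monoidal_base.intro)
  show ?thesis
    using strict_monoidal_functor_M full_M faithful_M M_functor_ob
    by (simp add: identity_on_objects_def)
qed

end
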